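(* Let $m:\widehat\Gamma\to\{0,1,2,\dots\}$ be a Borel function satisfying the consistency inequality $m(\omega)\le\sum_{\alpha^*(\zeta)=\omega}m(\zeta)$, and let $H=[h_{i,j}]$ be a filter relative to $m$ and $\alpha^*$ such that the Ruelle operator $S_H$ is a pure isometry on $\bigoplus_i L^2(\sigma_i)$. Let $\widetilde m(\omega)=\sum_{\alpha^*(\zeta)=\omega}m(\zeta)-m(\omega)$, and let $G$ be a complementary filter to $H$. Define $\mathcal V_0=\bigoplus_i L^2(\sigma_i)$ and $\mathcal W_0=\bigoplus_k L^2(\widetilde\sigma_k)$. For $n\ge 1$ inductively set $\mathcal W_n=\mathcal D(\mathcal W_{n-1})$ (the dilation by $\alpha^*$ of $\mathcal W_{n-1}$), and set $\mathcal H=\mathcal V_0\oplus\bigoplus_{n=0}^\infty\mathcal W_n$. Define a representation $\pi$ of $\Gamma$ on $\mathcal H$ by $[\pi_\gamma(f)](\omega)=\omega(\gamma)f(\omega)$ (in every component). Writing $f\in\mathcal H$ as $\{f_{\mathcal V_0},f_{\mathcal W_0},f_{\mathcal W_1},\dots\}$, define an operator $T$ on $\mathcal H$ by \[ [T(f)]_{\mathcal V_0}=S_H(f_{\mathcal V_0})+S_G(f_{\mathcal W_0}),\qquad [T(f)]_{\mathcal W_n}=\mathcal D^{-1}(f_{\mathcal W_{n+1}})\quad (n\ge 0). \] Then: (1) $T$ is a unitary operator on $\mathcal H$. (2) $T\pi_\gamma T^{-1}=\pi_{\alpha(\gamma)}$ for all $\gamma\in\Gamma$. (3) If $\mathcal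 V_j$ is defined to be $T^{-j}(\mathcal V_0)$ for $j\in\mathbb Z$, then the collection $\{\mathcal V_j\}$ is a GMRA relative to $\pi$ and $\delta$, where $\delta=T^{-1}$. (4) The multiplicity function associated to the core subspace $\mathcal V_0$ is the given function $m$, and the given $H$ is a filter constructed from the GMRA $\{\mathcal V_j\}$.
   Context: Setting: $\Gamma$ is a countable (discrete) abelian group, $\alpha:\Gamma\to\Gamma$ is an injective homomorphism whose image has finite index $N>1$ in $\Gamma$, and $\bigcap_{n}\alpha^n(\Gamma)=\{0\}$. $\widehat\Gamma$ is the (compact) dual group, written multiplicatively, with Haar measure $\mu$. The dual endomorphism $\alpha^*:\widehat\Gamma\to\widehat\Gamma$, $[\alpha^*(\omega)](\gamma)=\omega(\alpha(\gamma))$, is onto and its kernel has exactly $N$ elements. Sets and functions on $\widehat\Gamma$ are considered up to Haar-null sets, identities and inequalities are understood almost everywhere, and $L^2(\sigma)$ for Borel $\sigma\subseteq\widehat\Gamma$ is taken with respect to Haar measure restricted to $\sigma$. Multiplicity functions and filters: put $\sigma_i=\{\omega:m(\omega)\ge i\}$ and $\widetilde\sigma_k=\{\omega:\widetilde m(\omega)\ge k\}$ for $i,k\ge1$. A filter relative to $m$ and $\alpha^*$ is a (possibly infinite) matrix $H=[h_{i,j}]$ of Borel complex-valued functions on $\widehat\Gamma$, with each $h_{i,j}$ supported in $\sigma_j$, such that $\sum_{\alpha^*(\zeta)=\omega}\sum_j h_{i,j}(\zeta)\overline{h_{i',j}(\zeta)}=N\delta_{i,i'}\chi_{\sigma_i}(\omega)$.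 A complementary filter to $H$ is a (possibly infinite) matrix $G=[g_{k,j}]$ of Borel complex-valued functions, with each $g_{k,j}$ supported in $\sigma_j$, such that $\sum_{\alpha^*(\zeta)=\omega}\sum_j g_{k,j}(\zeta)\overline{g_{k',j}(\zeta)}=N\delta_{k,k'}\chi_{\widetilde\sigma_k}(\omega)$ and $\sum_{\alpha^*(\zeta)=\omega}\sum_j g_{k,j}(\zeta)\overline{h_{i,j}(\zeta)}=0$. The Ruelle operators are $S_H$ on $\bigoplus_iL^2(\sigma_i)$, $[S_H(f)](\omega)=H^t(\omega)f(\alpha^*(\omega))$, and $S_G:\bigoplus_kL^2(\widetilde\sigma_k)\to\bigoplus_iL^2(\sigma_i)$, $[S_G(f)](\omega)=G^t(\omega)f(\alpha^*(\omega))$. An isometry $S$ on a Hilbert space $\mathcal K$ is pure if $\bigcap_{n\ge0}S^n(\mathcal K)=\{0\}$. Dilation by $\alpha^*$: fix a Borel cross-section $c:\widehat\Gamma\to\widehat\Gamma$ of $\alpha^*$ (so $\alpha^*(c(\omega))=\omega$) and let $\tau(\omega)=c(\alpha^*(\omega))\omega^{-1}\in\ker\alpha^*$. Given a space $\mathcal K=\bigoplus_iL^2(E_i,\nu_i)$ (countable direct sum, $E_i\subseteq\widehat\Gamma$ Borel, $\nu_i$ a finite Borel measure on $E_i$), for $\zeta\in\ker\alpha^*$ put $E_{i,\zeta}=\{\omega\in E_i:\tau(\omega)=\zeta\}$, $E'_{i,\zeta}=\alpha^*(E_{i,\zeta})$, $\nu'_{i,\zeta}(F)=N\nu_i(E_{i,\zeta}\cap{\alpha^*}^{-1}(F))$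 for $F\subseteq E'_{i,\zeta}$, and $\mathcal D(\mathcal K)=\bigoplus_{i,\zeta}L^2(E'_{i,\zeta},\nu'_{i,\zeta})$, with $\mathcal D:\mathcal K\to\mathcal D(\mathcal K)$, $[\mathcal D(f)]_{i,\zeta}(\omega)=\frac1{\sqrt N}f_i(\zeta^{-1}c(\omega))$. This $\mathcal D$ is a surjective isometry, with inverse $[\mathcal D^{-1}(f)]_i(\omega)=\sqrt N f_{i,\tau(\omega)}(\alpha^*(\omega))$. GMRA: let $\pi$ be a unitary representation of $\Gamma$ and $\delta$ a unitary operator on a separable Hilbert space $\mathcal H$ with $\delta^{-1}\pi_\gamma\delta=\pi_{\alpha(\gamma)}$ for all $\gamma$. A collection $\{V_j\}_{j\in\mathbb Z}$ of closed subspaces is a GMRA relative to $\pi$ and $\delta$ if $V_j\subseteq V_{j+1}$ and $V_{j+1}=\delta(V_j)$ for all $j$, $\bigcap_jV_j=\{0\}$, $\bigcup_jV_j$ is dense in $\mathcal H$, and $V_0$ (the core subspace) is invariant under $\pi$. The multiplicity function associated to $V_0$ (when the associated measure is absolutely continuous with respect to Haar measure) is the function $m=\sum_i\chi_{\sigma_i}$ where $\sigma_1\supseteq\sigma_2\supseteq\cdots$ are the Borel sets, unique up to null sets, for which there is a unitary $J:V_0\to\bigoplus_iL^2(\sigma_i)$ with $[J(\pi_\gamma f)](\omega)=\omega(\gamma)[J(f)](\omega)$. A matrix $H=[h_{i,j}]$ is a filter constructed from the GMRA if for some such $J$ one has $\bigoplus_jh_{i,j}=J(\delta^{-1}(J^{-1}(C_i)))$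 for all $i$, where $C_i\in\bigoplus_jL^2(\sigma_j)$ has $i$th coordinate $\chi_{\sigma_i}$ and other coordinates $0$. *)

theory Defs
  imports "HOL-Analysis.Analysis"
begin

text \<open>
  The spaces below depend on terms (a Haar measure, a multiplicity function), so Hilbert spaces
  are structures with a carrier set rather than types.  The inner product is linear in the first
  argument.
\<close>

record 'v hspace =
  hcarrier :: "'v set"
  hzero :: "'v"
  hadd :: "'v \<Rightarrow> 'v \<Rightarrow> 'v"
  hscale :: "complex \<Rightarrow> 'v \<Rightarrow> 'v"
  hinner :: "'v \<Rightarrow> 'v \<Rightarrow> complex"

definition hnorm :: "'v hspace \<Rightarrow> 'v \<Rightarrow> real" where
  "hnorm V x = sqrt (Re (hinner V x x))"

text \<open>\<^locale>\<open>Metric_space\<close> demands nonnegativity and symmetry off the carrier as well, hence the default 0.\<close>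

definition hdist :: "'v hspace \<Rightarrow> 'v \<Rightarrow> 'v \<Rightarrow> real" where
  "hdist V x y =
    (if x \<in> hcarrier V \<and> y \<in> hcarrier V then hnorm V (hadd V x (hscale V (-1) y)) else 0)"

definition htopology :: "'v hspace \<Rightarrow> 'v topology" where
  "htopology V = Metric_space.mtopology (hcarrier V) (hdist V)"

locale complex_inner_space =
  fixes V :: "'v hspace"
  assumes zero_closed: "hzero V \<in> hcarrier V"
    and add_closed: "\<lbrakk>x \<in> hcarrier V; y \<in> hcarrier V\<rbrakk> \<Longrightarrow> hadd V x y \<in> hcarrier V"
    and scale_closed: "x \<in> hcarrier V \<Longrightarrow> hscale V a x \<in> hcarrier V"
    and add_assoc: "\<lbrakk>x \<in> hcarrier V; y \<in> hcarrier V; z \<in> hcarrier V\<rbrakk>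
      \<Longrightarrow> hadd V (hadd V x y) z = hadd V x (hadd V y z)"
    and add_commute: "\<lbrakk>x \<in> hcarrier V; y \<in> hcarrier V\<rbrakk> \<Longrightarrow> hadd V x y = hadd V y x"
    and add_zero: "x \<in> hcarrier V \<Longrightarrow> hadd V x (hzero V) = x"
    and add_minus: "x \<in> hcarrier V \<Longrightarrow> hadd V x (hscale V (-1) x) = hzero V"
    and scale_one: "x \<in> hcarrier V \<Longrightarrow> hscale V 1 x = x"
    and scale_scale: "x \<in> hcarrier V \<Longrightarrow> hscale V a (hscale V b x) = hscale V (a * b) x"
    and scale_add_left: "x \<in> hcarrier V
      \<Longrightarrow> hscale V (a + b) x = hadd V (hscale V a x) (hscale V b x)"
    and scale_add_right: "\<lbrakk>x \<in> hcarrier V; y \<in> hcarrier V\<rbrakk>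
      \<Longrightarrow> hscale V a (hadd V x y) = hadd V (hscale V a x) (hscale V a y)"
    and inner_add_left: "\<lbrakk>x \<in> hcarrier V; y \<in> hcarrier V; z \<in> hcarrier V\<rbrakk>
      \<Longrightarrow> hinner V (hadd V x y) z = hinner V x z + hinner V y z"
    and inner_scale_left: "\<lbrakk>x \<in> hcarrier V; y \<in> hcarrier V\<rbrakk>
      \<Longrightarrow> hinner V (hscale V a x) y = a * hinner V x y"
    and inner_commute: "\<lbrakk>x \<in> hcarrier V; y \<in> hcarrier V\<rbrakk> \<Longrightarrow> hinner V x y = cnj (hinner V y x)"
    and inner_nonneg: "x \<in> hcarrier V \<Longrightarrow> 0 \<le> Re (hinner V x x)"
    and inner_definite: "\<lbrakk>x \<in> hcarrier V; hinner V x x = 0\<rbrakk> \<Longrightarrow> x = hzero V"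

locale hilbert_space = complex_inner_space +
  assumes complete: "Metric_space.mcomplete (hcarrier V) (hdist V)"

definition linear_op :: "'v hspace \<Rightarrow> 'w hspace \<Rightarrow> ('v \<Rightarrow> 'w) \<Rightarrow> bool" where
  "linear_op V W S \<longleftrightarrow>
    (\<forall>x\<in>hcarrier V. S x \<in> hcarrier W) \<and>
    (\<forall>x\<in>hcarrier V. \<forall>y\<in>hcarrier V. S (hadd V x y) = hadd W (S x) (S y)) \<and>
    (\<forall>a. \<forall>x\<in>hcarrier V. S (hscale V a x) = hscale W a (S x))"

definition isometry_op :: "'v hspace \<Rightarrow> 'w hspace \<Rightarrow> ('v \<Rightarrow> 'w) \<Rightarrow> bool" where
  "isometry_op V W S \<longleftrightarrow> linear_op V W S \<and> (\<forall>x\<in>hcarrier V. hnorm W (S x) = hnorm V x)"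

definition pure_isometry :: "'v hspace \<Rightarrow> ('v \<Rightarrow> 'v) \<Rightarrow> bool" where
  "pure_isometry V S \<longleftrightarrow> isometry_op V V S \<and> (\<Inter>n. (S ^^ n) ` hcarrier V) = {hzero V}"

definition unitary_op :: "'v hspace \<Rightarrow> 'w hspace \<Rightarrow> ('v \<Rightarrow> 'w) \<Rightarrow> bool" where
  "unitary_op V W U \<longleftrightarrow> linear_op V W U \<and> bij_betw U (hcarrier V) (hcarrier W) \<and>
    (\<forall>x\<in>hcarrier V. \<forall>y\<in>hcarrier V. hinner W (U x) (U y) = hinner V x y)"

definition op_inverse :: "'v hspace \<Rightarrow> ('v \<Rightarrow> 'w) \<Rightarrow> 'w \<Rightarrow> 'v" where
  "op_inverse V U = inv_into (hcarrier V) U"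

definition op_powi :: "'v hspace \<Rightarrow> ('v \<Rightarrow> 'v) \<Rightarrow> int \<Rightarrow> 'v \<Rightarrow> 'v" where
  "op_powi V U j = (if 0 \<le> j then U ^^ nat j else op_inverse V U ^^ nat (- j))"

definition closed_subspace :: "'v hspace \<Rightarrow> 'v set \<Rightarrow> bool" where
  "closed_subspace V U \<longleftrightarrow> U \<subseteq> hcarrier V \<and> hzero V \<in> U \<and>
    (\<forall>x\<in>U. \<forall>y\<in>U. hadd V x y \<in> U) \<and> (\<forall>a. \<forall>x\<in>U. hscale V a x \<in> U) \<and>
    closedin (htopology V) U"

definition hsum :: "'i set \<Rightarrow> ('i \<Rightarrow> 'v hspace) \<Rightarrow> ('i \<Rightarrow> 'v) hspace" where
  "hsum I V = \<lparr>
    hcarrier = {f \<in> \<Pi>\<^sub>E i\<in>I. hcarrier (V i). (\<lambda>i. (hnorm (V i) (f i))\<^sup>2) summable_on I},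
    hzero = (\<lambda>i\<in>I. hzero (V i)),
    hadd = (\<lambda>f g. \<lambda>i\<in>I. hadd (V i) (f i) (g i)),
    hscale = (\<lambda>a f. \<lambda>i\<in>I. hscale (V i) a (f i)),
    hinner = (\<lambda>f g. \<Sum>\<^sub>\<infinity>i\<in>I. hinner (V i) (f i) (g i))\<rparr>"

definition hprod :: "'v hspace \<Rightarrow> 'w hspace \<Rightarrow> ('v \<times> 'w) hspace" where
  "hprod V W = \<lparr>
    hcarrier = hcarrier V \<times> hcarrier W,
    hzero = (hzero V, hzero W),
    hadd = (\<lambda>x y. (hadd V (fst x) (fst y), hadd W (snd x) (snd y))),
    hscale = (\<lambda>a x. (hscale V a (fst x), hscale W a (snd x))),
    hinner = (\<lambda>x y. hinner V (fst x) (fst y) + hinner W (snd x) (snd y))\<rparr>"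

definition l2_class :: "'x measure \<Rightarrow> ('x \<Rightarrow> complex) \<Rightarrow> ('x \<Rightarrow> complex) set" where
  "l2_class M f = {g \<in> borel_measurable M. AE x in M. g x = f x}"

text \<open>
  The values of class members outside the space of the measure are arbitrary; extending by 0 makes
  elements of \<open>L2 (restrict_space \<mu> E)\<close> functions on the whole dual group that vanish off \<open>E\<close>.
\<close>

definition l2_fun :: "'x measure \<Rightarrow> ('x \<Rightarrow> complex) set \<Rightarrow> 'x \<Rightarrow> complex" where
  "l2_fun M F x = (if x \<in> space M then (SOME f. f \<in> F) x else 0)"

definition L2 :: "'x measure \<Rightarrow> ('x \<Rightarrow> complex) set hspace" where
  "L2 M = \<lparr>
    hcarrier = l2_class M ` {f \<in> borel_measurable M. integrable M (\<lambda>x. (cmod (f x))\<^sup>2)},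
    hzero = l2_class M (\<lambda>_. 0),
    hadd = (\<lambda>F G. l2_class M (\<lambda>x. l2_fun M F x + l2_fun M G x)),
    hscale = (\<lambda>a F. l2_class M (\<lambda>x. a * l2_fun M F x)),
    hinner = (\<lambda>F G. integral\<^sup>L M (\<lambda>x. l2_fun M F x * cnj (l2_fun M G x)))\<rparr>"

text \<open>
  A pair \<open>(I, \<nu>)\<close> of an index set and a family of measures, the measure \<open>\<nu> i\<close> having the Borel set
  \<open>E i\<close> as its underlying space, encodes the data of the direct sum of the spaces \<open>L2 (E i, \<nu> i)\<close>.
\<close>

type_synonym ('i, 'x) mfam = "'i set \<times> ('i \<Rightarrow> 'x measure)"

definition L2_sum :: "('i, 'x) mfam \<Rightarrow> ('i \<Rightarrow> ('x \<Rightarrow> complex) set) hspace" where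
  "L2_sum K = hsum (fst K) (\<lambda>i. L2 (snd K i))"

text \<open>
  Characters are functions on the discrete group; the topology of the dual group is the product
  topology (pointwise convergence) inherited from the function type.
\<close>

type_synonym 'g character = "'g \<Rightarrow> complex"

definition dual_group :: "'g::ab_group_add character set" where
  "dual_group = {\<omega>. (\<forall>x. cmod (\<omega> x) = 1) \<and> (\<forall>x y. \<omega> (x + y) = \<omega> x * \<omega> y)}"

definition char_mult :: "'g character \<Rightarrow> 'g character \<Rightarrow> 'g character" where
  "char_mult \<omega> \<zeta> = (\<lambda>x. \<omega> x * \<zeta> x)"

definition char_inv :: "'g character \<Rightarrow> 'g character" where
  "char_inv \<omega> = (\<lambda>x. inverse (\<omega> x))"

definition haar_measure :: "'g::{ab_group_add,countable} character measure \<Rightarrow> bool" where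
  "haar_measure \<mu> \<longleftrightarrow> sets \<mu> = sets (restrict_space borel dual_group) \<and>
    emeasure \<mu> dual_group = 1 \<and>
    (\<forall>\<omega>\<in>dual_group. \<forall>A\<in>sets \<mu>. emeasure \<mu> (char_mult \<omega> ` A) = emeasure \<mu> A)"

definition image_index :: "('g::ab_group_add \<Rightarrow> 'g) \<Rightarrow> nat" where
  "image_index \<alpha> = card (UNIV // {(x, y). x - y \<in> range \<alpha>})"

definition dual_endo :: "('g \<Rightarrow> 'g) \<Rightarrow> 'g character \<Rightarrow> 'g character" where
  "dual_endo \<alpha> \<omega> = (\<lambda>x. \<omega> (\<alpha> x))"

definition dual_ker :: "('g::ab_group_add \<Rightarrow> 'g) \<Rightarrow> 'g character set" where
  "dual_ker \<alpha> = {\<zeta> \<in> dual_group. dual_endo \<alpha> \<zeta> = (\<lambda>_. 1)}"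

definition dual_fiber :: "('g::ab_group_add \<Rightarrow> 'g) \<Rightarrow> 'g character \<Rightarrow> 'g character set" where
  "dual_fiber \<alpha> \<omega> = {\<zeta> \<in> dual_group. dual_endo \<alpha> \<zeta> = \<omega>}"

definition level :: "('g::ab_group_add character \<Rightarrow> nat) \<Rightarrow> nat \<Rightarrow> 'g character set" where
  "level m i = {\<omega> \<in> dual_group. i \<le> m \<omega>}"

definition level_fam :: "'g::ab_group_add character measure \<Rightarrow> ('g character \<Rightarrow> nat)
    \<Rightarrow> (nat, 'g character) mfam" where
  "level_fam \<mu> m = ({1..}, \<lambda>i. restrict_space \<mu> (level m i))"

definition consistency_inequality :: "'g::ab_group_add character measure \<Rightarrow> ('g \<Rightarrow> 'g)
    \<Rightarrow> ('g character \<Rightarrow> nat) \<Rightarrow> bool" where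
  "consistency_inequality \<mu> \<alpha> m \<longleftrightarrow> (AE \<omega> in \<mu>. m \<omega> \<le> (\<Sum>\<zeta>\<in>dual_fiber \<alpha> \<omega>. m \<zeta>))"

text \<open>The consistency inequality makes the truncated subtraction exact almost everywhere.\<close>

definition co_mult :: "('g::ab_group_add \<Rightarrow> 'g) \<Rightarrow> ('g character \<Rightarrow> nat) \<Rightarrow> 'g character \<Rightarrow> nat" where
  "co_mult \<alpha> m \<omega> = (\<Sum>\<zeta>\<in>dual_fiber \<alpha> \<omega>. m \<zeta>) - m \<omega>"

text \<open>
  Matrices are indexed by \<open>i, j \<ge> 1\<close>.  The infinite sums over \<open>j\<close> are finite almost everywhere,
  because the entries of column \<open>j\<close> vanish off \<open>level m j\<close> and \<open>m\<close> is finite.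
\<close>

type_synonym 'g fmatrix = "nat \<Rightarrow> nat \<Rightarrow> 'g character \<Rightarrow> complex"

definition supported_matrix :: "'g::ab_group_add character measure \<Rightarrow> ('g character \<Rightarrow> nat)
    \<Rightarrow> 'g fmatrix \<Rightarrow> bool" where
  "supported_matrix \<mu> m A \<longleftrightarrow> (\<forall>i\<ge>1. \<forall>j\<ge>1. A i j \<in> borel_measurable \<mu> \<and>
    (AE \<omega> in \<mu>. \<omega> \<notin> level m j \<longrightarrow> A i j \<omega> = 0))"

definition filter_product :: "('g::ab_group_add \<Rightarrow> 'g) \<Rightarrow> 'g fmatrix \<Rightarrow> 'g fmatrix
    \<Rightarrow> nat \<Rightarrow> nat \<Rightarrow> 'g character \<Rightarrow> complex" where
  "filter_product \<alpha> A B i i' \<omega> =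
    (\<Sum>\<zeta>\<in>dual_fiber \<alpha> \<omega>. \<Sum>\<^sub>\<infinity>j\<in>{1..}. A i j \<zeta> * cnj (B i' j \<zeta>))"

definition filter_matrix :: "'g::ab_group_add character measure \<Rightarrow> ('g \<Rightarrow> 'g)
    \<Rightarrow> ('g character \<Rightarrow> nat) \<Rightarrow> 'g fmatrix \<Rightarrow> bool" where
  "filter_matrix \<mu> \<alpha> m H \<longleftrightarrow> supported_matrix \<mu> m H \<and>
    (\<forall>i\<ge>1. \<forall>i'\<ge>1. AE \<omega> in \<mu>. filter_product \<alpha> H H i i' \<omega> =
      of_nat (image_index \<alpha>) * (if i = i' then 1 else 0) * indicator (level m i) \<omega>)"

definition complementary_filter :: "'g::ab_group_add character measure \<Rightarrow> ('g \<Rightarrow> 'g)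
    \<Rightarrow> ('g character \<Rightarrow> nat) \<Rightarrow> 'g fmatrix \<Rightarrow> 'g fmatrix \<Rightarrow> bool" where
  "complementary_filter \<mu> \<alpha> m H G \<longleftrightarrow> supported_matrix \<mu> m G \<and>
    (\<forall>k\<ge>1. \<forall>k'\<ge>1. AE \<omega> in \<mu>. filter_product \<alpha> G G k k' \<omega> =
      of_nat (image_index \<alpha>) * (if k = k' then 1 else 0) * indicator (level (co_mult \<alpha> m) k) \<omega>) \<and>
    (\<forall>k\<ge>1. \<forall>i\<ge>1. AE \<omega> in \<mu>. filter_product \<alpha> G H k i \<omega> = 0)"

text \<open>
  For a matrix whose rows are indexed along \<open>r\<close> and whose columns along \<open>m\<close>:
  \<open>f \<mapsto> (\<omega> \<mapsto> A\<^sup>t(\<omega>) f(\<alpha>\<^sup>*\<omega>))\<close>.  The sum over \<open>i\<close> is finite, as \<open>f\<^sub>i\<close> vanishes off \<open>level r i\<close>.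
\<close>

definition ruelle :: "'g::ab_group_add character measure \<Rightarrow> ('g \<Rightarrow> 'g) \<Rightarrow> ('g character \<Rightarrow> nat)
    \<Rightarrow> ('g character \<Rightarrow> nat) \<Rightarrow> 'g fmatrix
    \<Rightarrow> (nat \<Rightarrow> ('g character \<Rightarrow> complex) set) \<Rightarrow> nat \<Rightarrow> ('g character \<Rightarrow> complex) set" where
  "ruelle \<mu> \<alpha> r m A F = (\<lambda>j\<in>{1..}. l2_class (restrict_space \<mu> (level m j))
    (\<lambda>\<omega>. \<Sum>\<^sub>\<infinity>i\<in>{1..}. A i j \<omega> * l2_fun (restrict_space \<mu> (level r i)) (F i) (dual_endo \<alpha> \<omega>)))"

definition section_shift :: "('g::ab_group_add \<Rightarrow> 'g) \<Rightarrow> ('g character \<Rightarrow> 'g character)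
    \<Rightarrow> 'g character \<Rightarrow> 'g character" where
  "section_shift \<alpha> c \<omega> = char_mult (c (dual_endo \<alpha> \<omega>)) (char_inv \<omega>)"

definition dilate_measure :: "('g::{ab_group_add,countable} \<Rightarrow> 'g)
    \<Rightarrow> ('g character \<Rightarrow> 'g character) \<Rightarrow> 'g character measure \<Rightarrow> 'g character
    \<Rightarrow> 'g character measure" where
  "dilate_measure \<alpha> c \<nu> \<zeta> =
    (let E = {\<omega> \<in> space \<nu>. section_shift \<alpha> c \<omega> = \<zeta>} in
      scale_measure (of_nat (image_index \<alpha>))
        (distr (restrict_space \<nu> E) (restrict_space borel (dual_endo \<alpha> ` E)) (dual_endo \<alpha>)))"

text \<open>
  Each dilation replaces an index \<open>i\<close> by pairs \<open>(i, \<zeta>)\<close> with \<open>\<zeta>\<close> in the kernel.  To keep one type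
  for all iterates, indices are pairs \<open>(k, zs)\<close>, and the pair \<open>((k, zs), \<zeta>)\<close> is written
  \<open>(k, \<zeta> # zs)\<close>.
\<close>

type_synonym 'g widx = "nat \<times> 'g character list"

definition dilate :: "('g::{ab_group_add,countable} \<Rightarrow> 'g) \<Rightarrow> ('g character \<Rightarrow> 'g character)
    \<Rightarrow> ('g widx, 'g character) mfam \<Rightarrow> ('g widx, 'g character) mfam" where
  "dilate \<alpha> c K =
    ({(k, \<zeta> # zs) | k \<zeta> zs. (k, zs) \<in> fst K \<and> \<zeta> \<in> dual_ker \<alpha>},
     \<lambda>(k, zs). dilate_measure \<alpha> c (snd K (k, tl zs)) (hd zs))"

definition dilate_op :: "('g::{ab_group_add,countable} \<Rightarrow> 'g) \<Rightarrow> ('g character \<Rightarrow> 'g character)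
    \<Rightarrow> ('g widx, 'g character) mfam
    \<Rightarrow> ('g widx \<Rightarrow> ('g character \<Rightarrow> complex) set)
    \<Rightarrow> 'g widx \<Rightarrow> ('g character \<Rightarrow> complex) set" where
  "dilate_op \<alpha> c K F = (\<lambda>(k, zs)\<in>fst (dilate \<alpha> c K). l2_class (snd (dilate \<alpha> c K) (k, zs))
    (\<lambda>\<omega>. complex_of_real (1 / sqrt (real (image_index \<alpha>))) *
      l2_fun (snd K (k, tl zs)) (F (k, tl zs)) (char_mult (char_inv (hd zs)) (c \<omega>))))"

primrec wavelet_fam :: "'g::{ab_group_add,countable} character measure \<Rightarrow> ('g \<Rightarrow> 'g)
    \<Rightarrow> ('g character \<Rightarrow> 'g character) \<Rightarrow> ('g character \<Rightarrow> nat) \<Rightarrow> nat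
    \<Rightarrow> ('g widx, 'g character) mfam" where
  "wavelet_fam \<mu> \<alpha> c m 0 =
    (fst (level_fam \<mu> (co_mult \<alpha> m)) \<times> {[]}, \<lambda>(k, zs). snd (level_fam \<mu> (co_mult \<alpha> m)) k)"
| "wavelet_fam \<mu> \<alpha> c m (Suc n) = dilate \<alpha> c (wavelet_fam \<mu> \<alpha> c m n)"

text \<open>Elements of the big space are pairs of the core component and the sequence of wavelet components.\<close>

type_synonym 'g ladder =
  "(nat \<Rightarrow> ('g character \<Rightarrow> complex) set) \<times> (nat \<Rightarrow> 'g widx \<Rightarrow> ('g character \<Rightarrow> complex) set)"

definition ladder_space :: "'g::{ab_group_add,countable} character measure \<Rightarrow> ('g \<Rightarrow> 'g)
    \<Rightarrow> ('g character \<Rightarrow> 'g character) \<Rightarrow> ('g character \<Rightarrow> nat) \<Rightarrow> 'g ladder hspace" where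
  "ladder_space \<mu> \<alpha> c m =
    hprod (L2_sum (level_fam \<mu> m)) (hsum UNIV (\<lambda>n. L2_sum (wavelet_fam \<mu> \<alpha> c m n)))"

definition mult_rep :: "('i, 'g character) mfam \<Rightarrow> 'g
    \<Rightarrow> ('i \<Rightarrow> ('g character \<Rightarrow> complex) set) \<Rightarrow> 'i \<Rightarrow> ('g character \<Rightarrow> complex) set" where
  "mult_rep K \<gamma> F = (\<lambda>i\<in>fst K. l2_class (snd K i) (\<lambda>\<omega>. \<omega> \<gamma> * l2_fun (snd K i) (F i) \<omega>))"

definition ladder_rep :: "'g::{ab_group_add,countable} character measure \<Rightarrow> ('g \<Rightarrow> 'g)
    \<Rightarrow> ('g character \<Rightarrow> 'g character) \<Rightarrow> ('g character \<Rightarrow> nat)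
    \<Rightarrow> 'g \<Rightarrow> 'g ladder \<Rightarrow> 'g ladder" where
  "ladder_rep \<mu> \<alpha> c m \<gamma> f =
    (mult_rep (level_fam \<mu> m) \<gamma> (fst f), \<lambda>n. mult_rep (wavelet_fam \<mu> \<alpha> c m n) \<gamma> (snd f n))"

definition ladder_op :: "'g::{ab_group_add,countable} character measure \<Rightarrow> ('g \<Rightarrow> 'g)
    \<Rightarrow> ('g character \<Rightarrow> 'g character) \<Rightarrow> ('g character \<Rightarrow> nat) \<Rightarrow> 'g fmatrix \<Rightarrow> 'g fmatrix
    \<Rightarrow> 'g ladder \<Rightarrow> 'g ladder" where
  "ladder_op \<mu> \<alpha> c m H G f =
    (hadd (L2_sum (level_fam \<mu> m))
       (ruelle \<mu> \<alpha> m m H (fst f))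
       (ruelle \<mu> \<alpha> (co_mult \<alpha> m) m G (\<lambda>k\<in>{1..}. snd f 0 (k, []))),
     \<lambda>n. op_inverse (L2_sum (wavelet_fam \<mu> \<alpha> c m n)) (dilate_op \<alpha> c (wavelet_fam \<mu> \<alpha> c m n))
           (snd f (Suc n)))"

definition ladder_core :: "'g::{ab_group_add,countable} character measure \<Rightarrow> ('g \<Rightarrow> 'g)
    \<Rightarrow> ('g character \<Rightarrow> 'g character) \<Rightarrow> ('g character \<Rightarrow> nat) \<Rightarrow> 'g ladder set" where
  "ladder_core \<mu> \<alpha> c m = {f \<in> hcarrier (ladder_space \<mu> \<alpha> c m).
    \<forall>n. snd f n = hzero (L2_sum (wavelet_fam \<mu> \<alpha> c m n))}"

definition unitary_rep :: "'v hspace \<Rightarrow> ('g::ab_group_add \<Rightarrow> 'v \<Rightarrow> 'v) \<Rightarrow> bool" where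
  "unitary_rep V \<pi> \<longleftrightarrow> (\<forall>\<gamma>. unitary_op V V (\<pi> \<gamma>)) \<and> (\<forall>f\<in>hcarrier V. \<pi> 0 f = f) \<and>
    (\<forall>\<gamma> \<gamma>'. \<forall>f\<in>hcarrier V. \<pi> (\<gamma> + \<gamma>') f = \<pi> \<gamma> (\<pi> \<gamma>' f))"

definition gmra :: "'v hspace \<Rightarrow> ('g::ab_group_add \<Rightarrow> 'g) \<Rightarrow> ('g \<Rightarrow> 'v \<Rightarrow> 'v) \<Rightarrow> ('v \<Rightarrow> 'v)
    \<Rightarrow> (int \<Rightarrow> 'v set) \<Rightarrow> bool" where
  "gmra V \<alpha> \<pi> \<delta> U \<longleftrightarrow>
    hilbert_space V \<and> separable_space (htopology V) \<and>
    unitary_rep V \<pi> \<and> unitary_op V V \<delta> \<and>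
    (\<forall>\<gamma>. \<forall>f\<in>hcarrier V. op_inverse V \<delta> (\<pi> \<gamma> (\<delta> f)) = \<pi> (\<alpha> \<gamma>) f) \<and>
    (\<forall>j. closed_subspace V (U j)) \<and>
    (\<forall>j. U j \<subseteq> U (j + 1) \<and> U (j + 1) = \<delta> ` U j) \<and>
    (\<Inter>j. U j) = {hzero V} \<and>
    htopology V closure_of (\<Union>j. U j) = hcarrier V \<and>
    (\<forall>\<gamma>. \<forall>f\<in>U 0. \<pi> \<gamma> f \<in> U 0)"

definition multiplicity_unitary :: "'g::ab_group_add character measure \<Rightarrow> 'v hspace
    \<Rightarrow> ('g \<Rightarrow> 'v \<Rightarrow> 'v) \<Rightarrow> 'v set \<Rightarrow> ('g character \<Rightarrow> nat)
    \<Rightarrow> ('v \<Rightarrow> nat \<Rightarrow> ('g character \<Rightarrow> complex) set) \<Rightarrow> bool" where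
  "multiplicity_unitary \<mu> V \<pi> U0 m J \<longleftrightarrow>
    unitary_op (V\<lparr>hcarrier := U0\<rparr>) (L2_sum (level_fam \<mu> m)) J \<and>
    (\<forall>\<gamma>. \<forall>f\<in>U0. J (\<pi> \<gamma> f) = mult_rep (level_fam \<mu> m) \<gamma> (J f))"

definition multiplicity_function :: "'g::ab_group_add character measure \<Rightarrow> 'v hspace
    \<Rightarrow> ('g \<Rightarrow> 'v \<Rightarrow> 'v) \<Rightarrow> 'v set \<Rightarrow> ('g character \<Rightarrow> nat) \<Rightarrow> bool" where
  "multiplicity_function \<mu> V \<pi> U0 m \<longleftrightarrow>
    m \<in> measurable \<mu> (count_space UNIV) \<and> (\<exists>J. multiplicity_unitary \<mu> V \<pi> U0 m J)"

definition coordinate_vector :: "'g::ab_group_add character measure \<Rightarrow> ('g character \<Rightarrow> nat)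
    \<Rightarrow> nat \<Rightarrow> nat \<Rightarrow> ('g character \<Rightarrow> complex) set" where
  "coordinate_vector \<mu> m i = (\<lambda>j\<in>{1..}. l2_class (restrict_space \<mu> (level m j))
    (if j = i then indicator (level m i) else (\<lambda>_. 0)))"

definition constructed_filter :: "'g::ab_group_add character measure \<Rightarrow> 'v hspace
    \<Rightarrow> ('g \<Rightarrow> 'v \<Rightarrow> 'v) \<Rightarrow> ('v \<Rightarrow> 'v) \<Rightarrow> (int \<Rightarrow> 'v set) \<Rightarrow> ('g character \<Rightarrow> nat)
    \<Rightarrow> 'g fmatrix \<Rightarrow> bool" where
  "constructed_filter \<mu> V \<pi> \<delta> U m H \<longleftrightarrow> (\<exists>J. multiplicity_unitary \<mu> V \<pi> (U 0) m J \<and>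
    (\<forall>i\<ge>1. (\<lambda>j\<in>{1..}. l2_class (restrict_space \<mu> (level m j)) (H i j)) =
      J (op_inverse V \<delta> (op_inverse (V\<lparr>hcarrier := U 0\<rparr>) J (coordinate_vector \<mu> m i)))))"

end

theory Submission
  imports Defs
begin

text \<open>
  The big space is a ladder with the core \<open>V0\<close> at its foot and the rungs \<open>W 0\<close>, \<open>W 1\<close>, and so on above
  it.  The operator \<open>T\<close> lowers every rung by one step and folds the lowest rung into the core, so
  everything rests on two unitaries: the folding of \<open>V0 \<oplus> W 0\<close> onto \<open>V0\<close>, and the dilation
  of each rung onto the next.

  For the folding, fix a point \<open>\<omega>\<close> of the dual group and stack the rows \<open>h\<^sub>i\<close>, \<open>i \<le> m(\<omega>)\<close>, on top of
  the rows \<open>g\<^sub>k\<close>, \<open>k \<le> m'(\<omega>)\<close>, where \<open>m'\<close> is the complementary multiplicity; the columns are the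
  pairs \<open>(\<zeta>, j)\<close> with \<open>\<alpha>\<^sup>*(\<zeta>) = \<omega>\<close> and \<open>j \<le> m(\<zeta>)\<close>.  The filter equations say that these rows are
  orthogonal with squared norm \<open>N\<close>, and the definition of \<open>m'\<close> says that the matrix is square.
  Hence its columns are orthogonal too (\<open>columns_orthogonal\<close>): over almost every point, folding is
  \<open>sqrt N\<close> times a unitary between finite-dimensional spaces.  The pointwise statement integrates
  because Haar measure is spread evenly over the fibres of \<open>\<alpha>\<^sup>*\<close> (\<open>nn_integral_sum_fiber\<close>), which
  follows from the uniqueness of Haar measure and the fact that \<open>\<alpha>\<^sup>*\<close> has a kernel of exactly \<open>N\<close>
  elements (\<open>card_annihilator\<close>).  This gives \<open>fold_unitary\<close>.

  For the dilation, the section shift cuts the space of each measure into \<open>N\<close> parts on which \<open>\<alpha>\<^sup>*\<close> is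
  injective, and the operator composes with the inverse branches; the factor \<open>N\<close> in the measures
  cancels the factor \<open>1 / sqrt N\<close> in the operator (\<open>dilate_unitary\<close>).

  The rest is geometry of the ladder, carried out for arbitrary Hilbert spaces in the locale
  \<open>ladder\<close>.  On the core, \<open>T\<close> is the Ruelle operator, so the spaces \<open>T\<^sup>n V0\<close> decrease to zero because
  that operator is pure; the space \<open>T\<^sup>-\<^sup>n V0\<close> contains the core and the first \<open>n\<close> rungs, so the union
  is dense.  Both unitaries turn multiplication by \<open>\<omega>(\<gamma>)\<close> into multiplication by \<open>\<omega>(\<alpha> \<gamma>)\<close>, because
  they compose functions with \<open>\<alpha>\<^sup>*\<close> or with a right inverse of it.  The core is a copy of \<open>V0\<close>, so
  projecting to \<open>V0\<close> realizes the multiplicity function \<open>m\<close>; and \<open>T\<close> sends the coordinate vector \<open>C\<^sub>i\<close>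
  to row \<open>i\<close> of the filter, since that row vanishes above the points where \<open>m < i\<close>.

  That the ladder is a separable Hilbert space comes from the Riesz--Fischer theorem
  (\<open>hilbert_space_L2\<close>), the completeness of direct sums, and a criterion for separability
  (\<open>separable_if_total\<close>): some countable set is orthogonal to the zero vector only.
\<close>

section \<open>Geometry of inner product spaces with a carrier\<close>

definition hsub :: "'v hspace \<Rightarrow> 'v \<Rightarrow> 'v \<Rightarrow> 'v" where
  "hsub V x y = hadd V x (hscale V (-1) y)"

context complex_inner_space
begin

lemmas closed [simp, intro] = zero_closed add_closed scale_closed

lemma hsub_closed [simp, intro]:
  "\<lbrakk>x \<in> hcarrier V; y \<in> hcarrier V\<rbrakk> \<Longrightarrow> hsub V x y \<in> hcarrier V"
  by (simp add: hsub_def)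

lemma inner_zero_left [simp]: "y \<in> hcarrier V \<Longrightarrow> hinner V (hzero V) y = 0"
  using inner_add_left[of "hzero V" "hzero V" y] add_zero[of "hzero V"] by simp

lemma inner_zero_right [simp]: "y \<in> hcarrier V \<Longrightarrow> hinner V y (hzero V) = 0"
  using inner_commute[of y "hzero V"] by simp

lemma inner_add_right:
  assumes "x \<in> hcarrier V" "y \<in> hcarrier V" "z \<in> hcarrier V"
  shows "hinner V x (hadd V y z) = hinner V x y + hinner V x z"
  using assms inner_add_left[of y z x] inner_commute[of x] by simp

lemma inner_scale_right:
  assumes "x \<in> hcarrier V" "y \<in> hcarrier V"
  shows "hinner V x (hscale V a y) = cnj a * hinner V x y"
  using assms inner_scale_left[of y x a] inner_commute[of x] by simp

lemma inner_sub_left: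
  "\<lbrakk>x \<in> hcarrier V; y \<in> hcarrier V; z \<in> hcarrier V\<rbrakk>
    \<Longrightarrow> hinner V (hsub V x y) z = hinner V x z - hinner V y z"
  by (simp add: hsub_def inner_add_left inner_scale_left)

lemma inner_sub_right:
  "\<lbrakk>x \<in> hcarrier V; y \<in> hcarrier V; z \<in> hcarrier V\<rbrakk>
    \<Longrightarrow> hinner V x (hsub V y z) = hinner V x y - hinner V x z"
  by (simp add: hsub_def inner_add_right inner_scale_right)

lemmas inner_simps = inner_add_left inner_add_right inner_scale_left inner_scale_right
  inner_sub_left inner_sub_right

text \<open>The inner product separates vectors, so an identity between vectors may be checked
  after pairing with an arbitrary vector, where it becomes an identity of complex numbers.\<close>

lemma vec_eqI:
  assumes "x \<in> hcarrier V" "y \<in> hcarrier V"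
    and "\<And>z. z \<in> hcarrier V \<Longrightarrow> hinner V x z = hinner V y z"
  shows "x = y"
proof -
  have "hinner V (hsub V x y) (hsub V x y) = 0"
    using assms by (simp add: inner_sub_left)
  then have *: "hsub V x y = hzero V"
    using assms inner_definite by blast
  have "x = hadd V x (hadd V y (hscale V (-1) y))"
    using assms by (simp add: add_minus add_zero)
  also have "\<dots> = hadd V (hsub V x y) y"
    using assms add_commute[of y "hscale V (-1) y"] unfolding hsub_def by (simp add: add_assoc)
  also have "\<dots> = y"
    using assms * add_commute[of "hzero V" y] by (simp add: add_zero)
  finally show ?thesis .
qed

lemma inner_self: "x \<in> hcarrier V \<Longrightarrow> hinner V x x = complex_of_real ((hnorm V x)\<^sup>2)"
  using inner_commute[of x x] inner_nonneg[of x] by (auto simp: hnorm_def complex_eq_iff)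

lemma hnorm_sq: "x \<in> hcarrier V \<Longrightarrow> (hnorm V x)\<^sup>2 = Re (hinner V x x)"
  by (simp add: hnorm_def inner_nonneg)

lemma hnorm_nonneg [simp]: "x \<in> hcarrier V \<Longrightarrow> 0 \<le> hnorm V x"
  by (simp add: hnorm_def inner_nonneg)

lemma hnorm_zero [simp]: "hnorm V (hzero V) = 0"
  by (simp add: hnorm_def)

lemma hnorm_eq_0: "x \<in> hcarrier V \<Longrightarrow> hnorm V x = 0 \<longleftrightarrow> x = hzero V"
  using inner_definite[of x] inner_self[of x] by auto

lemma hnorm_scale: "x \<in> hcarrier V \<Longrightarrow> hnorm V (hscale V a x) = cmod a * hnorm V x"
proof -
  assume x: "x \<in> hcarrier V"
  have "hinner V (hscale V a x) (hscale V a x) = (a * cnj a) * hinner V x x"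
    using x by (simp add: inner_simps)
  also have "\<dots> = complex_of_real ((cmod a * hnorm V x)\<^sup>2)"
    using x by (simp only: complex_norm_square[symmetric] inner_self of_real_mult[symmetric]
        power_mult_distrib)
  finally have "(hnorm V (hscale V a x))\<^sup>2 = (cmod a * hnorm V x)\<^sup>2"
    using x by (simp only: hnorm_sq closed Re_complex_of_real)
  then show ?thesis using x by (simp add: power2_eq_iff_nonneg)
qed

lemma norm_add_sq:
  assumes "x \<in> hcarrier V" "y \<in> hcarrier V"
  shows "(hnorm V (hadd V x y))\<^sup>2 = (hnorm V x)\<^sup>2 + (hnorm V y)\<^sup>2 + 2 * Re (hinner V x y)"
  using assms inner_commute[of y x] by (simp add: hnorm_sq inner_simps)

lemma norm_sub_sq:
  assumes "x \<in> hcarrier V" "y \<in> hcarrier V"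
  shows "(hnorm V (hsub V x y))\<^sup>2 = (hnorm V x)\<^sup>2 + (hnorm V y)\<^sup>2 - 2 * Re (hinner V x y)"
  using assms inner_commute[of y x] by (simp add: hnorm_sq inner_simps)

text \<open>Subtracting from \<open>x\<close> its projection \<open>t y\<close> to the line of \<open>y\<close> leaves a vector of nonnegative norm.\<close>

lemma Cauchy_Schwarz:
  assumes x: "x \<in> hcarrier V" and y: "y \<in> hcarrier V"
  shows "cmod (hinner V x y) \<le> hnorm V x * hnorm V y"
proof (cases "hnorm V y = 0")
  case True
  then show ?thesis using assms hnorm_eq_0 by simp
next
  case False
  define t where "t = hinner V x y / complex_of_real ((hnorm V y)\<^sup>2)"
  have ny: "(hnorm V y)\<^sup>2 > 0" using False by simp
  have t: "cnj t * hinner V x y = complex_of_real ((cmod (hinner V x y))\<^sup>2 / (hnorm V y)\<^sup>2)"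
    unfolding t_def of_real_divide complex_norm_square[of "hinner V x y"] by (simp add: mult.commute)
  have ct: "(cmod t)\<^sup>2 * (hnorm V y)\<^sup>2 = (cmod (hinner V x y))\<^sup>2 / (hnorm V y)\<^sup>2"
    using ny by (simp add: t_def norm_divide power_divide norm_power) (simp add: field_simps power2_eq_square power4_eq_xxxx)
  have "0 \<le> (hnorm V (hsub V x (hscale V t y)))\<^sup>2" by simp
  also have "\<dots> = (hnorm V x)\<^sup>2 - (cmod (hinner V x y))\<^sup>2 / (hnorm V y)\<^sup>2"
    using x y t ct by (simp add: norm_sub_sq hnorm_scale power_mult_distrib inner_simps
        del: of_real_power of_real_divide)
  finally have "(cmod (hinner V x y))\<^sup>2 \<le> (hnorm V x * hnorm V y)\<^sup>2"
    using ny by (simp add: field_simps power_mult_distrib)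
  then show ?thesis using x y by (simp add: abs_le_square_iff[symmetric] abs_mult)
qed

lemma norm_triangle:
  assumes x: "x \<in> hcarrier V" and y: "y \<in> hcarrier V"
  shows "hnorm V (hadd V x y) \<le> hnorm V x + hnorm V y"
proof -
  have "Re (hinner V x y) \<le> hnorm V x * hnorm V y"
    using Cauchy_Schwarz[OF x y] complex_Re_le_cmod order_trans by blast
  then have "(hnorm V (hadd V x y))\<^sup>2 \<le> (hnorm V x + hnorm V y)\<^sup>2"
    using x y by (simp add: norm_add_sq power2_sum)
  then show ?thesis using x y by (simp add: abs_le_square_iff[symmetric])
qed

lemma norm_add_sq_le:
  assumes x: "x \<in> hcarrier V" and y: "y \<in> hcarrier V"
  shows "(hnorm V (hadd V x y))\<^sup>2 \<le> 2 * (hnorm V x)\<^sup>2 + 2 * (hnorm V y)\<^sup>2"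
  using norm_add_sq[OF x y] norm_sub_sq[OF x y] zero_le_power2[of "hnorm V (hsub V x y)"] by linarith

lemma sub_add_sub:
  assumes "x \<in> hcarrier V" "y \<in> hcarrier V" "z \<in> hcarrier V"
  shows "hadd V (hsub V x y) (hsub V y z) = hsub V x z"
  by (rule vec_eqI) (use assms in \<open>auto simp: inner_simps\<close>)

lemma sub_self: "x \<in> hcarrier V \<Longrightarrow> hsub V x x = hzero V"
  by (simp add: hsub_def add_minus)

lemma sub_eq_zero: "\<lbrakk>x \<in> hcarrier V; y \<in> hcarrier V\<rbrakk> \<Longrightarrow> hsub V x y = hzero V \<longleftrightarrow> x = y"
  using vec_eqI[of x y] by (metis inner_sub_left inner_zero_left right_minus_eq sub_self)

lemma norm_sub_commute:
  "\<lbrakk>x \<in> hcarrier V; y \<in> hcarrier V\<rbrakk> \<Longrightarrow> hnorm V (hsub V x y) = hnorm V (hsub V y x)"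
  using inner_commute[of x y] by (simp add: hnorm_def inner_simps)

lemma hdist_eq: "\<lbrakk>x \<in> hcarrier V; y \<in> hcarrier V\<rbrakk> \<Longrightarrow> hdist V x y = hnorm V (hsub V x y)"
  by (simp add: hdist_def hsub_def)

lemma Metric_space: "Metric_space (hcarrier V) (hdist V)"
proof
  show "0 \<le> hdist V x y" for x y
    by (simp add: hdist_def)
  show "hdist V x y = hdist V y x" for x y
    by (cases "x \<in> hcarrier V \<and> y \<in> hcarrier V")
      (auto simp: hdist_eq norm_sub_commute, auto simp: hdist_def)
  show "hdist V x y = 0 \<longleftrightarrow> x = y" if "x \<in> hcarrier V" "y \<in> hcarrier V" for x y
    using that by (simp add: hdist_eq hnorm_eq_0 sub_eq_zero)
  show "hdist V x z \<le> hdist V x y + hdist V y z"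
    if "x \<in> hcarrier V" "y \<in> hcarrier V" "z \<in> hcarrier V" for x y z
    using that norm_triangle[of "hsub V x y" "hsub V y z"] by (simp add: hdist_eq sub_add_sub)
qed

sublocale metric: Metric_space "hcarrier V" "hdist V"
  by (rule Metric_space)

lemma topspace_htopology [simp]: "topspace (htopology V) = hcarrier V"
  by (simp add: htopology_def)

definition converges :: "(nat \<Rightarrow> 'v) \<Rightarrow> 'v \<Rightarrow> bool" where
  "converges x l \<longleftrightarrow> range x \<subseteq> hcarrier V \<and> l \<in> hcarrier V \<and>
    (\<lambda>n. hnorm V (hsub V (x n) l)) \<longlonglongrightarrow> 0"

lemma limitin_iff_converges:
  assumes "range x \<subseteq> hcarrier V"
  shows "limitin (htopology V) x l sequentially \<longleftrightarrow> converges x l"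
proof (cases "l \<in> hcarrier V")
  case True
  then have "(\<lambda>n. hdist V (x n) l) = (\<lambda>n. hnorm V (hsub V (x n) l))"
    using assms by (auto simp: hdist_eq image_subset_iff)
  then show ?thesis
    using assms True unfolding htopology_def metric.limitin_metric_dist_null converges_def
    by (auto intro!: always_eventually)
next
  case False
  then show ?thesis
    unfolding htopology_def metric.limitin_metric_dist_null converges_def by auto
qed

lemma closedin_iff:
  "closedin (htopology V) S \<longleftrightarrow> S \<subseteq> hcarrier V \<and>
    (\<forall>x l. range x \<subseteq> S \<longrightarrow> converges x l \<longrightarrow> l \<in> S)"
  using limitin_iff_converges unfolding htopology_def metric.metric_closedin_iff_sequentially_closed
  by (metis subset_trans)

lemma in_closure_of_iff:
  assumes "S \<subseteq> hcarrier V"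
  shows "l \<in> htopology V closure_of S \<longleftrightarrow>
    l \<in> hcarrier V \<and> (\<forall>e>0. \<exists>x\<in>S. hnorm V (hsub V x l) < e)"
  using assms unfolding htopology_def metric.metric_closure_of
  by (auto simp: hdist_eq subset_iff norm_sub_commute metric.in_mball) (metis hdist_eq norm_sub_commute)+

lemma converges_in_closure:
  assumes "range x \<subseteq> S" "S \<subseteq> hcarrier V" "converges x l"
  shows "l \<in> htopology V closure_of S"
  unfolding in_closure_of_iff[OF assms(2)]
proof (intro conjI allI impI)
  show "l \<in> hcarrier V" using assms(3) by (simp add: converges_def)
  fix e :: real assume "e > 0"
  then have "eventually (\<lambda>n. hnorm V (hsub V (x n) l) < e) sequentially"
    using assms(3) by (intro order_tendstoD(2)[where y=0]) (auto simp: converges_def)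
  then obtain n where "hnorm V (hsub V (x n) l) < e"
    by (auto simp: eventually_sequentially)
  then show "\<exists>x\<in>S. hnorm V (hsub V x l) < e" using assms(1) by blast
qed

definition cauchy :: "(nat \<Rightarrow> 'v) \<Rightarrow> bool" where
  "cauchy x \<longleftrightarrow> range x \<subseteq> hcarrier V \<and>
    (\<forall>e>0. \<exists>N. \<forall>n\<ge>N. \<forall>k\<ge>N. hnorm V (hsub V (x n) (x k)) < e)"

lemma cauchy_iff: "cauchy x \<longleftrightarrow> metric.MCauchy x"
  unfolding cauchy_def metric.MCauchy_def
  by (auto simp: hdist_eq image_subset_iff)

lemma complete_iff:
  "metric.mcomplete \<longleftrightarrow> (\<forall>x. cauchy x \<longrightarrow> (\<exists>l. converges x l))"
  unfolding metric.mcomplete_def cauchy_iff[symmetric]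
  using limitin_iff_converges[unfolded htopology_def] by (metis cauchy_def)

lemma hilbert_spaceI:
  assumes "\<And>x. cauchy x \<Longrightarrow> \<exists>l. converges x l"
  shows "hilbert_space V"
  using assms complete_iff by (simp add: hilbert_space_axioms_def hilbert_space_def complex_inner_space_axioms)

text \<open>It suffices that rapidly convergent sequences have limits: every Cauchy sequence has a
  rapidly convergent subsequence, and shares its limit.\<close>

lemma hilbert_spaceI_fast:
  assumes fast: "\<And>x. \<lbrakk>range x \<subseteq> hcarrier V; \<And>n. hnorm V (hsub V (x (Suc n)) (x n)) \<le> (1/2) ^ n\<rbrakk>
    \<Longrightarrow> \<exists>l. converges x l"
  shows "hilbert_space V"
proof (rule hilbert_spaceI)
  fix x assume x: "cauchy x"
  then have xC: "x n \<in> hcarrier V" for n by (auto simp: cauchy_def)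
  have "\<exists>N. \<forall>n\<ge>N. \<forall>k\<ge>N. hnorm V (hsub V (x n) (x k)) < (1/2) ^ p" for p
    using x by (simp add: cauchy_def)
  then obtain N where N: "\<And>p n k. n \<ge> N p \<Longrightarrow> k \<ge> N p \<Longrightarrow> hnorm V (hsub V (x n) (x k)) < (1/2) ^ p"
    by metis
  \<comment> \<open>The sum makes the indices increase, the summand \<open>p\<close> makes them tend to infinity.\<close>
  define r where "r p = (\<Sum>q\<le>p. N q) + p" for p
  have rN: "N p \<le> r p" for p
    unfolding r_def by (rule trans_le_add1, rule member_le_sum) auto
  have rmono: "r p \<le> r (Suc p)" for p by (simp add: r_def)
  have "\<exists>l. converges (x \<circ> r) l"
  proof (rule fast)
    show "range (x \<circ> r) \<subseteq> hcarrier V" using xC by auto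
    show "hnorm V (hsub V ((x \<circ> r) (Suc n)) ((x \<circ> r) n)) \<le> (1/2) ^ n" for n
      using N[of n "r (Suc n)" "r n"] rN[of n] rmono[of n] by simp
  qed
  then obtain l where l: "converges (x \<circ> r) l" ..
  then have lC: "l \<in> hcarrier V" and lim: "(\<lambda>n. hnorm V (hsub V (x (r n)) l)) \<longlonglongrightarrow> 0"
    by (auto simp: converges_def)
  have "(\<lambda>n. hnorm V (hsub V (x n) l)) \<longlonglongrightarrow> 0"
  proof (rule LIMSEQ_I)
    fix e :: real assume e: "e > 0"
    obtain M where M: "\<And>n k. n \<ge> M \<Longrightarrow> k \<ge> M \<Longrightarrow> hnorm V (hsub V (x n) (x k)) < e/2"
      using x e unfolding cauchy_def by (meson half_gt_zero)
    obtain p where p: "p \<ge> M" "hnorm V (hsub V (x (r p)) l) < e/2"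
      using order_tendstoD(2)[OF lim, of "e/2"] e unfolding eventually_sequentially
      by (meson half_gt_zero nle_le)
    have "r p \<ge> M" using p by (simp add: r_def)
    have "hnorm V (hsub V (x n) l) < e" if "n \<ge> M" for n
      using norm_triangle[of "hsub V (x n) (x (r p))" "hsub V (x (r p)) l"]
        M[OF that \<open>r p \<ge> M\<close>] p(2) by (simp add: sub_add_sub xC lC)
    then show "\<exists>no. \<forall>n\<ge>no. norm (hnorm V (hsub V (x n) l) - 0) < e"
      using xC lC by auto
  qed
  then show "\<exists>l. converges x l" using xC lC by (auto simp: converges_def)
qed

end

lemma (in hilbert_space) cauchy_converges: "cauchy x \<Longrightarrow> \<exists>l. converges x l"
  using complete complete_iff by blast

section \<open>Isometric and unitary operators\<close>

text \<open>Polarization: the inner product is determined by the norm.\<close>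

lemma (in complex_inner_space) polarization:
  assumes "x \<in> hcarrier V" "y \<in> hcarrier V"
  shows "hinner V x y = Complex
    (((hnorm V (hadd V x y))\<^sup>2 - (hnorm V x)\<^sup>2 - (hnorm V y)\<^sup>2) / 2)
    (((hnorm V (hadd V x (hscale V \<i> y)))\<^sup>2 - (hnorm V x)\<^sup>2 - (hnorm V (hscale V \<i> y))\<^sup>2) / 2)"
  using assms by (simp add: norm_add_sq complex_eq_iff inner_scale_right)

text \<open>For a linear surjection it is enough to preserve norms: inner products are then preserved by
  polarization, and injectivity follows.\<close>

lemma unitary_opI:
  assumes V: "complex_inner_space V" and W: "complex_inner_space W"
    and lin: "linear_op V W U"
    and norm: "\<And>x. x \<in> hcarrier V \<Longrightarrow> hnorm W (U x) = hnorm V x"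
    and surj: "\<And>y. y \<in> hcarrier W \<Longrightarrow> \<exists>x\<in>hcarrier V. U x = y"
  shows "unitary_op V W U"
proof -
  interpret V: complex_inner_space V by fact
  interpret W: complex_inner_space W by fact
  have cl: "U x \<in> hcarrier W" if "x \<in> hcarrier V" for x
    using lin that by (simp add: linear_op_def)
  have ad: "U (hadd V x y) = hadd W (U x) (U y)" if "x \<in> hcarrier V" "y \<in> hcarrier V" for x y
    using lin that by (simp add: linear_op_def)
  have sc: "U (hscale V a x) = hscale W a (U x)" if "x \<in> hcarrier V" for a x
    using lin that by (simp add: linear_op_def)
  have inner: "hinner W (U x) (U y) = hinner V x y" if "x \<in> hcarrier V" "y \<in> hcarrier V" for x y
    using that by (simp add: V.polarization W.polarization cl norm ad[symmetric] sc[symmetric])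
  have "inj_on U (hcarrier V)"
  proof (rule inj_onI)
    fix x y assume xy: "x \<in> hcarrier V" "y \<in> hcarrier V" "U x = U y"
    show "x = y"
      by (rule V.vec_eqI) (use xy inner in \<open>metis\<close>)+
  qed
  moreover have "U ` hcarrier V = hcarrier W"
    using cl surj by (auto simp: image_iff)
  ultimately show ?thesis
    using lin inner by (simp add: unitary_op_def bij_betw_def)
qed

context
  fixes V :: "'v hspace" and W :: "'w hspace" and U
  assumes U: "unitary_op V W U"
begin

lemma unitary_closed: "x \<in> hcarrier V \<Longrightarrow> U x \<in> hcarrier W"
  using U by (simp add: unitary_op_def linear_op_def)

lemma unitary_add: "\<lbrakk>x \<in> hcarrier V; y \<in> hcarrier V\<rbrakk> \<Longrightarrow> U (hadd V x y) = hadd W (U x) (U y)"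
  using U by (simp add: unitary_op_def linear_op_def)

lemma unitary_scale: "x \<in> hcarrier V \<Longrightarrow> U (hscale V a x) = hscale W a (U x)"
  using U by (simp add: unitary_op_def linear_op_def)

lemma unitary_inner: "\<lbrakk>x \<in> hcarrier V; y \<in> hcarrier V\<rbrakk> \<Longrightarrow> hinner W (U x) (U y) = hinner V x y"
  using U by (simp add: unitary_op_def)

lemma unitary_norm: "x \<in> hcarrier V \<Longrightarrow> hnorm W (U x) = hnorm V x"
  by (simp add: hnorm_def unitary_inner)

lemma unitary_bij: "bij_betw U (hcarrier V) (hcarrier W)"
  using U by (simp add: unitary_op_def)

lemma unitary_image: "U ` hcarrier V = hcarrier W"
  using unitary_bij by (rule bij_betw_imp_surj_on)

lemma unitary_inverse_left: "x \<in> hcarrier V \<Longrightarrow> op_inverse V U (U x) = x"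
  using unitary_bij by (simp add: op_inverse_def bij_betw_inv_into_left)

lemma unitary_inverse_right: "y \<in> hcarrier W \<Longrightarrow> U (op_inverse V U y) = y"
  using unitary_bij by (simp add: op_inverse_def bij_betw_inv_into_right)

lemma unitary_inverse_closed: "y \<in> hcarrier W \<Longrightarrow> op_inverse V U y \<in> hcarrier V"
  unfolding op_inverse_def using unitary_image inv_into_into[of y U "hcarrier V"] by simp

lemma unitary_inverse_eqI: "\<lbrakk>x \<in> hcarrier V; U x = y\<rbrakk> \<Longrightarrow> op_inverse V U y = x"
  using unitary_inverse_left by blast

lemma unitary_zero:
  assumes "complex_inner_space V" "complex_inner_space W"
  shows "U (hzero V) = hzero W"
proof (rule complex_inner_space.inner_definite[OF assms(2)])
  have z: "hzero V \<in> hcarrier V" by (rule complex_inner_space.zero_closed[OF assms(1)])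
  show "U (hzero V) \<in> hcarrier W" by (rule unitary_closed[OF z])
  show "hinner W (U (hzero V)) (U (hzero V)) = 0"
    unfolding unitary_inner[OF z z] by (rule complex_inner_space.inner_zero_left[OF assms(1) z])
qed

lemma unitary_inverse:
  assumes "complex_inner_space V" "complex_inner_space W"
  shows "unitary_op W V (op_inverse V U)"
proof (rule unitary_opI)
  interpret V: complex_inner_space V by fact
  interpret W: complex_inner_space W by fact
  note [simp] = unitary_inverse_right unitary_inverse_left unitary_inverse_closed unitary_closed
  show "linear_op W V (op_inverse V U)"
    unfolding linear_op_def
    by (intro conjI ballI allI unitary_inverse_eqI) (simp_all add: unitary_add unitary_scale)
  show "hnorm V (op_inverse V U x) = hnorm W x" if "x \<in> hcarrier W" for x
    using unitary_norm[of "op_inverse V U x"] that by simp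
  show "\<exists>x\<in>hcarrier W. op_inverse V U x = y" if "y \<in> hcarrier V" for y
    using that by (intro bexI[of _ "U y"]) auto
qed (use assms in auto)

end

lemma unitary_op_compose:
  assumes U: "unitary_op V W U" and U': "unitary_op W X U'"
  shows "unitary_op V X (\<lambda>x. U' (U x))"
proof -
  have "bij_betw (U' \<circ> U) (hcarrier V) (hcarrier X)"
    by (rule bij_betw_trans[OF unitary_bij[OF U] unitary_bij[OF U']])
  then show ?thesis
    using unitary_closed[OF U] unitary_closed[OF U']
    by (simp add: unitary_op_def linear_op_def o_def unitary_add[OF U] unitary_add[OF U']
        unitary_scale[OF U] unitary_scale[OF U'] unitary_inner[OF U] unitary_inner[OF U'])
qed

lemma unitary_hsub:
  assumes "unitary_op V W U" "complex_inner_space V" "x \<in> hcarrier V" "y \<in> hcarrier V"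
  shows "U (hsub V x y) = hsub W (U x) (U y)"
  using assms by (simp add: hsub_def unitary_add[OF assms(1)] unitary_scale[OF assms(1)]
      complex_inner_space.scale_closed)

text \<open>A unitary operator is a homeomorphism, so it maps closed subspaces to closed subspaces.\<close>

lemma closed_subspace_unitary_image:
  assumes U: "unitary_op V W U" and V: "complex_inner_space V" and W: "complex_inner_space W"
    and S: "closed_subspace V S"
  shows "closed_subspace W (U ` S)"
proof -
  interpret V: complex_inner_space V by fact
  interpret W: complex_inner_space W by fact
  have SC: "S \<subseteq> hcarrier V" using S by (simp add: closed_subspace_def)
  have "U ` S \<subseteq> hcarrier W" using SC unitary_closed[OF U] by blast
  moreover have "hzero W \<in> U ` S"
    using S unitary_zero[OF U V W] by (auto simp: closed_subspace_def intro!: rev_image_eqI)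
  moreover have "\<forall>x\<in>U ` S. \<forall>y\<in>U ` S. hadd W x y \<in> U ` S"
  proof safe
    fix x y assume xy: "x \<in> S" "y \<in> S"
    then have "hadd V x y \<in> S" using S by (simp add: closed_subspace_def)
    then show "hadd W (U x) (U y) \<in> U ` S"
      using xy SC unitary_add[OF U] by (metis image_eqI subsetD)
  qed
  moreover have "\<forall>a. \<forall>x\<in>U ` S. hscale W a x \<in> U ` S"
  proof safe
    fix a x assume x: "x \<in> S"
    then have "hscale V a x \<in> S" using S by (simp add: closed_subspace_def)
    then show "hscale W a (U x) \<in> U ` S"
      using x SC unitary_scale[OF U] by (metis image_eqI subsetD)
  qed
  moreover have "closedin (htopology W) (U ` S)"
    unfolding W.closedin_iff
  proof (intro conjI allI impI)
    show "U ` S \<subseteq> hcarrier W" by fact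
    fix y l assume y: "range y \<subseteq> U ` S" and conv: "W.converges y l"
    have "y n \<in> U ` S" for n using y by (simp add: image_subset_iff)
    then have "\<exists>x. x \<in> S \<and> U x = y n" for n by (metis imageE)
    then obtain x where x: "\<And>n. x n \<in> S" "\<And>n. U (x n) = y n" by metis
    define k where "k = op_inverse V U l"
    have k: "k \<in> hcarrier V" "U k = l"
      using conv by (auto simp: k_def W.converges_def unitary_inverse_closed[OF U] unitary_inverse_right[OF U])
    have "hnorm V (hsub V (x n) k) = hnorm W (hsub W (y n) l)" for n
    proof -
      have "x n \<in> hcarrier V" using x SC by blast
      then show ?thesis
        using x k unitary_hsub[OF U V, of "x n" k] unitary_norm[OF U, of "hsub V (x n) k"] by simp
    qed
    then have "V.converges x k"
      using conv x(1) SC k by (auto simp: V.converges_def W.converges_def)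
    moreover have "range x \<subseteq> S" using x(1) by blast
    ultimately have "k \<in> S" using S unfolding closed_subspace_def V.closedin_iff by blast
    then show "l \<in> U ` S" using k by blast
  qed
  ultimately show ?thesis by (simp add: closed_subspace_def)
qed

section \<open>Square-integrable functions\<close>

lemma borel_measurable_cnj [measurable]:
  "f \<in> borel_measurable M \<Longrightarrow> (\<lambda>x. cnj (f x)) \<in> borel_measurable M"
  by (rule measurable_compose[OF _ borel_measurable_continuous_onI]) (auto intro: continuous_intros)

definition square_integrable :: "'x measure \<Rightarrow> ('x \<Rightarrow> complex) \<Rightarrow> bool" where
  "square_integrable M f \<longleftrightarrow> f \<in> borel_measurable M \<and> integrable M (\<lambda>x. (cmod (f x))\<^sup>2)"

lemma square_integrableD [simp]: "square_integrable M f \<Longrightarrow> f \<in> borel_measurable M"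
  by (simp add: square_integrable_def)

lemma square_integrable_iff:
  assumes [measurable]: "f \<in> borel_measurable M"
  shows "square_integrable M f \<longleftrightarrow> (\<integral>\<^sup>+x. ennreal ((cmod (f x))\<^sup>2) \<partial>M) < \<infinity>"
  by (auto simp: square_integrable_def integrable_iff_bounded)

lemma square_integrable_add:
  assumes f: "square_integrable M f" and g: "square_integrable M g"
  shows "square_integrable M (\<lambda>x. f x + g x)"
proof -
  have [measurable]: "f \<in> borel_measurable M" "g \<in> borel_measurable M" using f g by auto
  have int: "integrable M (\<lambda>x. 2 * (cmod (f x))\<^sup>2 + 2 * (cmod (g x))\<^sup>2)"
    using f g by (auto simp: square_integrable_def)
  have "(cmod (f x + g x))\<^sup>2 \<le> 2 * (cmod (f x))\<^sup>2 + 2 * (cmod (g x))\<^sup>2" for x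
  proof -
    have "(cmod (f x + g x))\<^sup>2 \<le> (cmod (f x) + cmod (g x))\<^sup>2"
      by (intro power_mono norm_triangle_ineq) auto
    also have "\<dots> \<le> 2 * (cmod (f x))\<^sup>2 + 2 * (cmod (g x))\<^sup>2"
      using zero_le_power2[of "cmod (f x) - cmod (g x)"] unfolding power2_sum power2_diff by linarith
    finally show ?thesis .
  qed
  then have "norm ((cmod (f x + g x))\<^sup>2) \<le> norm (2 * (cmod (f x))\<^sup>2 + 2 * (cmod (g x))\<^sup>2)" for x
    using abs_ge_self order_trans by (metis abs_power2 real_norm_def)
  then have le: "AE x in M. norm ((cmod (f x + g x))\<^sup>2) \<le> norm (2 * (cmod (f x))\<^sup>2 + 2 * (cmod (g x))\<^sup>2)"
    by (intro AE_I2)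
  have "integrable M (\<lambda>x. (cmod (f x + g x))\<^sup>2)"
    by (rule Bochner_Integration.integrable_bound[OF int _ le]) measurable
  then show ?thesis by (simp add: square_integrable_def)
qed

lemma square_integrable_scale:
  assumes "square_integrable M f"
  shows "square_integrable M (\<lambda>x. a * f x)"
  using assms by (auto simp: square_integrable_def norm_mult power_mult_distrib)

lemma square_integrable_zero: "square_integrable M (\<lambda>_. 0)"
  by (simp add: square_integrable_def)

lemma square_integrable_mult:
  assumes f: "square_integrable M f" and g: "square_integrable M g"
  shows "integrable M (\<lambda>x. f x * cnj (g x))"
proof -
  have [measurable]: "f \<in> borel_measurable M" "g \<in> borel_measurable M" using f g by auto
  have int: "integrable M (\<lambda>x. (cmod (f x))\<^sup>2 + (cmod (g x))\<^sup>2)"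
    using f g by (auto simp: square_integrable_def)
  have "cmod (f x * cnj (g x)) \<le> (cmod (f x))\<^sup>2 + (cmod (g x))\<^sup>2" for x
  proof -
    have "cmod (f x) * cmod (g x) \<ge> 0" by simp
    then have "cmod (f x) * cmod (g x) \<le> (cmod (f x))\<^sup>2 + (cmod (g x))\<^sup>2"
      using zero_le_power2[of "cmod (f x) - cmod (g x)"] unfolding power2_diff by linarith
    then show ?thesis by (simp add: norm_mult)
  qed
  then have "norm (f x * cnj (g x)) \<le> norm ((cmod (f x))\<^sup>2 + (cmod (g x))\<^sup>2)" for x
    using abs_ge_self order_trans by (metis real_norm_def)
  then have le: "AE x in M. norm (f x * cnj (g x)) \<le> norm ((cmod (f x))\<^sup>2 + (cmod (g x))\<^sup>2)"
    by (intro AE_I2)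
  show ?thesis
    by (rule Bochner_Integration.integrable_bound[OF int _ le]) measurable
qed

section \<open>The space of square-integrable classes\<close>

lemma l2_class_eqI: "AE x in M. f x = g x \<Longrightarrow> l2_class M f = l2_class M g"
  unfolding l2_class_def by (auto elim!: AE_mp)

text \<open>The representative chosen by \<open>l2_fun\<close> agrees with any other one only almost everywhere.\<close>

lemma l2_fun_class:
  assumes f: "f \<in> borel_measurable M"
  shows l2_fun_class_measurable: "l2_fun M (l2_class M f) \<in> borel_measurable M"
    and l2_fun_class_AE: "AE x in M. l2_fun M (l2_class M f) x = f x"
proof -
  have "f \<in> l2_class M f" using f by (simp add: l2_class_def)
  then have "(SOME g. g \<in> l2_class M f) \<in> l2_class M f" by (rule someI[where P="\<lambda>g. g \<in> l2_class M f"])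
  then have 1: "(SOME g. g \<in> l2_class M f) \<in> borel_measurable M"
    and 2: "AE x in M. (SOME g. g \<in> l2_class M f) x = f x"
    by (auto simp: l2_class_def)
  show "l2_fun M (l2_class M f) \<in> borel_measurable M"
    using 1 by (subst measurable_cong[where g="SOME g. g \<in> l2_class M f"]) (auto simp: l2_fun_def)
  show "AE x in M. l2_fun M (l2_class M f) x = f x"
    using 2 AE_space by eventually_elim (simp add: l2_fun_def)
qed

lemma l2_class_eq_iff:
  assumes "f \<in> borel_measurable M" "g \<in> borel_measurable M"
  shows "l2_class M f = l2_class M g \<longleftrightarrow> (AE x in M. f x = g x)"
proof
  assume "l2_class M f = l2_class M g"
  then have "f \<in> l2_class M g" using assms by (auto simp: l2_class_def)
  then show "AE x in M. f x = g x" by (simp add: l2_class_def)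
qed (rule l2_class_eqI)

lemma l2_fun_zero_off: "x \<notin> space M \<Longrightarrow> l2_fun M F x = 0"
  by (simp add: l2_fun_def)

lemma L2_carrier_iff: "F \<in> hcarrier (L2 M) \<longleftrightarrow> (\<exists>f. square_integrable M f \<and> F = l2_class M f)"
  by (auto simp: L2_def square_integrable_def)

lemma l2_class_in_L2: "square_integrable M f \<Longrightarrow> l2_class M f \<in> hcarrier (L2 M)"
  by (auto simp: L2_carrier_iff)

lemma square_integrable_cong_AE:
  assumes "square_integrable M f" "g \<in> borel_measurable M" "AE x in M. g x = f x"
  shows "square_integrable M g"
proof -
  have [measurable]: "f \<in> borel_measurable M" "g \<in> borel_measurable M" using assms by auto
  have "(\<integral>\<^sup>+x. ennreal ((cmod (g x))\<^sup>2) \<partial>M) = (\<integral>\<^sup>+x. ennreal ((cmod (f x))\<^sup>2) \<partial>M)"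
    by (rule nn_integral_cong_AE) (use assms(3) in auto)
  then show ?thesis using assms(1) by (simp add: square_integrable_iff)
qed

lemma l2_class_in_L2D:
  assumes "l2_class M f \<in> hcarrier (L2 M)" "f \<in> borel_measurable M"
  shows "square_integrable M f"
proof -
  obtain g where g: "square_integrable M g" "l2_class M f = l2_class M g"
    using assms(1) by (auto simp: L2_carrier_iff)
  then have "AE x in M. f x = g x" using assms(2) by (simp add: l2_class_eq_iff)
  then show ?thesis using g(1) assms(2) by (rule square_integrable_cong_AE[rotated 2])
qed

lemma l2_fun_square_integrable:
  assumes "F \<in> hcarrier (L2 M)"
  shows "square_integrable M (l2_fun M F)" and "l2_class M (l2_fun M F) = F"
proof -
  obtain f where f: "square_integrable M f" "F = l2_class M f"
    using assms by (auto simp: L2_carrier_iff)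
  then show "square_integrable M (l2_fun M F)"
    using l2_fun_class[of f M] square_integrable_cong_AE by (metis square_integrableD)
  show "l2_class M (l2_fun M F) = F"
    using f l2_fun_class_AE[of f M] by (auto intro!: l2_class_eqI)
qed

lemma L2_add:
  assumes "f \<in> borel_measurable M" "g \<in> borel_measurable M"
  shows "hadd (L2 M) (l2_class M f) (l2_class M g) = l2_class M (\<lambda>x. f x + g x)"
  using l2_fun_class_AE[OF assms(1)] l2_fun_class_AE[OF assms(2)]
  by (auto simp: L2_def intro!: l2_class_eqI elim!: eventually_rev_mp)

lemma L2_scale:
  assumes "f \<in> borel_measurable M"
  shows "hscale (L2 M) a (l2_class M f) = l2_class M (\<lambda>x. a * f x)"
  using l2_fun_class_AE[OF assms(1)]
  by (auto simp: L2_def intro!: l2_class_eqI)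

lemma L2_zero: "hzero (L2 M) = l2_class M (\<lambda>_. 0)"
  by (simp add: L2_def)

lemma L2_inner:
  assumes [measurable]: "f \<in> borel_measurable M" "g \<in> borel_measurable M"
  shows "hinner (L2 M) (l2_class M f) (l2_class M g) = (\<integral>x. f x * cnj (g x) \<partial>M)"
proof -
  have [measurable]: "l2_fun M (l2_class M f) \<in> borel_measurable M"
      "l2_fun M (l2_class M g) \<in> borel_measurable M"
    by (auto intro!: l2_fun_class_measurable assms)
  have "(\<integral>x. l2_fun M (l2_class M f) x * cnj (l2_fun M (l2_class M g) x) \<partial>M) = (\<integral>x. f x * cnj (g x) \<partial>M)"
  proof (rule integral_cong_AE)
    show "AE x in M. l2_fun M (l2_class M f) x * cnj (l2_fun M (l2_class M g) x) = f x * cnj (g x)"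
      using l2_fun_class_AE[OF assms(1)] l2_fun_class_AE[OF assms(2)] by eventually_elim simp
  qed measurable
  then show ?thesis by (simp add: L2_def)
qed

lemma L2_norm_sq:
  assumes "square_integrable M f"
  shows "(hnorm (L2 M) (l2_class M f))\<^sup>2 = (\<integral>x. (cmod (f x))\<^sup>2 \<partial>M)"
proof -
  have "hinner (L2 M) (l2_class M f) (l2_class M f) = (\<integral>x. complex_of_real ((cmod (f x))\<^sup>2) \<partial>M)"
    using assms by (simp add: L2_inner complex_norm_square del: of_real_power)
  also have "\<dots> = complex_of_real (\<integral>x. (cmod (f x))\<^sup>2 \<partial>M)"
    using assms by (intro integral_of_real) (auto simp: square_integrable_def)
  finally show ?thesis by (simp add: hnorm_def)
qed

lemma L2_norm_nn:
  assumes "square_integrable M f"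
  shows "ennreal ((hnorm (L2 M) (l2_class M f))\<^sup>2) = (\<integral>\<^sup>+x. ennreal ((cmod (f x))\<^sup>2) \<partial>M)"
  unfolding L2_norm_sq[OF assms]
proof (rule nn_integral_eq_integral[symmetric])
  show "integrable M (\<lambda>x. (cmod (f x))\<^sup>2)" using assms unfolding square_integrable_def by blast
qed simp

lemma complex_inner_space_L2: "complex_inner_space (L2 M)"
proof
  note sq = square_integrable_add square_integrable_scale square_integrable_zero
  note ops = L2_add L2_scale L2_zero L2_inner
  show "hzero (L2 M) \<in> hcarrier (L2 M)"
    by (auto simp: L2_carrier_iff L2_zero intro: sq)
  fix x assume x: "x \<in> hcarrier (L2 M)"
  then obtain f where f: "square_integrable M f" "x = l2_class M f" by (auto simp: L2_carrier_iff)
  note [measurable] = square_integrableD[OF f(1)]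
  show "hscale (L2 M) a x \<in> hcarrier (L2 M)" for a
    using f by (auto simp: ops intro!: l2_class_in_L2 sq)
  show "hadd (L2 M) x (hzero (L2 M)) = x" using f by (simp add: ops)
  show "hadd (L2 M) x (hscale (L2 M) (-1) x) = hzero (L2 M)" using f by (simp add: ops)
  show "hscale (L2 M) 1 x = x" using f by (simp add: ops)
  show "hscale (L2 M) a (hscale (L2 M) b x) = hscale (L2 M) (a * b) x" for a b
    using f by (simp add: ops mult.assoc)
  show "hscale (L2 M) (a + b) x = hadd (L2 M) (hscale (L2 M) a x) (hscale (L2 M) b x)" for a b
    using f by (simp add: ops distrib_right)
  have sqe: "hinner (L2 M) x x = complex_of_real (\<integral>x. (cmod (f x))\<^sup>2 \<partial>M)"
    using f by (simp add: L2_inner complex_norm_square[symmetric] integral_of_real del: of_real_power)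
  show "0 \<le> Re (hinner (L2 M) x x)" by (simp add: sqe)
  show "x = hzero (L2 M)" if "hinner (L2 M) x x = 0"
  proof -
    have "(\<integral>x. (cmod (f x))\<^sup>2 \<partial>M) = 0" using that sqe by simp
    then have "AE x in M. (cmod (f x))\<^sup>2 = 0"
      using f(1) by (subst (asm) integral_nonneg_eq_0_iff_AE) (auto simp: square_integrable_def)
    then show ?thesis unfolding f(2) L2_zero by (intro l2_class_eqI) auto
  qed
  fix y assume y: "y \<in> hcarrier (L2 M)"
  then obtain g where g: "square_integrable M g" "y = l2_class M g" by (auto simp: L2_carrier_iff)
  note [measurable] = square_integrableD[OF g(1)]
  show "hadd (L2 M) x y \<in> hcarrier (L2 M)"
    using f g by (auto simp: ops intro!: l2_class_in_L2 sq)
  show "hadd (L2 M) x y = hadd (L2 M) y x" using f g by (simp add: ops add.commute)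
  show "hscale (L2 M) a (hadd (L2 M) x y) = hadd (L2 M) (hscale (L2 M) a x) (hscale (L2 M) a y)" for a
    using f g by (simp add: ops distrib_left)
  show "hinner (L2 M) (hscale (L2 M) a x) y = a * hinner (L2 M) x y" for a
    using f g square_integrable_mult[OF f(1) g(1)] by (simp add: ops mult.assoc)
  show "hinner (L2 M) x y = cnj (hinner (L2 M) y x)"
  proof -
    have "cnj (\<integral>t. g t * cnj (f t) \<partial>M) = (\<integral>t. f t * cnj (g t) \<partial>M)"
      by (subst Bochner_Integration.integral_cnj[symmetric]) (simp add: mult.commute)
    then show ?thesis using f g by (simp add: ops)
  qed
  fix z assume z: "z \<in> hcarrier (L2 M)"
  then obtain h where h: "square_integrable M h" "z = l2_class M h" by (auto simp: L2_carrier_iff)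
  note [measurable] = square_integrableD[OF h(1)]
  show "hadd (L2 M) (hadd (L2 M) x y) z = hadd (L2 M) x (hadd (L2 M) y z)"
    using f g h by (simp add: ops add.assoc)
  show "hinner (L2 M) (hadd (L2 M) x y) z = hinner (L2 M) x z + hinner (L2 M) y z"
    using f g h square_integrable_mult[OF f(1) h(1)] square_integrable_mult[OF g(1) h(1)]
    by (simp add: ops distrib_right)
qed

lemma L2_sub:
  assumes "f \<in> borel_measurable M" "g \<in> borel_measurable M"
  shows "hsub (L2 M) (l2_class M f) (l2_class M g) = l2_class M (\<lambda>x. f x - g x)"
  using assms by (simp add: hsub_def L2_add L2_scale)

text \<open>The Riesz--Fischer theorem.  Along a rapidly convergent sequence, the weighted series
  \<open>\<Sum>\<^sub>n 2\<^sup>n |f\<^sub>n\<^sub>+\<^sub>1 - f\<^sub>n|\<^sup>2\<close> has a finite integral, so almost everywhere its terms are bounded and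
  the increments decay geometrically.  Hence the sequence converges almost everywhere, and by
  Fatou's lemma also in the mean.\<close>

theorem hilbert_space_L2: "hilbert_space (L2 M)"
proof -
  interpret complex_inner_space "L2 M" by (rule complex_inner_space_L2)
  show ?thesis
  proof (rule hilbert_spaceI_fast)
    fix x assume x: "range x \<subseteq> hcarrier (L2 M)"
      and fast: "\<And>n. hnorm (L2 M) (hsub (L2 M) (x (Suc n)) (x n)) \<le> (1/2) ^ n"
    define f where "f n = l2_fun M (x n)" for n
    have xC: "x n \<in> hcarrier (L2 M)" for n using x by auto
    have f: "square_integrable M (f n)" and xf: "x n = l2_class M (f n)" for n
      using l2_fun_square_integrable[OF xC[of n]] by (auto simp: f_def)
    note [measurable] = square_integrableD[OF f]
    have sqd: "square_integrable M (\<lambda>x. f m x - f n x)" for m n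
      using square_integrable_add[OF f[of m] square_integrable_scale[OF f[of n], of "-1"]] by simp
    have norm_diff: "(\<integral>\<^sup>+t. ennreal ((cmod (f m t - f n t))\<^sup>2) \<partial>M)
        = ennreal ((hnorm (L2 M) (hsub (L2 M) (x m) (x n)))\<^sup>2)" for m n
      using L2_norm_nn[OF sqd[of m n]] by (simp add: xf L2_sub)
    have dist: "hnorm (L2 M) (hsub (L2 M) (x (n + p)) (x n)) \<le> 2 * (1/2) ^ n - 2 * (1/2) ^ (n + p)" for n p
    proof (induction p)
      case 0
      then show ?case by (simp add: sub_self xC)
    next
      case (Suc p)
      have "hnorm (L2 M) (hsub (L2 M) (x (n + Suc p)) (x n)) \<le>
          hnorm (L2 M) (hsub (L2 M) (x (Suc (n + p))) (x (n + p))) +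
          hnorm (L2 M) (hsub (L2 M) (x (n + p)) (x n))"
        using norm_triangle[of "hsub (L2 M) (x (Suc (n + p))) (x (n + p))" "hsub (L2 M) (x (n + p)) (x n)"]
        by (simp add: sub_add_sub xC)
      then show ?case using Suc fast[of "n + p"] by simp
    qed
    have tail: "(\<integral>\<^sup>+t. ennreal ((cmod (f m t - f n t))\<^sup>2) \<partial>M) \<le> ennreal ((2 * (1/2) ^ n)\<^sup>2)"
      if "m \<ge> n" for m n
    proof -
      obtain p where p: "m = n + p" using \<open>m \<ge> n\<close> le_Suc_ex by blast
      have "hnorm (L2 M) (hsub (L2 M) (x m) (x n)) \<le> 2 * (1/2) ^ n"
        using dist[of n p] zero_le_power[of "1/2 :: real" "n + p"] unfolding p by linarith
      then show ?thesis unfolding norm_diff by (intro ennreal_leI power_mono) (auto simp: xC)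
    qed
    \<comment> \<open>The weights \<open>2\<^sup>n\<close> leave the integral finite, as the squared distances are at most \<open>4\<^sup>-\<^sup>n\<close>.\<close>
    define h where "h t = (\<Sum>n. ennreal (2 ^ n * (cmod (f (Suc n) t - f n t))\<^sup>2))" for t
    have "(\<integral>\<^sup>+t. h t \<partial>M) = (\<Sum>n. \<integral>\<^sup>+t. ennreal (2 ^ n * (cmod (f (Suc n) t - f n t))\<^sup>2) \<partial>M)"
      unfolding h_def by (rule nn_integral_suminf) measurable
    also have "\<dots> \<le> (\<Sum>n. ennreal ((1/2) ^ n))"
    proof (intro suminf_le allI summableI)
      fix n
      have "(\<integral>\<^sup>+t. ennreal (2 ^ n * (cmod (f (Suc n) t - f n t))\<^sup>2) \<partial>M)
          = ennreal (2 ^ n) * ennreal ((hnorm (L2 M) (hsub (L2 M) (x (Suc n)) (x n)))\<^sup>2)"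
        unfolding norm_diff[symmetric] by (subst nn_integral_cmult[symmetric]) (auto simp: ennreal_mult)
      also have "\<dots> \<le> ennreal (2 ^ n) * ennreal (((1/2) ^ n)\<^sup>2)"
        using fast[of n] by (intro mult_left_mono ennreal_leI power_mono) (auto simp: xC)
      also have "\<dots> = ennreal ((1/2) ^ n)"
        by (simp add: ennreal_mult[symmetric] power2_eq_square power_mult_distrib[symmetric] mult.assoc[symmetric])
      finally show "(\<integral>\<^sup>+t. ennreal (2 ^ n * (cmod (f (Suc n) t - f n t))\<^sup>2) \<partial>M) \<le> ennreal ((1/2) ^ n)" .
    qed
    also have "\<dots> = ennreal (\<Sum>n. (1/2) ^ n)"
      by (rule suminf_ennreal2) (auto intro: summable_geometric)
    finally have "(\<integral>\<^sup>+t. h t \<partial>M) \<noteq> \<infinity>" by (auto simp: top_unique)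
    then have "AE t in M. h t \<noteq> \<infinity>"
      by (intro nn_integral_PInf_AE) (auto simp: h_def)
    then have conv: "AE t in M. convergent (\<lambda>n. f n t)"
    proof eventually_elim
      case (elim t)
      define a where "a n = 2 ^ n * (cmod (f (Suc n) t - f n t))\<^sup>2" for n
      define C where "C = enn2real (h t)"
      have C: "h t = ennreal C" "C \<ge> 0"
        using elim by (simp_all add: C_def ennreal_enn2real_if)
      have aC: "a n \<le> C" for n
      proof -
        have "(\<Sum>k\<in>{n}. ennreal (a k)) \<le> (\<Sum>k. ennreal (a k))"
          by (rule sum_le_suminf) auto
        then have "ennreal (a n) \<le> h t" by (simp add: h_def a_def)
        then show ?thesis using C by simp
      qed
      have "cmod (f (Suc n) t - f n t) \<le> sqrt C * (1 / sqrt 2) ^ n" for n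
      proof -
        have "((1 / sqrt 2) ^ n)\<^sup>2 = (1 / 2 :: real) ^ n"
          by (simp add: power_divide power_even_eq[symmetric] power_mult[symmetric] mult.commute[of n])
            (simp add: power_mult)
        then have "(sqrt C * (1 / sqrt 2) ^ n)\<^sup>2 = C * (1 / 2) ^ n"
          using C(2) by (simp add: power_mult_distrib)
        moreover have "(cmod (f (Suc n) t - f n t))\<^sup>2 \<le> C * (1 / 2) ^ n"
          using aC[of n] by (simp add: a_def field_simps)
        ultimately have "(cmod (f (Suc n) t - f n t))\<^sup>2 \<le> (sqrt C * (1 / sqrt 2) ^ n)\<^sup>2" by simp
        then show ?thesis by (rule power2_le_imp_le) (simp add: C(2))
      qed
      moreover have "summable (\<lambda>n. sqrt C * (1 / sqrt 2) ^ n)"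
      proof (rule summable_mult[OF summable_geometric])
        have "(1 :: real) < sqrt 2" by (rule real_less_rsqrt) simp
        then show "norm (1 / sqrt 2) < 1" by (simp add: norm_divide)
      qed
      ultimately have "summable (\<lambda>n. f (Suc n) t - f n t)"
        by (rule_tac summable_comparison_test'[where N=0]) assumption
      then have "convergent (\<lambda>n. \<Sum>i<n. f (Suc i) t - f i t)" by (simp add: summable_iff_convergent)
      then have "convergent (\<lambda>n. f n t - f 0 t)" 
        unfolding sum_lessThan_telescope[of "\<lambda>i. f i t"] .
      then have "convergent (\<lambda>n. f n t - f 0 t + f 0 t)" by (intro convergent_add convergent_const)
      then show ?case by simp
    qed
    \<comment> \<open>Where the sequence diverges, \<open>lim\<close> is an arbitrary value; this happens on a null set only.\<close>
    define F where "F t = lim (\<lambda>n. f n t)" for t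
    have [measurable]: "F \<in> borel_measurable M"
      unfolding F_def by (rule borel_measurable_lim_metric) measurable
    have lim: "AE t in M. (\<lambda>n. f n t) \<longlonglongrightarrow> F t"
      using conv by eventually_elim (simp add: F_def convergent_LIMSEQ_iff)
    have close: "(\<integral>\<^sup>+t. ennreal ((cmod (F t - f n t))\<^sup>2) \<partial>M) \<le> ennreal ((2 * (1/2) ^ n)\<^sup>2)" for n
    proof -
      have "(\<integral>\<^sup>+t. ennreal ((cmod (F t - f n t))\<^sup>2) \<partial>M)
          = (\<integral>\<^sup>+t. liminf (\<lambda>m. ennreal ((cmod (f m t - f n t))\<^sup>2)) \<partial>M)"
      proof (rule nn_integral_cong_AE)
        show "AE t in M. ennreal ((cmod (F t - f n t))\<^sup>2) = liminf (\<lambda>m. ennreal ((cmod (f m t - f n t))\<^sup>2))"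
          using lim
        proof eventually_elim
          case (elim t)
          then have "(\<lambda>m. ennreal ((cmod (f m t - f n t))\<^sup>2)) \<longlonglongrightarrow> ennreal ((cmod (F t - f n t))\<^sup>2)"
            by (intro tendsto_intros) auto
          then show ?case by (rule lim_imp_Liminf[OF trivial_limit_sequentially, symmetric])
        qed
      qed
      also have "\<dots> \<le> liminf (\<lambda>m. \<integral>\<^sup>+t. ennreal ((cmod (f m t - f n t))\<^sup>2) \<partial>M)"
        by (rule nn_integral_liminf) measurable
      also have "\<dots> \<le> ennreal ((2 * (1/2) ^ n)\<^sup>2)"
        by (rule Liminf_le) (use tail in \<open>auto simp: eventually_sequentially\<close>)
      finally show ?thesis .
    qed
    have sqF: "square_integrable M (\<lambda>t. F t - f n t)" for n
      using close[of n] by (subst square_integrable_iff) (auto intro: le_less_trans)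
    have F: "square_integrable M F"
      using square_integrable_add[OF sqF[of 0] f[of 0]] by simp
    have "hnorm (L2 M) (hsub (L2 M) (x n) (l2_class M F)) \<le> 2 * (1/2) ^ n" for n
    proof -
      have "ennreal ((hnorm (L2 M) (hsub (L2 M) (l2_class M F) (x n)))\<^sup>2) \<le> ennreal ((2 * (1/2) ^ n)\<^sup>2)"
        using close[of n] L2_norm_nn[OF sqF[of n]] by (simp add: xf L2_sub)
      then have "(hnorm (L2 M) (hsub (L2 M) (x n) (l2_class M F)))\<^sup>2 \<le> (2 * (1/2) ^ n)\<^sup>2"
        by (simp add: norm_sub_commute xC l2_class_in_L2 F)
      then show ?thesis by (rule power2_le_imp_le) simp
    qed
    then have "\<forall>\<^sub>F n in sequentially. norm (hnorm (L2 M) (hsub (L2 M) (x n) (l2_class M F))) \<le> 2 * (1/2) ^ n"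
      by (simp add: xC l2_class_in_L2 F)
    moreover have "(\<lambda>n. 2 * (1/2) ^ n :: real) \<longlonglongrightarrow> 0"
      by (rule tendsto_mult_right_zero[OF LIMSEQ_power_zero]) simp
    ultimately have "(\<lambda>n. hnorm (L2 M) (hsub (L2 M) (x n) (l2_class M F))) \<longlonglongrightarrow> 0"
      by (rule Lim_null_comparison)
    then show "\<exists>l. converges x l"
      using x l2_class_in_L2[OF F] by (auto simp: converges_def)
  qed
qed

section \<open>Direct sums of Hilbert spaces\<close>

lemma (in complex_inner_space) norm_converges:
  assumes "converges x l" "a \<in> hcarrier V"
  shows "(\<lambda>n. hnorm V (hsub V a (x n))) \<longlonglongrightarrow> hnorm V (hsub V a l)"
proof -
  have xC: "x n \<in> hcarrier V" and lC: "l \<in> hcarrier V" for n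
    using assms(1) by (auto simp: converges_def)
  have "\<bar>hnorm V (hsub V a (x n)) - hnorm V (hsub V a l)\<bar> \<le> hnorm V (hsub V (x n) l)" for n
  proof -
    have "hnorm V (hsub V a l) \<le> hnorm V (hsub V a (x n)) + hnorm V (hsub V (x n) l)"
      using norm_triangle[of "hsub V a (x n)" "hsub V (x n) l"] by (simp add: sub_add_sub assms(2) xC lC)
    moreover have "hnorm V (hsub V a (x n)) \<le> hnorm V (hsub V a l) + hnorm V (hsub V l (x n))"
      using norm_triangle[of "hsub V a l" "hsub V l (x n)"] by (simp add: sub_add_sub assms(2) xC lC)
    ultimately show ?thesis using norm_sub_commute[OF lC xC[of n]] by linarith
  qed
  then have "\<forall>\<^sub>F n in sequentially. norm (hnorm V (hsub V a (x n)) - hnorm V (hsub V a l))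
      \<le> hnorm V (hsub V (x n) l)"
    by (simp only: real_norm_def eventually_True)
  moreover have "(\<lambda>n. hnorm V (hsub V (x n) l)) \<longlonglongrightarrow> 0"
    using assms(1) by (simp only: converges_def)
  ultimately have "(\<lambda>n. hnorm V (hsub V a (x n)) - hnorm V (hsub V a l)) \<longlonglongrightarrow> 0"
    by (rule Lim_null_comparison)
  then show ?thesis by (rule LIM_zero_cancel)
qed

locale hilbert_family =
  fixes I :: "'i set" and V :: "'i \<Rightarrow> 'v hspace"
  assumes inner: "i \<in> I \<Longrightarrow> complex_inner_space (V i)"
begin

abbreviation "S \<equiv> hsum I V"

lemma hsum_carrier_iff:
  "f \<in> hcarrier S \<longleftrightarrow> f \<in> extensional I \<and> (\<forall>i\<in>I. f i \<in> hcarrier (V i)) \<and>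
    (\<lambda>i. (hnorm (V i) (f i))\<^sup>2) summable_on I"
  by (auto simp: hsum_def PiE_iff)

lemma carrierD:
  assumes "f \<in> hcarrier S"
  shows "i \<in> I \<Longrightarrow> f i \<in> hcarrier (V i)" and "(\<lambda>i. (hnorm (V i) (f i))\<^sup>2) summable_on I"
    and "f \<in> extensional I"
  using assms by (auto simp: hsum_carrier_iff)

lemma hsum_simps:
  shows "i \<in> I \<Longrightarrow> hzero S i = hzero (V i)"
    and "i \<in> I \<Longrightarrow> hadd S f g i = hadd (V i) (f i) (g i)"
    and "i \<in> I \<Longrightarrow> hscale S a f i = hscale (V i) a (f i)"
    and "hinner S f g = (\<Sum>\<^sub>\<infinity>i\<in>I. hinner (V i) (f i) (g i))"
    and "hzero S \<in> extensional I" "hadd S f g \<in> extensional I" "hscale S a f \<in> extensional I"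
  by (auto simp: hsum_def)

lemma hsum_sub: "i \<in> I \<Longrightarrow> hsub S f g i = hsub (V i) (f i) (g i)"
  by (simp add: hsub_def hsum_simps)

lemma add_closed: 
  assumes f: "f \<in> hcarrier S" and g: "g \<in> hcarrier S"
  shows "hadd S f g \<in> hcarrier S"
  unfolding hsum_carrier_iff
proof (intro conjI ballI)
  have "(\<lambda>i. 2 * (hnorm (V i) (f i))\<^sup>2 + 2 * (hnorm (V i) (g i))\<^sup>2) summable_on I"
    by (intro summable_on_add summable_on_cmult_right carrierD(2) f g)
  then show "(\<lambda>i. (hnorm (V i) (hadd S f g i))\<^sup>2) summable_on I"
    by (rule summable_on_comparison_test)
      (auto simp: hsum_simps intro!: complex_inner_space.norm_add_sq_le[OF inner] carrierD(1)[OF f] carrierD(1)[OF g])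
  fix i assume i: "i \<in> I"
  then show "hadd S f g i \<in> hcarrier (V i)"
    by (auto simp: hsum_simps intro!: complex_inner_space.add_closed[OF inner] carrierD(1)[OF f] carrierD(1)[OF g])
qed (simp add: hsum_simps)

lemma scale_closed:
  assumes f: "f \<in> hcarrier S"
  shows "hscale S a f \<in> hcarrier S"
  unfolding hsum_carrier_iff
proof (intro conjI ballI)
  have "(\<lambda>i. (cmod a)\<^sup>2 * (hnorm (V i) (f i))\<^sup>2) summable_on I"
    by (intro summable_on_cmult_right carrierD(2) f)
  then show "(\<lambda>i. (hnorm (V i) (hscale S a f i))\<^sup>2) summable_on I"
    by (rule summable_on_cong[THEN iffD1, rotated])
      (simp add: hsum_simps complex_inner_space.hnorm_scale[OF inner] carrierD(1)[OF f] power_mult_distrib)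
  fix i assume i: "i \<in> I"
  then show "hscale S a f i \<in> hcarrier (V i)"
    by (auto simp: hsum_simps intro!: complex_inner_space.scale_closed[OF inner] carrierD(1)[OF f])
qed (simp add: hsum_simps)

lemma zero_closed: "hzero S \<in> hcarrier S"
  unfolding hsum_carrier_iff
proof (intro conjI ballI)
  have "(\<lambda>i. 0 :: real) summable_on I" by simp
  then show "(\<lambda>i. (hnorm (V i) (hzero S i))\<^sup>2) summable_on I"
    by (rule summable_on_cong[THEN iffD1, rotated])
      (simp add: hsum_simps complex_inner_space.hnorm_zero[OF inner])
qed (auto simp: hsum_simps complex_inner_space.zero_closed[OF inner])

text \<open>The inner products are dominated by the sum of the squared norms, which is summable.\<close>

lemma inner_summable:
  assumes f: "f \<in> hcarrier S" and g: "g \<in> hcarrier S"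
  shows "(\<lambda>i. hinner (V i) (f i) (g i)) summable_on I"
proof -
  have "(\<lambda>i. (hnorm (V i) (f i))\<^sup>2 + (hnorm (V i) (g i))\<^sup>2) summable_on I"
    by (intro summable_on_add carrierD(2) f g)
  then have "(\<lambda>i. cmod (hinner (V i) (f i) (g i))) summable_on I"
  proof (rule summable_on_comparison_test)
    fix i assume i: "i \<in> I"
    interpret Vi: complex_inner_space "V i" by (rule inner[OF i])
    have "cmod (hinner (V i) (f i) (g i)) \<le> hnorm (V i) (f i) * hnorm (V i) (g i)"
      by (intro Vi.Cauchy_Schwarz carrierD(1) f g i)
    moreover have "2 * (hnorm (V i) (f i) * hnorm (V i) (g i)) \<le> (hnorm (V i) (f i))\<^sup>2 + (hnorm (V i) (g i))\<^sup>2"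
      using zero_le_power2[of "hnorm (V i) (f i) - hnorm (V i) (g i)"] unfolding power2_diff by linarith
    moreover have "0 \<le> hnorm (V i) (f i) * hnorm (V i) (g i)"
      by (intro mult_nonneg_nonneg Vi.hnorm_nonneg carrierD(1) f g i)
    ultimately show "cmod (hinner (V i) (f i) (g i)) \<le> (hnorm (V i) (f i))\<^sup>2 + (hnorm (V i) (g i))\<^sup>2"
      by linarith
  qed simp
  then show ?thesis by (rule abs_summable_summable)
qed

lemma inner_self_hsum:
  assumes f: "f \<in> hcarrier S"
  shows "hinner S f f = complex_of_real (\<Sum>\<^sub>\<infinity>i\<in>I. (hnorm (V i) (f i))\<^sup>2)"
proof -
  have "((\<lambda>i. complex_of_real ((hnorm (V i) (f i))\<^sup>2)) has_sum
      complex_of_real (\<Sum>\<^sub>\<infinity>i\<in>I. (hnorm (V i) (f i))\<^sup>2)) I"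
    by (intro has_sum_of_real has_sum_infsum carrierD(2) f)
  then have "((\<lambda>i. hinner (V i) (f i) (f i)) has_sum complex_of_real (\<Sum>\<^sub>\<infinity>i\<in>I. (hnorm (V i) (f i))\<^sup>2)) I"
    by (rule has_sum_cong[THEN iffD1, rotated])
      (simp add: complex_inner_space.inner_self[OF inner] carrierD(1)[OF f])
  then show ?thesis unfolding hsum_simps by (rule infsumI)
qed

lemma norm_sq_hsum:
  "f \<in> hcarrier S \<Longrightarrow> (hnorm S f)\<^sup>2 = (\<Sum>\<^sub>\<infinity>i\<in>I. (hnorm (V i) (f i))\<^sup>2)"
  using inner_self_hsum[of f] by (simp add: hnorm_def[of S] infsum_nonneg)

lemma complex_inner_space_hsum: "complex_inner_space S"
proof
  note cl = add_closed scale_closed zero_closed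
  note ext = extensionalityI[of _ I]
  show "hzero S \<in> hcarrier S" by (rule cl)
  fix x assume x: "x \<in> hcarrier S"
  note xi = carrierD(1)[OF x] and xe = carrierD(3)[OF x]
  show "hscale S a x \<in> hcarrier S" for a by (intro cl x)
  show "hadd S x (hzero S) = x"
    by (rule ext) (auto simp: hsum_simps xi xe intro: complex_inner_space.add_zero[OF inner])
  show "hadd S x (hscale S (-1) x) = hzero S"
    by (rule ext) (auto simp: hsum_simps xi xe intro: complex_inner_space.add_minus[OF inner])
  show "hscale S 1 x = x"
    by (rule ext) (auto simp: hsum_simps xi xe intro: complex_inner_space.scale_one[OF inner])
  show "hscale S a (hscale S b x) = hscale S (a * b) x" for a b
    by (rule ext) (auto simp: hsum_simps xi xe intro: complex_inner_space.scale_scale[OF inner])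
  show "hscale S (a + b) x = hadd S (hscale S a x) (hscale S b x)" for a b
    by (rule ext) (auto simp: hsum_simps xi xe intro: complex_inner_space.scale_add_left[OF inner])
  show "0 \<le> Re (hinner S x x)"
    by (simp add: inner_self_hsum[OF x] infsum_nonneg)
  show "x = hzero S" if "hinner S x x = 0"
  proof (rule ext)
    fix i assume i: "i \<in> I"
    have "(\<Sum>\<^sub>\<infinity>i\<in>I. (hnorm (V i) (x i))\<^sup>2) \<le> 0" using that inner_self_hsum[OF x] by simp
    then have "(hnorm (V i) (x i))\<^sup>2 = 0"
      by (rule nonneg_infsum_le_0D) (use carrierD(2)[OF x] i in auto)
    then show "x i = hzero S i"
      using complex_inner_space.hnorm_eq_0[OF inner[OF i] xi[OF i]] i by (simp add: hsum_simps)
  qed (auto simp: hsum_simps xe)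
  fix y assume y: "y \<in> hcarrier S"
  note yi = carrierD(1)[OF y] and ye = carrierD(3)[OF y]
  show "hadd S x y \<in> hcarrier S" by (intro cl x y)
  show "hadd S x y = hadd S y x"
    by (rule ext) (auto simp: hsum_simps xi xe yi intro: complex_inner_space.add_commute[OF inner])
  show "hscale S a (hadd S x y) = hadd S (hscale S a x) (hscale S a y)" for a
    by (rule ext) (auto simp: hsum_simps xi yi intro: complex_inner_space.scale_add_right[OF inner])
  show "hinner S (hscale S a x) y = a * hinner S x y" for a
  proof -
    have "hinner S (hscale S a x) y = (\<Sum>\<^sub>\<infinity>i\<in>I. a * hinner (V i) (x i) (y i))"
      unfolding hsum_simps(4)
      by (rule infsum_cong) (simp add: hsum_simps complex_inner_space.inner_scale_left[OF inner] xi yi)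
    then show ?thesis by (simp add: hsum_simps infsum_cmult_right')
  qed
  show "hinner S x y = cnj (hinner S y x)"
    unfolding hsum_simps(4) infsum_cnj[symmetric]
    by (rule infsum_cong) (rule complex_inner_space.inner_commute[OF inner xi yi])
  fix z assume z: "z \<in> hcarrier S"
  note zi = carrierD(1)[OF z]
  show "hadd S (hadd S x y) z = hadd S x (hadd S y z)"
    by (rule ext) (auto simp: hsum_simps xi yi zi intro: complex_inner_space.add_assoc[OF inner])
  show "hinner S (hadd S x y) z = hinner S x z + hinner S y z"
  proof -
    have "hinner S (hadd S x y) z = (\<Sum>\<^sub>\<infinity>i\<in>I. hinner (V i) (x i) (z i) + hinner (V i) (y i) (z i))"
      unfolding hsum_simps(4)
      by (rule infsum_cong) (simp add: hsum_simps complex_inner_space.inner_add_left[OF inner] xi yi zi)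
    also have "\<dots> = hinner S x z + hinner S y z"
      unfolding hsum_simps(4) by (intro infsum_add inner_summable x y z)
    finally show ?thesis .
  qed
qed

sublocale sum: complex_inner_space S
  by (rule complex_inner_space_hsum)

lemma finite_sum_le_norm_sq:
  assumes f: "f \<in> hcarrier S" and F: "finite F" "F \<subseteq> I"
  shows "(\<Sum>i\<in>F. (hnorm (V i) (f i))\<^sup>2) \<le> (hnorm S f)\<^sup>2"
  unfolding norm_sq_hsum[OF f] by (rule finite_sum_le_infsum) (use F carrierD(2)[OF f] in auto)

lemma component_norm_le:
  assumes f: "f \<in> hcarrier S" and i: "i \<in> I"
  shows "hnorm (V i) (f i) \<le> hnorm S f"
  using finite_sum_le_norm_sq[OF f, of "{i}"] i f by (auto intro: power2_le_imp_le)

text \<open>Componentwise limits of a Cauchy sequence assemble to its limit: the distance to the limit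
  is controlled on finitely many components at a time.\<close>

lemma hilbert_space_hsum:
  assumes hilbert: "\<And>i. i \<in> I \<Longrightarrow> hilbert_space (V i)"
  shows "hilbert_space S"
proof (rule sum.hilbert_spaceI)
  fix x assume x: "sum.cauchy x"
  then have xC: "x n \<in> hcarrier S" for n by (auto simp: sum.cauchy_def)
  note xi = carrierD(1)[OF xC]
  have "\<exists>l. complex_inner_space.converges (V i) (\<lambda>n. x n i) l" if i: "i \<in> I" for i
  proof -
    interpret Vi: hilbert_space "V i" by (rule hilbert[OF i])
    have "hnorm (V i) (hsub (V i) (x n i) (x k i)) \<le> hnorm S (hsub S (x n) (x k))" for n k
      using component_norm_le[of "hsub S (x n) (x k)" i] i xC by (simp add: hsum_sub)
    then have "Vi.cauchy (\<lambda>n. x n i)"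
      using x xi[OF i] unfolding Vi.cauchy_def sum.cauchy_def
      by (auto intro: le_less_trans) (meson le_less_trans)
    then show ?thesis by (rule Vi.cauchy_converges)
  qed
  then obtain l where l: "\<And>i. i \<in> I \<Longrightarrow> complex_inner_space.converges (V i) (\<lambda>n. x n i) (l i)" by metis
  define L where "L = restrict l I"
  have lC: "l i \<in> hcarrier (V i)" if "i \<in> I" for i
    using l[OF that] complex_inner_space.converges_def[OF inner[OF that]] by blast
  have part: "(\<Sum>i\<in>F. (hnorm (V i) (hsub (V i) (x n i) (l i)))\<^sup>2) \<le> e\<^sup>2"
    if N: "\<And>k. k \<ge> N \<Longrightarrow> hnorm S (hsub S (x n) (x k)) < e" and F: "finite F" "F \<subseteq> I" for F n N and e :: real
  proof (rule LIMSEQ_le_const2)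
    show "(\<lambda>k. \<Sum>i\<in>F. (hnorm (V i) (hsub (V i) (x n i) (x k i)))\<^sup>2)
        \<longlonglongrightarrow> (\<Sum>i\<in>F. (hnorm (V i) (hsub (V i) (x n i) (l i)))\<^sup>2)"
      using F l xi by (intro tendsto_intros complex_inner_space.norm_converges[OF inner]) auto
    have "(\<Sum>i\<in>F. (hnorm (V i) (hsub (V i) (x n i) (x k i)))\<^sup>2) \<le> e\<^sup>2" if k: "k \<ge> N" for k
    proof -
      have "(\<Sum>i\<in>F. (hnorm (V i) (hsub (V i) (x n i) (x k i)))\<^sup>2) \<le> (hnorm S (hsub S (x n) (x k)))\<^sup>2"
        using finite_sum_le_norm_sq[of "hsub S (x n) (x k)", OF _ F] F xC
        by (simp add: hsum_sub subset_iff)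
      also have "\<dots> \<le> e\<^sup>2" using N[OF k] xC by (intro power_mono) auto
      finally show ?thesis .
    qed
    then show "\<exists>N. \<forall>k\<ge>N. (\<Sum>i\<in>F. (hnorm (V i) (hsub (V i) (x n i) (x k i)))\<^sup>2) \<le> e\<^sup>2" by blast
  qed
  define d where "d n = (\<lambda>i\<in>I. hsub (V i) (x n i) (l i))" for n
  have di: "d n i \<in> hcarrier (V i)" if "i \<in> I" for n i
    using that complex_inner_space.hsub_closed[OF inner] xi lC by (simp add: d_def)
  have d: "d n \<in> hcarrier S \<and> hnorm S (d n) \<le> e"
    if N: "\<And>k. k \<ge> N \<Longrightarrow> hnorm S (hsub S (x n) (x k)) < e" and e: "e > 0" for n N and e :: real
  proof -
    have part': "(\<Sum>i\<in>F. (hnorm (V i) (d n i))\<^sup>2) \<le> e\<^sup>2" if "finite F" "F \<subseteq> I" for F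
      using part[OF N that] that by (simp add: d_def subset_iff)
    have "(\<lambda>i. (hnorm (V i) (d n i))\<^sup>2) summable_on I"
      by (rule nonneg_bdd_above_summable_on) (auto intro!: bdd_aboveI[of _ "e\<^sup>2"] part')
    then have *: "d n \<in> hcarrier S" using di by (simp add: hsum_carrier_iff) (simp add: d_def)
    have "(hnorm S (d n))\<^sup>2 \<le> e\<^sup>2"
      unfolding norm_sq_hsum[OF *] by (rule infsum_le_finite_sums) (use part' carrierD(2)[OF *] in auto)
    then show ?thesis using * e by (auto intro: power2_le_imp_le)
  qed
  have C: "\<exists>N. \<forall>n\<ge>N. \<forall>k\<ge>N. hnorm S (hsub S (x n) (x k)) < e" if "e > 0" for e
    using x that by (simp add: sum.cauchy_def)
  obtain N where N: "\<And>n k. n \<ge> N \<Longrightarrow> k \<ge> N \<Longrightarrow> hnorm S (hsub S (x n) (x k)) < 1"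
    using C[of 1] by auto
  have dN: "d N \<in> hcarrier S" using d[of N N 1] N by auto
  \<comment> \<open>Square summability of the limit is inherited from one member of the sequence.\<close>
  have "L = hsub S (x N) (d N)"
  proof (rule extensionalityI[of _ I])
    fix i assume i: "i \<in> I"
    interpret Vi: complex_inner_space "V i" by (rule inner[OF i])
    show "L i = hsub S (x N) (d N) i"
      unfolding hsum_sub[OF i]
      by (rule Vi.vec_eqI) (use i xi[OF i] lC[OF i] in \<open>auto simp: L_def d_def Vi.inner_simps\<close>)
  qed (auto simp: L_def hsub_def hsum_simps)
  then have LC: "L \<in> hcarrier S" using xC dN by simp
  have xL: "hsub S (x n) L = d n" for n
    by (rule extensionalityI[of _ I]) (auto simp: hsum_sub L_def d_def, auto simp: hsub_def hsum_simps)
  have "(\<lambda>n. hnorm S (hsub S (x n) L)) \<longlonglongrightarrow> 0"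
  proof (rule LIMSEQ_I)
    fix e :: real assume e: "e > 0"
    obtain N where N: "\<And>n k. n \<ge> N \<Longrightarrow> k \<ge> N \<Longrightarrow> hnorm S (hsub S (x n) (x k)) < e/2"
      using C[of "e/2"] e by auto
    have "hnorm S (hsub S (x n) L) < e" if "n \<ge> N" for n
      using d[of N n "e/2"] N[OF that] e by (simp add: xL)
    then show "\<exists>no. \<forall>n\<ge>no. norm (hnorm S (hsub S (x n) L) - 0) < e"
      using xC LC by auto
  qed
  then show "\<exists>l. sum.converges x l" using xC LC by (auto simp: sum.converges_def)
qed

end

lemma hprod_simps [simp]:
  "hcarrier (hprod V W) = hcarrier V \<times> hcarrier W"
  "hzero (hprod V W) = (hzero V, hzero W)"
  "hadd (hprod V W) x y = (hadd V (fst x) (fst y), hadd W (snd x) (snd y))"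
  "hscale (hprod V W) a x = (hscale V a (fst x), hscale W a (snd x))"
  "hinner (hprod V W) x y = hinner V (fst x) (fst y) + hinner W (snd x) (snd y)"
  by (simp_all add: hprod_def)

lemma hprod_sub [simp]: "hsub (hprod V W) x y = (hsub V (fst x) (fst y), hsub W (snd x) (snd y))"
  by (simp add: hsub_def)

lemma complex_inner_space_hprod:
  assumes "complex_inner_space V" "complex_inner_space W"
  shows "complex_inner_space (hprod V W)"
proof -
  interpret V: complex_inner_space V by fact
  interpret W: complex_inner_space W by fact
  show ?thesis
  proof
    fix x y z assume x: "x \<in> hcarrier (hprod V W)"
    then have x': "fst x \<in> hcarrier V" "snd x \<in> hcarrier W" by auto
    show "0 \<le> Re (hinner (hprod V W) x x)"
      using x' V.inner_nonneg W.inner_nonneg by simp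
    show "x = hzero (hprod V W)" if "hinner (hprod V W) x x = 0"
    proof -
      have "hinner V (fst x) (fst x) + hinner W (snd x) (snd x) = 0" using that by simp
      then have "complex_of_real ((hnorm V (fst x))\<^sup>2 + (hnorm W (snd x))\<^sup>2) = 0"
        using x' by (simp add: V.inner_self W.inner_self)
      then have "(hnorm V (fst x))\<^sup>2 + (hnorm W (snd x))\<^sup>2 = 0" by (simp only: of_real_eq_0_iff)
      then have "hnorm V (fst x) = 0" "hnorm W (snd x) = 0"
        by (simp_all add: sum_power2_eq_zero_iff)
      then show ?thesis using x' by (cases x) (auto simp: V.hnorm_eq_0 W.hnorm_eq_0)
    qed
    show "hscale (hprod V W) a x \<in> hcarrier (hprod V W)" for a
      using x' by simp
    show "hadd (hprod V W) x (hzero (hprod V W)) = x"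
      using x' by (simp add: V.add_zero W.add_zero)
    show "hadd (hprod V W) x (hscale (hprod V W) (-1) x) = hzero (hprod V W)"
      using x' by (simp add: V.add_minus W.add_minus)
    show "hscale (hprod V W) 1 x = x"
      using x' by (simp add: V.scale_one W.scale_one)
    show "hscale (hprod V W) a (hscale (hprod V W) b x) = hscale (hprod V W) (a * b) x" for a b
      using x' by (simp add: V.scale_scale W.scale_scale)
    show "hscale (hprod V W) (a + b) x = hadd (hprod V W) (hscale (hprod V W) a x) (hscale (hprod V W) b x)"
      for a b
      using x' by (simp add: V.scale_add_left W.scale_add_left)
    assume y: "y \<in> hcarrier (hprod V W)"
    then have y': "fst y \<in> hcarrier V" "snd y \<in> hcarrier W" by auto
    show "hadd (hprod V W) x y \<in> hcarrier (hprod V W)"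
      using x' y' by simp
    show "hinner (hprod V W) x y = cnj (hinner (hprod V W) y x)"
      using x' y' V.inner_commute[of "fst x" "fst y"] W.inner_commute[of "snd x" "snd y"] by simp
    show "hadd (hprod V W) x y = hadd (hprod V W) y x"
      using x' y' V.add_commute[of "fst x" "fst y"] W.add_commute[of "snd x" "snd y"] by simp
    show "hscale (hprod V W) a (hadd (hprod V W) x y)
        = hadd (hprod V W) (hscale (hprod V W) a x) (hscale (hprod V W) a y)" for a
      using x' y' by (simp add: V.scale_add_right W.scale_add_right)
    show "hinner (hprod V W) (hscale (hprod V W) a x) y = a * hinner (hprod V W) x y" for a
      using x' y' by (simp add: V.inner_scale_left W.inner_scale_left distrib_left)
    assume z: "z \<in> hcarrier (hprod V W)"
    then have z': "fst z \<in> hcarrier V" "snd z \<in> hcarrier W" by auto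
    show "hadd (hprod V W) (hadd (hprod V W) x y) z = hadd (hprod V W) x (hadd (hprod V W) y z)"
      using x' y' z' by (simp add: V.add_assoc W.add_assoc)
    show "hinner (hprod V W) (hadd (hprod V W) x y) z = hinner (hprod V W) x z + hinner (hprod V W) y z"
      using x' y' z' by (simp add: V.inner_add_left W.inner_add_left)
  qed (simp add: V.zero_closed W.zero_closed)
qed

lemma norm_sq_hprod:
  assumes "complex_inner_space V" "complex_inner_space W" "x \<in> hcarrier (hprod V W)"
  shows "(hnorm (hprod V W) x)\<^sup>2 = (hnorm V (fst x))\<^sup>2 + (hnorm W (snd x))\<^sup>2"
proof -
  have "fst x \<in> hcarrier V" "snd x \<in> hcarrier W" using assms(3) by auto
  then show ?thesis
    using complex_inner_space.hnorm_sq[OF complex_inner_space_hprod[OF assms(1,2)] assms(3)]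
      complex_inner_space.hnorm_sq[OF assms(1)] complex_inner_space.hnorm_sq[OF assms(2)]
    by simp
qed

lemma hilbert_space_hprod:
  assumes "hilbert_space V" "hilbert_space W"
  shows "hilbert_space (hprod V W)"
proof -
  interpret V: hilbert_space V by fact
  interpret W: hilbert_space W by fact
  interpret P: complex_inner_space "hprod V W"
    by (intro complex_inner_space_hprod V.complex_inner_space_axioms W.complex_inner_space_axioms)
  note norm_sq = norm_sq_hprod[OF V.complex_inner_space_axioms W.complex_inner_space_axioms]
  have fst_le: "hnorm V (fst x) \<le> hnorm (hprod V W) x" and snd_le: "hnorm W (snd x) \<le> hnorm (hprod V W) x"
    if "x \<in> hcarrier (hprod V W)" for x
    by (rule power2_le_imp_le[OF _ P.hnorm_nonneg[OF that]], simp add: norm_sq[OF that])+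
  show ?thesis
  proof (rule P.hilbert_spaceI)
    fix x assume x: "P.cauchy x"
    then have xC: "x n \<in> hcarrier (hprod V W)" for n unfolding P.cauchy_def by blast
    then have xC': "fst (x n) \<in> hcarrier V" "snd (x n) \<in> hcarrier W" for n by (simp_all add: mem_Times_iff)
    have C: "\<exists>N. \<forall>n\<ge>N. \<forall>k\<ge>N. hnorm (hprod V W) (hsub (hprod V W) (x n) (x k)) < e" if "e > 0" for e
      using x that unfolding P.cauchy_def by blast
    have le: "hnorm V (hsub V (fst (x n)) (fst (x k))) \<le> hnorm (hprod V W) (hsub (hprod V W) (x n) (x k))"
      "hnorm W (hsub W (snd (x n)) (snd (x k))) \<le> hnorm (hprod V W) (hsub (hprod V W) (x n) (x k))" for n k
      using fst_le[OF P.hsub_closed[OF xC xC], of n k] snd_le[OF P.hsub_closed[OF xC xC], of n k]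
      by simp_all
    have "V.cauchy (\<lambda>n. fst (x n))"
      unfolding V.cauchy_def using C le(1) xC' by (meson image_subsetI le_less_trans)
    then obtain l where l: "V.converges (\<lambda>n. fst (x n)) l" using V.cauchy_converges by blast
    have "W.cauchy (\<lambda>n. snd (x n))"
      unfolding W.cauchy_def using C le(2) xC' by (meson image_subsetI le_less_trans)
    then obtain k where k: "W.converges (\<lambda>n. snd (x n)) k" using W.cauchy_converges by blast
    have lk: "(l, k) \<in> hcarrier (hprod V W)"
      using l k by (simp add: V.converges_def W.converges_def)
    have "(\<lambda>n. sqrt ((hnorm V (hsub V (fst (x n)) l))\<^sup>2 + (hnorm W (hsub W (snd (x n)) k))\<^sup>2)) \<longlonglongrightarrow> sqrt (0\<^sup>2 + 0\<^sup>2)"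
      using l k unfolding V.converges_def W.converges_def by (intro tendsto_intros) auto
    moreover have "hnorm (hprod V W) (hsub (hprod V W) (x n) (l, k)) =
        sqrt ((hnorm V (hsub V (fst (x n)) l))\<^sup>2 + (hnorm W (hsub W (snd (x n)) k))\<^sup>2)" for n
      using norm_sq[OF P.hsub_closed[OF xC lk], of n] P.hnorm_nonneg[OF P.hsub_closed[OF xC lk], of n]
      by (simp add: real_sqrt_unique[symmetric])
    ultimately have "P.converges x (l, k)"
      unfolding P.converges_def using xC lk by (simp add: image_subset_iff)
    then show "\<exists>l. P.converges x l" ..
  qed
qed

lemma unitary_hsum:
  assumes V: "\<And>i. i \<in> I \<Longrightarrow> complex_inner_space (V i)"
    and W: "\<And>i. i \<in> I \<Longrightarrow> complex_inner_space (W i)"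
    and U: "\<And>i. i \<in> I \<Longrightarrow> unitary_op (V i) (W i) (U i)"
  shows "unitary_op (hsum I V) (hsum I W) (\<lambda>f. \<lambda>i\<in>I. U i (f i))"
proof -
  interpret V: hilbert_family I V by (rule hilbert_family.intro) (rule V)
  interpret W: hilbert_family I W by (rule hilbert_family.intro) (rule W)
  have norms: "(hnorm (W i) (U i (f i)))\<^sup>2 = (hnorm (V i) (f i))\<^sup>2" if "f \<in> hcarrier (hsum I V)" "i \<in> I" for f i
    using unitary_norm[OF U] V.carrierD(1)[OF that] that(2) by simp
  have cl: "(\<lambda>i\<in>I. U i (f i)) \<in> hcarrier (hsum I W)" if f: "f \<in> hcarrier (hsum I V)" for f
    unfolding W.hsum_carrier_iff
  proof (intro conjI ballI)
    show "(\<lambda>i. (hnorm (W i) ((\<lambda>i\<in>I. U i (f i)) i))\<^sup>2) summable_on I"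
      using V.carrierD(2)[OF f] by (rule summable_on_cong[THEN iffD1, rotated]) (simp add: norms f)
  qed (auto intro: unitary_closed[OF U] V.carrierD(1)[OF f])
  show ?thesis
  proof (rule unitary_opI[OF V.complex_inner_space_hsum W.complex_inner_space_hsum])
    show "linear_op (hsum I V) (hsum I W) (\<lambda>f. \<lambda>i\<in>I. U i (f i))"
      unfolding linear_op_def
    proof (intro conjI ballI allI)
      fix f g assume f: "f \<in> hcarrier (hsum I V)" and g: "g \<in> hcarrier (hsum I V)"
      show "(\<lambda>i\<in>I. U i (hadd (hsum I V) f g i)) = hadd (hsum I W) (\<lambda>i\<in>I. U i (f i)) (\<lambda>i\<in>I. U i (g i))"
        by (rule extensionalityI[of _ I])
          (auto simp: V.hsum_simps W.hsum_simps unitary_add[OF U] V.carrierD(1)[OF f] V.carrierD(1)[OF g])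
    next
      fix a f assume f: "f \<in> hcarrier (hsum I V)"
      show "(\<lambda>i\<in>I. U i (hscale (hsum I V) a f i)) = hscale (hsum I W) a (\<lambda>i\<in>I. U i (f i))"
        by (rule extensionalityI[of _ I])
          (auto simp: V.hsum_simps W.hsum_simps unitary_scale[OF U] V.carrierD(1)[OF f])
    qed (rule cl)
    show "hnorm (hsum I W) (\<lambda>i\<in>I. U i (f i)) = hnorm (hsum I V) f" if f: "f \<in> hcarrier (hsum I V)" for f
    proof -
      have "(hnorm (hsum I W) (\<lambda>i\<in>I. U i (f i)))\<^sup>2 = (hnorm (hsum I V) f)\<^sup>2"
        unfolding W.norm_sq_hsum[OF cl[OF f]] V.norm_sq_hsum[OF f]
        by (rule infsum_cong) (simp add: norms f)
      then show ?thesis using cl[OF f] f by (simp add: power2_eq_iff_nonneg)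
    qed
    show "\<exists>f\<in>hcarrier (hsum I V). (\<lambda>i\<in>I. U i (f i)) = g" if g: "g \<in> hcarrier (hsum I W)" for g
    proof (rule bexI)
      define f where "f = (\<lambda>i\<in>I. op_inverse (V i) (U i) (g i))"
      have fi: "f i \<in> hcarrier (V i)" "U i (f i) = g i" if "i \<in> I" for i
        using unitary_inverse_closed[OF U[OF that]] unitary_inverse_right[OF U[OF that]] W.carrierD(1)[OF g that] that
        by (simp_all add: f_def)
      show "(\<lambda>i\<in>I. U i (f i)) = g"
        by (rule extensionalityI[of _ I]) (auto simp: fi W.carrierD(3)[OF g])
      show "f \<in> hcarrier (hsum I V)"
        unfolding V.hsum_carrier_iff
      proof (intro conjI ballI)
        show "(\<lambda>i. (hnorm (V i) (f i))\<^sup>2) summable_on I"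
          using W.carrierD(2)[OF g]
          by (rule summable_on_cong[THEN iffD1, rotated]) (metis fi U unitary_norm)
      qed (auto simp: fi, simp add: f_def)
    qed
  qed
qed

lemma unitary_hprod:
  assumes "complex_inner_space V" "complex_inner_space W" "complex_inner_space V'" "complex_inner_space W'"
    and U: "unitary_op V V' U" and U': "unitary_op W W' U'"
  shows "unitary_op (hprod V W) (hprod V' W') (\<lambda>x. (U (fst x), U' (snd x)))"
proof -
  note cl = unitary_closed[OF U] unitary_closed[OF U']
  show ?thesis
    unfolding unitary_op_def linear_op_def bij_betw_def
  proof (intro conjI ballI allI)
    show "inj_on (\<lambda>x. (U (fst x), U' (snd x))) (hcarrier (hprod V W))"
      using unitary_bij[OF U] unitary_bij[OF U'] by (auto simp: bij_betw_def inj_on_def)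
    have "(\<lambda>x. (U (fst x), U' (snd x))) ` (hcarrier V \<times> hcarrier W) = (U ` hcarrier V) \<times> (U' ` hcarrier W)"
      by force
    then show "(\<lambda>x. (U (fst x), U' (snd x))) ` hcarrier (hprod V W) = hcarrier (hprod V' W')"
      by (simp add: unitary_image[OF U] unitary_image[OF U'])
  qed (auto simp: cl unitary_add[OF U] unitary_add[OF U'] unitary_scale[OF U] unitary_scale[OF U']
      unitary_inner[OF U] unitary_inner[OF U'])
qed

section \<open>Separability from a countable total set\<close>

definition countable_total :: "'v hspace \<Rightarrow> 'v set \<Rightarrow> bool" where
  "countable_total V S \<longleftrightarrow> S \<subseteq> hcarrier V \<and> countable S \<and>
    (\<forall>x\<in>hcarrier V. (\<forall>s\<in>S. hinner V x s = 0) \<longrightarrow> x = hzero V)"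

text \<open>A countable stand-in for the span of \<open>S\<close>: it is closed under midpoints, and from each of its
  points one can move by arbitrarily small steps in the four directions \<open>\<plusminus>s\<close>, \<open>\<plusminus>\<i>s\<close>.\<close>

primrec span_stage :: "'v hspace \<Rightarrow> 'v set \<Rightarrow> nat \<Rightarrow> 'v set" where
  "span_stage V S 0 = insert (hzero V)
    ((\<lambda>(u, n, s). hscale V (u / of_nat (Suc n)) s) ` ({1, -1, \<i>, -\<i>} \<times> UNIV \<times> S))"
| "span_stage V S (Suc k) = span_stage V S k \<union>
    (\<lambda>(x, y). hadd V x y) ` (span_stage V S k \<times> span_stage V S k) \<union>
    hscale V (1/2) ` span_stage V S k"

definition countable_span :: "'v hspace \<Rightarrow> 'v set \<Rightarrow> 'v set" where
  "countable_span V S = (\<Union>k. span_stage V S k)"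

lemma countable_countable_span:
  assumes "countable S"
  shows "countable (countable_span V S)"
proof -
  have "countable (span_stage V S k)" for k
    by (induction k) (use assms in auto)
  then show ?thesis by (simp add: countable_span_def)
qed

lemma span_stage_mono: "k \<le> l \<Longrightarrow> span_stage V S k \<subseteq> span_stage V S l"
  by (induction l) (auto simp: le_Suc_eq)

lemma countable_span_add:
  assumes "x \<in> countable_span V S" "y \<in> countable_span V S"
  shows "hadd V x y \<in> countable_span V S"
proof -
  obtain k l where "x \<in> span_stage V S k" "y \<in> span_stage V S l"
    using assms by (auto simp: countable_span_def)
  then have "x \<in> span_stage V S (max k l)" "y \<in> span_stage V S (max k l)"
    using span_stage_mono[of k "max k l"] span_stage_mono[of l "max k l"] by (meson max.cobounded1 max.cobounded2 subsetD)+
  then have "hadd V x y \<in> span_stage V S (Suc (max k l))" by force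
  then show ?thesis unfolding countable_span_def by blast
qed

lemma countable_span_half: "x \<in> countable_span V S \<Longrightarrow> hscale V (1/2) x \<in> countable_span V S"
proof -
  assume "x \<in> countable_span V S"
  then obtain k where "x \<in> span_stage V S k" by (auto simp: countable_span_def)
  then have "hscale V (1/2) x \<in> span_stage V S (Suc k)" by simp
  then show ?thesis unfolding countable_span_def by blast
qed

lemma countable_span_step:
  "\<lbrakk>s \<in> S; u \<in> {1, -1, \<i>, -\<i>}\<rbrakk> \<Longrightarrow> hscale V (u / of_nat (Suc n)) s \<in> countable_span V S"
  unfolding countable_span_def by (rule UN_I[of 0]) (auto intro!: image_eqI[of _ _ "(u, n, s)"])

lemma (in complex_inner_space) countable_span_subset:
  assumes "S \<subseteq> hcarrier V"
  shows "countable_span V S \<subseteq> hcarrier V"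
proof -
  have "span_stage V S k \<subseteq> hcarrier V" for k
    by (induction k) (use assms in auto)
  then show ?thesis by (auto simp: countable_span_def)
qed

text \<open>The parallelogram law for \<open>x - y\<close> and \<open>x - z\<close>, written with the midpoint of \<open>y\<close> and \<open>z\<close>.\<close>

lemma (in complex_inner_space) parallelogram_midpoint:
  assumes x: "x \<in> hcarrier V" and y: "y \<in> hcarrier V" and z: "z \<in> hcarrier V"
  shows "(hnorm V (hsub V y z))\<^sup>2 = 2 * (hnorm V (hsub V x y))\<^sup>2 + 2 * (hnorm V (hsub V x z))\<^sup>2
    - 4 * (hnorm V (hsub V x (hscale V (1/2) (hadd V y z))))\<^sup>2"
proof -
  have "Re (hinner V y x) = Re (hinner V x y)" "Re (hinner V z x) = Re (hinner V x z)"
    "Re (hinner V z y) = Re (hinner V y z)"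
    using inner_commute[OF x y] inner_commute[OF x z] inner_commute[OF y z] by simp_all
  then show ?thesis using x y z by (simp add: hnorm_sq inner_simps field_simps)
qed

text \<open>Approximate a vector from the countable set as well as possible.  By the parallelogram law
  a minimizing sequence is Cauchy; since no small step in a direction of \<open>S\<close> brings its limit
  closer, the error is orthogonal to \<open>S\<close>, hence zero.\<close>

lemma (in hilbert_space) total_imp_dense:
  assumes S: "countable_total V S" and x: "x \<in> hcarrier V"
  shows "x \<in> htopology V closure_of (countable_span V S)"
proof -
  define D where "D = countable_span V S"
  have SC: "S \<subseteq> hcarrier V" using S by (simp add: countable_total_def)
  have DC: "D \<subseteq> hcarrier V" unfolding D_def by (rule countable_span_subset[OF SC])
  have "hzero V \<in> D" unfolding D_def countable_span_def by (rule UN_I[of 0]) auto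
  define d where "d = (INF y\<in>D. hnorm V (hsub V x y))"
  have bdd: "bdd_below ((\<lambda>y. hnorm V (hsub V x y)) ` D)"
    by (rule bdd_belowI[of _ 0]) (use DC x in auto)
  have d_le: "d \<le> hnorm V (hsub V x y)" if "y \<in> D" for y
    unfolding d_def by (rule cINF_lower[OF bdd that])
  have d0: "0 \<le> d" unfolding d_def by (rule cINF_greatest) (use \<open>hzero V \<in> D\<close> DC x in auto)
  have "\<exists>y\<in>D. hnorm V (hsub V x y) < d + 1 / Suc n" for n
    using cINF_less_iff[OF _ bdd, of "d + 1 / Suc n"] \<open>hzero V \<in> D\<close> unfolding d_def by auto
  then obtain y where yD: "\<And>n. y n \<in> D" and y: "\<And>n. hnorm V (hsub V x (y n)) < d + 1 / Suc n"
    by metis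
  have yC: "y n \<in> hcarrier V" for n using yD DC by blast
  have close: "(hnorm V (hsub V (y n) (y k)))\<^sup>2 \<le> (8 * d + 4) / Suc N" if "n \<ge> N" "k \<ge> N" for n k N
  proof -
    have le: "(hnorm V (hsub V x (y n)))\<^sup>2 \<le> (d + 1 / Suc N)\<^sup>2" if "n \<ge> N" for n
    proof (rule power_mono)
      have "1 / real (Suc n) \<le> 1 / real (Suc N)" using that by (simp add: frac_le)
      then show "hnorm V (hsub V x (y n)) \<le> d + 1 / Suc N" using y[of n] by linarith
    qed (use x yC in simp)
    have "hscale V (1/2) (hadd V (y n) (y k)) \<in> D"
      using yD unfolding D_def by (intro countable_span_half countable_span_add) auto
    then have "d\<^sup>2 \<le> (hnorm V (hsub V x (hscale V (1/2) (hadd V (y n) (y k)))))\<^sup>2"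
      by (intro power_mono d_le d0)
    then have "(hnorm V (hsub V (y n) (y k)))\<^sup>2 \<le> 4 * (d + 1 / Suc N)\<^sup>2 - 4 * d\<^sup>2"
      using parallelogram_midpoint[OF x yC[of n] yC[of k]] le[OF that(1)] le[OF that(2)] by linarith
    also have "\<dots> = 8 * d / Suc N + 4 * (1 / Suc N)\<^sup>2"
      by (simp add: power2_eq_square algebra_simps add_divide_distrib)
    also have "\<dots> \<le> 8 * d / Suc N + 4 * (1 / Suc N)"
      using power_decreasing[of 1 2 "1 / real (Suc N)"] by simp
    finally show ?thesis by (simp add: add_divide_distrib)
  qed
  have "cauchy y"
    unfolding cauchy_def
  proof (intro conjI allI impI)
    fix e :: real assume e: "e > 0"
    obtain N where N: "(8 * d + 4) / e\<^sup>2 < real N" using reals_Archimedean2 by blast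
    then have "(8 * d + 4) < e\<^sup>2 * real (Suc N)"
      using e by (simp add: field_simps) (smt (verit) zero_less_power)
    then have N': "(8 * d + 4) / Suc N < e\<^sup>2" by (simp add: field_simps)
    have "hnorm V (hsub V (y n) (y k)) < e" if "n \<ge> N" "k \<ge> N" for n k
      using close[OF that] N' e by (intro power2_less_imp_less[of _ e]) auto
    then show "\<exists>N. \<forall>n\<ge>N. \<forall>k\<ge>N. hnorm V (hsub V (y n) (y k)) < e" by blast
  qed (use yC in auto)
  then obtain p where p: "converges y p" using cauchy_converges by blast
  then have pC: "p \<in> hcarrier V" by (simp add: converges_def)
  have "hnorm V (hsub V x p) \<le> d"
  proof (rule LIMSEQ_le[OF norm_converges[OF p x]])
    show "(\<lambda>n. d + 1 / Suc n) \<longlonglongrightarrow> d"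
      using tendsto_add[OF tendsto_const LIMSEQ_inverse_real_of_nat, of d] by (simp add: inverse_eq_divide)
    show "\<exists>N. \<forall>n\<ge>N. hnorm V (hsub V x (y n)) \<le> d + 1 / Suc n" using y by (auto intro: less_imp_le)
  qed
  define z where "z = hsub V x p"
  have zC: "z \<in> hcarrier V" using x pC by (simp add: z_def)
  have orth: "hinner V z s = 0" if s: "s \<in> S" for s
  proof -
    have sC: "s \<in> hcarrier V" using s SC by blast
    have "Re (cnj u * hinner V z s) \<le> 0" if u: "u \<in> {1, -1, \<i>, -\<i>}" for u
    proof (rule LIMSEQ_le_const)
      show "(\<lambda>n. ((hnorm V s)\<^sup>2 / 2) * (1 / Suc n)) \<longlonglongrightarrow> 0"
        using tendsto_mult_right_zero[OF LIMSEQ_inverse_real_of_nat, of "(hnorm V s)\<^sup>2 / 2"]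
        unfolding inverse_eq_divide .
      have "Re (cnj u * hinner V z s) \<le> ((hnorm V s)\<^sup>2 / 2) * (1 / Suc n)" for n
      proof -
        define t where "t = u / of_nat (Suc n)"
        have ts: "hscale V t s \<in> hcarrier V" using sC by simp
        have "d \<le> hnorm V (hsub V (hsub V x (hscale V t s)) p)"
        proof (rule LIMSEQ_le_const[OF norm_converges[OF p]])
          have "d \<le> hnorm V (hsub V (hsub V x (hscale V t s)) (y k))" for k
          proof -
            have "hadd V (y k) (hscale V t s) \<in> D"
              using yD[of k] countable_span_step[OF s u] unfolding D_def t_def by (intro countable_span_add)
            then have "d \<le> hnorm V (hsub V x (hadd V (y k) (hscale V t s)))" by (rule d_le)
            also have "hsub V x (hadd V (y k) (hscale V t s)) = hsub V (hsub V x (hscale V t s)) (y k)"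
              by (rule vec_eqI) (use x yC ts in \<open>auto simp: inner_simps\<close>)
            finally show ?thesis .
          qed
          then show "\<exists>N. \<forall>k\<ge>N. d \<le> hnorm V (hsub V (hsub V x (hscale V t s)) (y k))" by blast
        qed (use x ts in simp)
        also have "hsub V (hsub V x (hscale V t s)) p = hsub V z (hscale V t s)"
          unfolding z_def by (rule vec_eqI) (use x pC ts in \<open>auto simp: inner_simps\<close>)
        finally have "d\<^sup>2 \<le> (hnorm V (hsub V z (hscale V t s)))\<^sup>2"
          using d0 by (intro power_mono)
        moreover have "(hnorm V z)\<^sup>2 \<le> d\<^sup>2"
          using \<open>hnorm V (hsub V x p) \<le> d\<close> zC by (intro power_mono) (auto simp: z_def)
        ultimately have "2 * Re (cnj t * hinner V z s) \<le> (cmod t)\<^sup>2 * (hnorm V s)\<^sup>2"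
          using sC zC by (simp add: norm_sub_sq hnorm_scale inner_simps power_mult_distrib)
        moreover have "cmod u = 1" using u by auto
        then have "(cmod t)\<^sup>2 = (1 / Suc n) * (1 / Suc n)"
          by (simp add: t_def norm_divide power2_eq_square del: of_nat_Suc)
        moreover have "Re (cnj t * hinner V z s) = (1 / Suc n) * Re (cnj u * hinner V z s)"
        proof -
          have "cnj t * hinner V z s = complex_of_real (1 / Suc n) * (cnj u * hinner V z s)"
            by (simp add: t_def del: of_nat_Suc)
          then show ?thesis by (simp only: times_complex.sel Re_complex_of_real Im_complex_of_real)
        qed
        ultimately have "(1 / Suc n) * (2 * Re (cnj u * hinner V z s)) \<le> (1 / Suc n) * ((1 / Suc n) * (hnorm V s)\<^sup>2)"
          by (simp only: mult_ac)
        then have le: "2 * Re (cnj u * hinner V z s) \<le> (1 / Suc n) * (hnorm V s)\<^sup>2"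
          by (rule mult_left_le_imp_le) simp
        have half: "r \<le> q / 2" if "2 * r \<le> q" for r q :: real
          using that by simp
        have "((hnorm V s)\<^sup>2 / 2) * (1 / Suc n) = ((1 / Suc n) * (hnorm V s)\<^sup>2) / 2" by simp
        then show ?thesis using half[OF le] by (simp only:)
      qed
      then show "\<exists>N. \<forall>n\<ge>N. Re (cnj u * hinner V z s) \<le> ((hnorm V s)\<^sup>2 / 2) * (1 / Suc n)" by blast
    qed
    from this[of 1] this[of "-1"] this[of \<i>] this[of "-\<i>"]
    show ?thesis by (simp add: complex_eq_iff)
  qed
  then have "z = hzero V" using S zC by (simp add: countable_total_def)
  then have "x = p" using sub_eq_zero[OF x pC] by (simp add: z_def)
  then show ?thesis
    using converges_in_closure[OF _ DC p] yD unfolding D_def by blast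
qed

lemma (in hilbert_space) separable_if_total:
  assumes S: "countable_total V S"
  shows "separable_space (htopology V)"
  unfolding separable_space_def
proof (intro exI conjI)
  have "S \<subseteq> hcarrier V" "countable S" using S by (auto simp: countable_total_def)
  then show "countable (countable_span V S)" "countable_span V S \<subseteq> topspace (htopology V)"
    by (simp_all add: countable_countable_span countable_span_subset)
  show "htopology V closure_of countable_span V S = topspace (htopology V)"
    using total_imp_dense[OF S] closure_of_subset_topspace[of "htopology V"] by auto
qed

text \<open>Total sets for the summands, placed in one coordinate each, form a total set of the direct sum.\<close>

lemma countable_total_hsum:
  assumes I: "countable I" and V: "\<And>i. i \<in> I \<Longrightarrow> complex_inner_space (V i)"
    and S: "\<And>i. i \<in> I \<Longrightarrow> countable_total (V i) (S i)"
  shows "\<exists>S. countable_total (hsum I V) S"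
proof -
  interpret hilbert_family I V by (rule hilbert_family.intro) (rule V)
  define single where "single i s = (\<lambda>j\<in>I. if j = i then s else hzero (V j))" for i s
  have single: "single i s \<in> hcarrier (hsum I V)" if i: "i \<in> I" and s: "s \<in> hcarrier (V i)" for i s
    unfolding hsum_carrier_iff
  proof (intro conjI ballI)
    have "(\<lambda>j. (hnorm (V j) (single i s j))\<^sup>2) summable_on {i}" by simp
    then show "(\<lambda>j. (hnorm (V j) (single i s j))\<^sup>2) summable_on I"
      by (rule summable_on_cong_neutral[THEN iffD1, rotated -1])
        (use i in \<open>auto simp: single_def complex_inner_space.hnorm_zero[OF V]\<close>)
    show "single i s j \<in> hcarrier (V j)" if "j \<in> I" for j
      using that s complex_inner_space.zero_closed[OF V] by (auto simp: single_def)
  qed (simp add: single_def)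
  have inner_single: "hinner (hsum I V) x (single i s) = hinner (V i) (x i) s"
    if x: "x \<in> hcarrier (hsum I V)" and i: "i \<in> I" for x i s
  proof -
    have "hinner (hsum I V) x (single i s) = (\<Sum>\<^sub>\<infinity>j\<in>{i}. hinner (V j) (x j) (single i s j))"
      unfolding hsum_simps(4)
      by (rule infsum_cong_neutral)
        (use i in \<open>auto simp: single_def complex_inner_space.inner_zero_right[OF V] carrierD(1)[OF x]\<close>)
    then show ?thesis using i by (simp add: single_def)
  qed
  have "countable_total (hsum I V) (\<Union>i\<in>I. single i ` S i)"
    unfolding countable_total_def
  proof (intro conjI ballI impI)
    show "(\<Union>i\<in>I. single i ` S i) \<subseteq> hcarrier (hsum I V)"
      using S by (auto simp: countable_total_def intro!: single)
    show "countable (\<Union>i\<in>I. single i ` S i)"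
      using I S by (auto simp: countable_total_def)
    fix x assume x: "x \<in> hcarrier (hsum I V)"
      and orth: "\<forall>s\<in>\<Union>i\<in>I. single i ` S i. hinner (hsum I V) x s = 0"
    show "x = hzero (hsum I V)"
    proof (rule extensionalityI[of _ I])
      fix i assume i: "i \<in> I"
      have "\<forall>s\<in>S i. hinner (V i) (x i) s = 0" using orth i inner_single[OF x i] by auto
      then show "x i = hzero (hsum I V) i"
        using S[OF i] carrierD(1)[OF x i] i by (simp add: countable_total_def hsum_simps)
    qed (auto simp: hsum_simps carrierD(3)[OF x])
  qed
  then show ?thesis by blast
qed

lemma countable_total_hprod:
  assumes V: "complex_inner_space V" and W: "complex_inner_space W"
    and S: "countable_total V S" and R: "countable_total W R"
  shows "countable_total (hprod V W) ((\<lambda>s. (s, hzero W)) ` S \<union> (\<lambda>r. (hzero V, r)) ` R)"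
  unfolding countable_total_def
proof (intro conjI ballI impI)
  interpret V: complex_inner_space V by fact
  interpret W: complex_inner_space W by fact
  show "(\<lambda>s. (s, hzero W)) ` S \<union> (\<lambda>r. (hzero V, r)) ` R \<subseteq> hcarrier (hprod V W)"
    using S R by (auto simp: countable_total_def)
  show "countable ((\<lambda>s. (s, hzero W)) ` S \<union> (\<lambda>r. (hzero V, r)) ` R)"
    using S R by (auto simp: countable_total_def)
  fix x assume x: "x \<in> hcarrier (hprod V W)"
    and orth: "\<forall>s\<in>(\<lambda>s. (s, hzero W)) ` S \<union> (\<lambda>r. (hzero V, r)) ` R. hinner (hprod V W) x s = 0"
  have x': "fst x \<in> hcarrier V" "snd x \<in> hcarrier W" using x by auto
  have "\<forall>s\<in>S. hinner V (fst x) s = 0" "\<forall>r\<in>R. hinner W (snd x) r = 0"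
    using orth x' by (auto simp: ball_Un)
  then show "x = hzero (hprod V W)"
    using S R x' by (cases x) (auto simp: countable_total_def)
qed

section \<open>The ladder construction in abstract Hilbert spaces\<close>

lemma (in complex_inner_space) norm_zero_sub:
  "x \<in> hcarrier V \<Longrightarrow> hnorm V (hsub V (hzero V) x) = hnorm V x"
  by (simp add: hnorm_def inner_sub_left inner_sub_right)

lemma op_inverse_op_inverse:
  assumes U: "unitary_op V V U" and V: "complex_inner_space V" and x: "x \<in> hcarrier V"
  shows "op_inverse V (op_inverse V U) x = U x"
  by (rule unitary_inverse_eqI[OF unitary_inverse[OF U V V]])
    (use x unitary_closed[OF U] unitary_inverse_left[OF U] in auto)

lemma infsum_nat_head:
  fixes a :: "nat \<Rightarrow> real"
  assumes "a summable_on UNIV"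
  shows "(\<lambda>n. a (Suc n)) summable_on UNIV" and "infsum a UNIV = a 0 + (\<Sum>\<^sub>\<infinity>n. a (Suc n))"
proof -
  have *: "UNIV = insert 0 (range Suc)" using nat.exhaust by (auto simp: image_iff)
  have "a summable_on range Suc" using assms by (rule summable_on_subset) simp
  then show "(\<lambda>n. a (Suc n)) summable_on UNIV"
    by (subst (asm) summable_on_reindex) (auto simp: o_def)
  have "infsum a UNIV = infsum a (insert 0 (range Suc))"
    by (rule arg_cong[OF *])
  also have "\<dots> = a 0 + infsum a (range Suc)"
    by (rule infsum_insert) (use \<open>a summable_on range Suc\<close> in auto)
  also have "infsum a (range Suc) = (\<Sum>\<^sub>\<infinity>n. a (Suc n))"
    by (subst infsum_reindex) (auto simp: o_def)
  finally show "infsum a UNIV = a 0 + (\<Sum>\<^sub>\<infinity>n. a (Suc n))" .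
qed

text \<open>The skeleton of the construction.  A unitary \<open>A\<close> folds the first rung \<open>W 0\<close> into the core
  \<open>V0\<close>, and unitaries \<open>D n\<close> identify each rung with the next; the operator below moves every rung
  one step towards the core.\<close>

locale ladder =
  fixes V0 :: "'v hspace" and W :: "nat \<Rightarrow> 'w hspace"
    and A :: "'v \<times> 'w \<Rightarrow> 'v" and D :: "nat \<Rightarrow> 'w \<Rightarrow> 'w"
    and \<alpha> :: "'g::ab_group_add \<Rightarrow> 'g"
    and \<rho>0 :: "'g \<Rightarrow> 'v \<Rightarrow> 'v" and \<rho> :: "nat \<Rightarrow> 'g \<Rightarrow> 'w \<Rightarrow> 'w"
  assumes V0: "hilbert_space V0" and W: "hilbert_space (W n)"
    and total0: "\<exists>S. countable_total V0 S" and total: "\<exists>S. countable_total (W n) S"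
    and A: "unitary_op (hprod V0 (W 0)) V0 A"
    and D: "unitary_op (W n) (W (Suc n)) (D n)"
    and pure: "(\<Inter>n. ((\<lambda>v. A (v, hzero (W 0))) ^^ n) ` hcarrier V0) = {hzero V0}"
    and \<rho>0: "unitary_rep V0 \<rho>0" and \<rho>: "unitary_rep (W n) (\<rho> n)"
    and A_rep: "\<lbrakk>v \<in> hcarrier V0; w \<in> hcarrier (W 0)\<rbrakk>
      \<Longrightarrow> A (\<rho>0 \<gamma> v, \<rho> 0 \<gamma> w) = \<rho>0 (\<alpha> \<gamma>) (A (v, w))"
    and D_rep: "w \<in> hcarrier (W n) \<Longrightarrow> D n (\<rho> n (\<alpha> \<gamma>) w) = \<rho> (Suc n) \<gamma> (D n w)"
begin

definition E :: "('v \<times> (nat \<Rightarrow> 'w)) hspace" where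
  "E = hprod V0 (hsum UNIV W)"

definition T :: "'v \<times> (nat \<Rightarrow> 'w) \<Rightarrow> 'v \<times> (nat \<Rightarrow> 'w)" where
  "T f = (A (fst f, snd f 0), \<lambda>n. op_inverse (W n) (D n) (snd f (Suc n)))"

definition \<delta> :: "'v \<times> (nat \<Rightarrow> 'w) \<Rightarrow> 'v \<times> (nat \<Rightarrow> 'w)" where
  "\<delta> = op_inverse E T"

definition core :: "('v \<times> (nat \<Rightarrow> 'w)) set" where
  "core = {f \<in> hcarrier E. \<forall>n. snd f n = hzero (W n)}"

definition subspace :: "int \<Rightarrow> ('v \<times> (nat \<Rightarrow> 'w)) set" where
  "subspace j = op_powi E T (- j) ` core"

definition rep :: "'g \<Rightarrow> 'v \<times> (nat \<Rightarrow> 'w) \<Rightarrow> 'v \<times> (nat \<Rightarrow> 'w)" where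
  "rep \<gamma> f = (\<rho>0 \<gamma> (fst f), \<lambda>n. \<rho> n \<gamma> (snd f n))"

sublocale V0: hilbert_space V0 by (rule V0)

sublocale Wn: hilbert_space "W n" for n by (rule W)

sublocale sum: hilbert_family UNIV W
  by (rule hilbert_family.intro) (rule Wn.complex_inner_space_axioms)

sublocale E: hilbert_space E
  unfolding E_def
  by (intro hilbert_space_hprod V0 sum.hilbert_space_hsum W)

lemma inner_spaces:
  "complex_inner_space V0" "complex_inner_space (W n)" "complex_inner_space (hsum UNIV W)"
  "complex_inner_space E" "complex_inner_space (hprod V0 (W 0))"
  by (rule V0.complex_inner_space_axioms Wn.complex_inner_space_axioms sum.complex_inner_space_hsum
      E.complex_inner_space_axioms
      complex_inner_space_hprod[OF V0.complex_inner_space_axioms Wn.complex_inner_space_axioms])+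

lemma E_carrier: "f \<in> hcarrier E \<longleftrightarrow> fst f \<in> hcarrier V0 \<and> (\<forall>n. snd f n \<in> hcarrier (W n)) \<and>
    (\<lambda>n. (hnorm (W n) (snd f n))\<^sup>2) summable_on UNIV"
  by (auto simp: E_def mem_Times_iff sum.hsum_carrier_iff)

lemma E_norm_sq: "f \<in> hcarrier E \<Longrightarrow>
    (hnorm E f)\<^sup>2 = (hnorm V0 (fst f))\<^sup>2 + (\<Sum>\<^sub>\<infinity>n. (hnorm (W n) (snd f n))\<^sup>2)"
  unfolding E_def by (simp add: norm_sq_hprod inner_spaces mem_Times_iff sum.norm_sq_hsum)

lemma E_simps:
  "hzero E = (hzero V0, \<lambda>n. hzero (W n))"
  "hadd E f g = (hadd V0 (fst f) (fst g), \<lambda>n. hadd (W n) (snd f n) (snd g n))"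
  "hscale E a f = (hscale V0 a (fst f), \<lambda>n. hscale (W n) a (snd f n))"
  by (simp_all add: E_def hsum_def restrict_def)

lemma A_norm_sq:
  assumes "v \<in> hcarrier V0" "w \<in> hcarrier (W 0)"
  shows "(hnorm V0 (A (v, w)))\<^sup>2 = (hnorm V0 v)\<^sup>2 + (hnorm (W 0) w)\<^sup>2"
  using assms unitary_norm[OF A, of "(v, w)"] norm_sq_hprod[OF inner_spaces(1,2), of "(v, w)" 0] by simp

lemma A_closed: "\<lbrakk>v \<in> hcarrier V0; w \<in> hcarrier (W 0)\<rbrakk> \<Longrightarrow> A (v, w) \<in> hcarrier V0"
  using unitary_closed[OF A, of "(v, w)"] by simp

lemma Dinv: "unitary_op (W (Suc n)) (W n) (op_inverse (W n) (D n))"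
  by (rule unitary_inverse[OF D inner_spaces(2) inner_spaces(2)])

lemma T_closed:
  assumes f: "f \<in> hcarrier E"
  shows "T f \<in> hcarrier E"
proof -
  have f': "fst f \<in> hcarrier V0" "snd f n \<in> hcarrier (W n)"
    "(\<lambda>n. (hnorm (W n) (snd f n))\<^sup>2) summable_on UNIV" for n
    using f by (auto simp: E_carrier)
  show ?thesis
    unfolding E_carrier T_def
    using f'(1,2) infsum_nat_head(1)[OF f'(3)]
    by (simp add: A_closed unitary_closed[OF Dinv] unitary_norm[OF Dinv])
qed

text \<open>Norms are preserved because \<open>A\<close> merges the first two summands isometrically and the other
  summands are only shifted; a preimage is found by unfolding the core and raising the rungs.\<close>

lemma T_unitary: "unitary_op E E T"
proof (rule unitary_opI[OF inner_spaces(4) inner_spaces(4)])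
  show "linear_op E E T"
    unfolding linear_op_def
  proof (intro conjI ballI allI)
    fix f g assume f: "f \<in> hcarrier E" and g: "g \<in> hcarrier E"
    show "T (hadd E f g) = hadd E (T f) (T g)"
      using f g unitary_add[OF A, of "(fst f, snd f 0)" "(fst g, snd g 0)"]
      by (simp add: T_def E_simps E_carrier unitary_add[OF Dinv])
  next
    fix a f assume f: "f \<in> hcarrier E"
    show "T (hscale E a f) = hscale E a (T f)"
      using f unitary_scale[OF A, of "(fst f, snd f 0)" a]
      by (simp add: T_def E_simps E_carrier unitary_scale[OF Dinv])
  qed (rule T_closed)
  show "hnorm E (T f) = hnorm E f" if f: "f \<in> hcarrier E" for f
  proof -
    have f': "fst f \<in> hcarrier V0" "snd f n \<in> hcarrier (W n)"
      "(\<lambda>n. (hnorm (W n) (snd f n))\<^sup>2) summable_on UNIV" for n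
      using f by (auto simp: E_carrier)
    have "(hnorm E (T f))\<^sup>2 = (hnorm E f)\<^sup>2"
      unfolding E_norm_sq[OF f] E_norm_sq[OF T_closed[OF f]] infsum_nat_head(2)[OF f'(3)]
      using f'(1,2) by (simp add: T_def A_norm_sq unitary_norm[OF Dinv])
    then show ?thesis using f T_closed[OF f] by (simp add: power2_eq_iff_nonneg)
  qed
  show "\<exists>f\<in>hcarrier E. T f = g" if g: "g \<in> hcarrier E" for g
  proof -
    have g': "fst g \<in> hcarrier V0" "snd g n \<in> hcarrier (W n)"
      "(\<lambda>n. (hnorm (W n) (snd g n))\<^sup>2) summable_on UNIV" for n
      using g by (auto simp: E_carrier)
    obtain v w where vw: "v \<in> hcarrier V0" "w \<in> hcarrier (W 0)" "A (v, w) = fst g"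
    proof -
      have "fst g \<in> A ` hcarrier (hprod V0 (W 0))" using unitary_image[OF A] g'(1) by simp
      then show ?thesis using that by auto
    qed
    define f where "f = (v, case_nat w (\<lambda>n. D n (snd g n)))"
    have fn: "snd f n \<in> hcarrier (W n)" for n
      using vw g' unitary_closed[OF D] by (auto simp: f_def split: nat.split)
    have "(\<lambda>n. (hnorm (W n) (snd f n))\<^sup>2) summable_on range Suc"
      by (subst summable_on_reindex) (use g'(2,3) in \<open>auto simp: f_def o_def unitary_norm[OF D]\<close>)
    then have "(\<lambda>n. (hnorm (W n) (snd f n))\<^sup>2) summable_on insert 0 (range Suc)"
      by (simp add: summable_on_insert_iff)
    moreover have "insert 0 (range Suc) = UNIV" using nat.exhaust by (auto simp: image_iff)
    ultimately have "f \<in> hcarrier E"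
      unfolding E_carrier using vw fn by (simp add: f_def)
    moreover have "T f = g"
      using vw g' by (cases g) (auto simp: T_def f_def unitary_inverse_left[OF D])
    ultimately show ?thesis by blast
  qed
qed

lemma \<delta>_unitary: "unitary_op E E \<delta>"
  unfolding \<delta>_def by (rule unitary_inverse[OF T_unitary inner_spaces(4) inner_spaces(4)])

lemma T_\<delta>: "f \<in> hcarrier E \<Longrightarrow> T (\<delta> f) = f"
  by (simp add: \<delta>_def unitary_inverse_right[OF T_unitary])

lemma \<delta>_T: "f \<in> hcarrier E \<Longrightarrow> \<delta> (T f) = f"
  by (simp add: \<delta>_def unitary_inverse_left[OF T_unitary])

lemma rep_unitary: "unitary_rep E rep"
proof -
  have "unitary_op E E (rep \<gamma>)" for \<gamma>
  proof -
    have U0: "unitary_op V0 V0 (\<rho>0 \<gamma>)" and U: "unitary_op (W n) (W n) (\<rho> n \<gamma>)" for n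
      using \<rho>0 \<rho>[of n] by (auto simp: unitary_rep_def)
    have "unitary_op (hsum UNIV W) (hsum UNIV W) (\<lambda>f. \<lambda>n\<in>UNIV. \<rho> n \<gamma> (f n))"
      by (rule unitary_hsum) (rule inner_spaces U)+
    then show ?thesis
      using unitary_hprod[OF inner_spaces(1,3,1,3) U0] by (simp add: E_def rep_def[abs_def] restrict_def)
  qed
  then show ?thesis
    using \<rho>0 \<rho> by (auto simp: unitary_rep_def rep_def E_carrier)
qed

lemma T_rep:
  assumes f: "f \<in> hcarrier E"
  shows "T (rep \<gamma> f) = rep (\<alpha> \<gamma>) (T f)"
proof -
  have f': "fst f \<in> hcarrier V0" "snd f n \<in> hcarrier (W n)" for n
    using f by (auto simp: E_carrier)
  have "op_inverse (W n) (D n) (\<rho> (Suc n) \<gamma> w) = \<rho> n (\<alpha> \<gamma>) (op_inverse (W n) (D n) w)"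
    if w: "w \<in> hcarrier (W (Suc n))" for n w
  proof (rule unitary_inverse_eqI[OF D])
    have c: "op_inverse (W n) (D n) w \<in> hcarrier (W n)" by (rule unitary_inverse_closed[OF D w])
    then show "\<rho> n (\<alpha> \<gamma>) (op_inverse (W n) (D n) w) \<in> hcarrier (W n)"
      using \<rho>[of n] by (auto simp: unitary_rep_def intro: unitary_closed)
    show "D n (\<rho> n (\<alpha> \<gamma>) (op_inverse (W n) (D n) w)) = \<rho> (Suc n) \<gamma> w"
      using D_rep[OF c] unitary_inverse_right[OF D w] by simp
  qed
  then show ?thesis using f' A_rep[of "fst f" "snd f 0" \<gamma>] by (simp add: T_def rep_def)
qed

lemma T_core: "f \<in> core \<Longrightarrow> T f = (A (fst f, hzero (W 0)), \<lambda>n. hzero (W n)) \<and> T f \<in> core"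
proof -
  assume f: "f \<in> core"
  then have "T f = (A (fst f, hzero (W 0)), \<lambda>n. hzero (W n))"
    by (simp add: core_def T_def unitary_zero[OF Dinv] inner_spaces)
  then show ?thesis using f T_closed[of f] by (simp add: core_def)
qed

lemma core_subset: "core \<subseteq> hcarrier E"
  by (auto simp: core_def)

lemma zero_in_core: "hzero E \<in> core"
  using E.zero_closed by (simp add: core_def E_simps)

text \<open>A limit of core vectors is a core vector, as each rung component depends continuously on the
  vector.\<close>

lemma core_closed: "closed_subspace E core"
  unfolding closed_subspace_def E.closedin_iff
proof (intro conjI ballI allI impI)
  show "hadd E f g \<in> core" if "f \<in> core" "g \<in> core" for f g
    using that E.add_closed[of f g] by (simp add: core_def E_simps Wn.add_zero)
  show "hscale E a f \<in> core" if "f \<in> core" for a f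
  proof -
    have "hscale (W n) a (hzero (W n)) = hzero (W n)" for n
      by (rule Wn.vec_eqI) (auto simp: Wn.inner_simps)
    then show ?thesis using that E.scale_closed[of f a] by (simp add: core_def E_simps)
  qed
  fix x l assume x: "range x \<subseteq> core" and conv: "E.converges x l"
  have xC: "x n \<in> core" for n using x by blast
  have lC: "l \<in> hcarrier E" using conv by (simp add: E.converges_def)
  then have lC': "snd l k \<in> hcarrier (W k)" "fst l \<in> hcarrier V0"
    "(\<lambda>n. (hnorm (W n) (snd l n))\<^sup>2) summable_on UNIV" for k
    by (auto simp: E_carrier)
  have "snd l k = hzero (W k)" for k
  proof -
    have "hnorm (W k) (snd l k) \<le> hnorm E (hsub E (x n) l)" for n
    proof -
      have d: "hsub E (x n) l \<in> hcarrier E" using xC core_subset lC by blast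
      have z: "snd (x n) k = hzero (W k)" for k using xC[of n] by (simp add: core_def)
      have "hnorm (W k) (snd (hsub E (x n) l) k) = hnorm (W k) (snd l k)"
        using lC' by (simp add: E_def sum.hsum_sub z Wn.norm_zero_sub)
      moreover have "(hnorm (W k) (snd (hsub E (x n) l) k))\<^sup>2 \<le> (hnorm E (hsub E (x n) l))\<^sup>2"
      proof -
        have "snd (hsub E (x n) l) \<in> hcarrier (hsum UNIV W)"
          using d unfolding E_def by (simp only: hprod_simps mem_Times_iff)
        then have "(hnorm (W k) (snd (hsub E (x n) l) k))\<^sup>2 \<le> (\<Sum>\<^sub>\<infinity>n'. (hnorm (W n') (snd (hsub E (x n) l) n'))\<^sup>2)"
          using sum.finite_sum_le_norm_sq[of "snd (hsub E (x n) l)" "{k}"] by (simp add: sum.norm_sq_hsum)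
        then show ?thesis unfolding E_norm_sq[OF d] by (simp add: add_increasing)
      qed
      ultimately show ?thesis using d lC' by (metis E.hnorm_nonneg power2_le_imp_le)
    qed
    then have "hnorm (W k) (snd l k) \<le> 0"
      using conv unfolding E.converges_def by (meson LIMSEQ_le_const)
    then show ?thesis
      using Wn.hnorm_eq_0[of "snd l k" k] Wn.hnorm_nonneg[of "snd l k" k] lC'(1) by (simp add: order_antisym)
  qed
  then show "l \<in> core" using lC by (simp add: core_def)
qed (use core_subset zero_in_core in auto)

lemma subspace_nonneg: "subspace (int n) = (\<delta> ^^ n) ` core"
  by (cases "n = 0") (auto simp: subspace_def op_powi_def \<delta>_def)

lemma subspace_neg: "subspace (- int n) = (T ^^ n) ` core"
  by (auto simp: subspace_def op_powi_def)

lemma pow_core_subset: "(T ^^ n) ` core \<subseteq> hcarrier E" "(\<delta> ^^ n) ` core \<subseteq> hcarrier E"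
proof -
  show "(T ^^ n) ` core \<subseteq> hcarrier E"
    by (induction n) (use core_subset T_closed in \<open>auto simp: image_subset_iff\<close>)
  show "(\<delta> ^^ n) ` core \<subseteq> hcarrier E"
    by (induction n) (use core_subset unitary_closed[OF \<delta>_unitary] in \<open>auto simp: image_subset_iff\<close>)
qed

lemma int_cases_nonneg_neg:
  obtains n where "j = int n" | n where "j = - int (Suc n)"
  by (cases j) auto

lemma subspace_subset: "subspace j \<subseteq> hcarrier E"
  by (cases j rule: int_cases_nonneg_neg) (use pow_core_subset subspace_nonneg subspace_neg in metis)+

lemma subspace_step: "subspace (j + 1) = \<delta> ` subspace j"
proof (cases j rule: int_cases_nonneg_neg)
  case (1 n)
  have "subspace (j + 1) = subspace (int (Suc n))" using 1 by (simp add: add.commute)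
  then show ?thesis unfolding subspace_nonneg 1 by (simp add: image_comp)
next
  case (2 n)
  have "subspace (j + 1) = (T ^^ n) ` core" using 2 subspace_neg[of n] by simp
  moreover have "\<delta> ` subspace j = (T ^^ n) ` core"
    unfolding 2 subspace_neg using pow_core_subset(1)[of n]
    by (auto simp: image_comp image_subset_iff \<delta>_T intro!: image_cong)
  ultimately show ?thesis by simp
qed

text \<open>Both halves of the chain start from \<open>T core \<subseteq> core\<close>.\<close>

lemma subspace_mono: "subspace j \<subseteq> subspace (j + 1)"
proof (cases j rule: int_cases_nonneg_neg)
  case (1 n)
  have "core \<subseteq> \<delta> ` core"
  proof
    fix f assume f: "f \<in> core"
    then have "f = \<delta> (T f)" by (metis \<delta>_T core_subset subsetD)
    then show "f \<in> \<delta> ` core" using T_core[OF f] by blast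
  qed
  then have "(\<delta> ^^ n) ` core \<subseteq> (\<delta> ^^ n) ` \<delta> ` core" by (rule image_mono)
  also have "\<dots> = (\<delta> ^^ Suc n) ` core" by (simp only: image_comp funpow_Suc_right)
  finally show ?thesis
    using subspace_nonneg[of n] subspace_nonneg[of "Suc n"] 1 by (simp add: add.commute)
next
  case (2 n)
  have "T ` core \<subseteq> core" using T_core by blast
  then have "(T ^^ n) ` T ` core \<subseteq> (T ^^ n) ` core" by (rule image_mono)
  moreover have "(T ^^ n) ` T ` core = (T ^^ Suc n) ` core" by (simp only: image_comp funpow_Suc_right)
  ultimately show ?thesis
    using subspace_neg[of n] subspace_neg[of "Suc n"] 2 by simp
qed

lemma subspace_closed: "closed_subspace E (subspace j)"
proof -
  have "closed_subspace E ((T ^^ n) ` core)" for n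
  proof (induction n)
    case (Suc n)
    then show ?case
      using closed_subspace_unitary_image[OF T_unitary inner_spaces(4) inner_spaces(4)]
      by (simp only: funpow.simps image_comp[symmetric])
  qed (simp add: core_closed)
  moreover have "closed_subspace E ((\<delta> ^^ n) ` core)" for n
  proof (induction n)
    case (Suc n)
    then show ?case
      using closed_subspace_unitary_image[OF \<delta>_unitary inner_spaces(4) inner_spaces(4)]
      by (simp only: funpow.simps image_comp[symmetric])
  qed (simp add: core_closed)
  ultimately show ?thesis
    by (cases j rule: int_cases_nonneg_neg) (use subspace_nonneg subspace_neg in metis)+
qed

text \<open>On the core, \<open>T\<close> is the pure isometry, so its iterated images shrink to zero.\<close>

lemma subspace_Inter: "(\<Inter>j. subspace j) = {hzero E}"
proof
  show "{hzero E} \<subseteq> (\<Inter>j. subspace j)"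
    using subspace_closed by (auto simp: closed_subspace_def)
  show "(\<Inter>j. subspace j) \<subseteq> {hzero E}"
  proof
    fix f assume f: "f \<in> (\<Inter>j. subspace j)"
    let ?S = "\<lambda>v. A (v, hzero (W 0))"
    have T_pow: "(T ^^ n) g = ((?S ^^ n) (fst g), \<lambda>n. hzero (W n)) \<and> (T ^^ n) g \<in> core" if "g \<in> core" for g n
    proof (induction n)
      case 0
      then show ?case using that by (cases g) (auto simp: core_def)
    next
      case (Suc n)
      have "T ((T ^^ n) g) = (A (fst ((T ^^ n) g), hzero (W 0)), \<lambda>n. hzero (W n)) \<and> T ((T ^^ n) g) \<in> core"
        by (rule T_core) (use Suc in blast)
      then have 1: "T ((T ^^ n) g) = (A (fst ((T ^^ n) g), hzero (W 0)), \<lambda>n. hzero (W n))"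
        and 2: "T ((T ^^ n) g) \<in> core" by blast+
      have "(T ^^ Suc n) g = ((?S ^^ Suc n) (fst g), \<lambda>n. hzero (W n))"
        using 1 Suc by simp
      moreover have "(T ^^ Suc n) g \<in> core" using 2 by simp
      ultimately show ?case by blast
    qed
    have "fst f \<in> (?S ^^ n) ` hcarrier V0" for n
    proof -
      have "f \<in> subspace (- int n)" using f by blast
      then obtain g where g: "g \<in> core" "f = (T ^^ n) g" unfolding subspace_neg by blast
      then have "fst f = (?S ^^ n) (fst g)" using T_pow by simp
      moreover have "fst g \<in> hcarrier V0" using g(1) core_subset by (auto simp: E_carrier)
      ultimately show ?thesis by blast
    qed
    then have "fst f = hzero V0" using pure by blast
    moreover have "f \<in> core" using f subspace_neg[of 0] by (auto dest!: INT_D[of _ _ _ "0::int"])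
    ultimately show "f \<in> {hzero E}" by (cases f) (auto simp: core_def E_simps)
  qed
qed

text \<open>\<open>T\<close> lowers the highest occupied rung by one.\<close>

lemma truncated_in_subspace:
  "\<lbrakk>f \<in> hcarrier E; \<And>n. n \<ge> N \<Longrightarrow> snd f n = hzero (W n)\<rbrakk> \<Longrightarrow> f \<in> subspace (int N)"
proof (induction N arbitrary: f)
  case 0
  then show ?case using subspace_nonneg[of 0] by (simp add: core_def)
next
  case (Suc N)
  have "T f \<in> subspace (int N)"
  proof (rule Suc.IH)
    show "T f \<in> hcarrier E" using Suc.prems by (simp add: T_closed)
    show "snd (T f) n = hzero (W n)" if "n \<ge> N" for n
      using that Suc.prems(2)[of "Suc n"] by (simp add: T_def unitary_zero[OF Dinv] inner_spaces)
  qed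
  then have "\<delta> (T f) \<in> subspace (int N + 1)" unfolding subspace_step by blast
  then show ?case using \<delta>_T[OF Suc.prems(1)] by (simp add: add.commute)
qed

text \<open>Cutting a vector off above rung \<open>N\<close> changes it by the tail of a convergent series.\<close>

lemma subspace_Union_dense: "htopology E closure_of (\<Union>j. subspace j) = hcarrier E"
proof
  show "htopology E closure_of (\<Union>j. subspace j) \<subseteq> hcarrier E"
    using closure_of_subset_topspace[of "htopology E"] by simp
  show "hcarrier E \<subseteq> htopology E closure_of (\<Union>j. subspace j)"
  proof
    fix f assume f: "f \<in> hcarrier E"
    define a where "a n = (hnorm (W n) (snd f n))\<^sup>2" for n
    have f': "fst f \<in> hcarrier V0" "snd f n \<in> hcarrier (W n)" "a summable_on UNIV" for n
      using f by (auto simp: E_carrier a_def[abs_def])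
    define g where "g N = (fst f, \<lambda>n. if n < N then snd f n else hzero (W n))" for N
    have g: "g N \<in> hcarrier E" for N
      unfolding E_carrier
    proof (intro conjI allI)
      show "(\<lambda>n. (hnorm (W n) (snd (g N) n))\<^sup>2) summable_on UNIV"
        using f'(3) by (rule summable_on_comparison_test) (auto simp: g_def a_def)
    qed (use f' in \<open>auto simp: g_def\<close>)
    have "g N \<in> (\<Union>j. subspace j)" for N
      using truncated_in_subspace[OF g, of N N] by (auto simp: g_def)
    then have "range g \<subseteq> (\<Union>j. subspace j)" by blast
    moreover have "(\<Union>j. subspace j) \<subseteq> hcarrier E" using subspace_subset by blast
    moreover have "E.converges g f"
      unfolding E.converges_def
    proof (intro conjI)
      have norm: "(hnorm E (hsub E (g N) f))\<^sup>2 = (\<Sum>n. a (n + N))" for N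
      proof -
        have "summable a" using f'(3) by (rule summable_on_imp_summable)
        have d: "hsub E (g N) f \<in> hcarrier E" using f g by simp
        have fst0: "hnorm V0 (fst (hsub E (g N) f)) = 0"
          using f' by (simp add: E_def g_def V0.sub_self)
        have sndn: "(hnorm (W n) (snd (hsub E (g N) f) n))\<^sup>2 = (if n < N then 0 else a n)" for n
          using f'(2)[of n]
          by (simp add: E_def sum.hsum_sub g_def Wn.sub_self a_def Wn.norm_zero_sub)
        have "(\<lambda>n. if n < N then 0 else a n) summable_on UNIV"
          using f'(3) by (rule summable_on_comparison_test) (auto simp: a_def)
        then have "(\<lambda>n. if n < N then 0 else a n) sums (\<Sum>\<^sub>\<infinity>n. if n < N then 0 else a n)"
          by (intro has_sum_imp_sums has_sum_infsum)
        moreover have "(\<lambda>n. if n < N then 0 else a n) sums (\<Sum>n. a (n + N))"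
          using \<open>summable a\<close>
          by (subst sums_iff_shift'[of _ N, symmetric]) (simp_all add: summable_sums summable_iff_shift)
        ultimately have "(\<Sum>\<^sub>\<infinity>n. if n < N then 0 else a n) = (\<Sum>n. a (n + N))" by (rule sums_unique2)
        then show ?thesis unfolding E_norm_sq[OF d] fst0 sndn by simp
      qed
      have "(\<lambda>N. \<Sum>n. a (n + N)) \<longlonglongrightarrow> 0"
      proof (rule LIMSEQ_I)
        fix e :: real assume "e > 0"
        then show "\<exists>N0. \<forall>N\<ge>N0. norm ((\<Sum>n. a (n + N)) - 0) < e"
          using suminf_exist_split[of e a] f'(3) by (simp add: summable_on_imp_summable)
      qed
      then have "(\<lambda>N. sqrt ((hnorm E (hsub E (g N) f))\<^sup>2)) \<longlonglongrightarrow> sqrt 0"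
        unfolding norm by (rule tendsto_real_sqrt)
      then show "(\<lambda>N. hnorm E (hsub E (g N) f)) \<longlonglongrightarrow> 0" using f g by simp
    qed (use f g in auto)
    ultimately show "f \<in> htopology E closure_of (\<Union>j. subspace j)"
      by (rule E.converges_in_closure)
  qed
qed

lemma E_separable: "separable_space (htopology E)"
proof -
  have "\<exists>S. \<forall>n. countable_total (W n) (S n)" using total by metis
  then obtain S where "\<And>n. countable_total (W n) (S n)" by blast
  then obtain R where "countable_total (hsum UNIV W) R"
    using countable_total_hsum[of "UNIV :: nat set" W S] inner_spaces(2) by auto
  then show ?thesis
    using total0 countable_total_hprod[OF inner_spaces(1,3)] E.separable_if_total unfolding E_def by metis
qed

theorem gmra_ladder: "gmra E \<alpha> rep \<delta> subspace"
  unfolding gmra_def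
proof (intro conjI allI ballI)
  show "hilbert_space E" by (rule E.hilbert_space_axioms)
  show "separable_space (htopology E)" by (rule E_separable)
  show "unitary_rep E rep" by (rule rep_unitary)
  show "unitary_op E E \<delta>" by (rule \<delta>_unitary)
  fix \<gamma> f
  show "op_inverse E \<delta> (rep \<gamma> (\<delta> f)) = rep (\<alpha> \<gamma>) f" if f: "f \<in> hcarrier E"
  proof -
    have \<delta>f: "\<delta> f \<in> hcarrier E" by (rule unitary_closed[OF \<delta>_unitary f])
    have "unitary_op E E (rep \<gamma>)" using rep_unitary by (simp add: unitary_rep_def)
    then have "rep \<gamma> (\<delta> f) \<in> hcarrier E" using \<delta>f by (rule unitary_closed)
    then have "op_inverse E \<delta> (rep \<gamma> (\<delta> f)) = T (rep \<gamma> (\<delta> f))"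
      unfolding \<delta>_def by (rule op_inverse_op_inverse[OF T_unitary inner_spaces(4)])
    then show ?thesis using T_rep[OF \<delta>f] T_\<delta>[OF f] by simp
  qed
  show "rep \<gamma> f \<in> subspace 0" if f: "f \<in> subspace 0"
  proof -
    have f: "f \<in> core" using f subspace_neg[of 0] by simp
    have "unitary_op (W n) (W n) (\<rho> n \<gamma>)" for n using \<rho>[of n] by (simp add: unitary_rep_def)
    then have "\<rho> n \<gamma> (hzero (W n)) = hzero (W n)" for n by (rule unitary_zero) (rule inner_spaces)+
    moreover have "rep \<gamma> f \<in> hcarrier E"
      using f core_subset rep_unitary unitary_closed[of E E "rep \<gamma>" f] by (auto simp: unitary_rep_def)
    ultimately have "rep \<gamma> f \<in> core" using f by (simp add: core_def rep_def)
    then show ?thesis using subspace_neg[of 0] by simp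
  qed
next
  fix j
  show "closed_subspace E (subspace j)" by (rule subspace_closed)
  show "subspace j \<subseteq> subspace (j + 1)" by (rule subspace_mono)
  show "subspace (j + 1) = \<delta> ` subspace j" by (rule subspace_step)
qed (rule subspace_Inter subspace_Union_dense)+

end

section \<open>Characters trivial on a subgroup of finite index\<close>

primrec nmul :: "nat \<Rightarrow> 'g::ab_group_add \<Rightarrow> 'g" where
  "nmul 0 z = 0"
| "nmul (Suc k) z = z + nmul k z"

lemma nmul_add: "nmul (j + k) z = nmul j z + nmul k z"
  by (induction j) (auto simp: add.assoc)

definition additive_subgroup :: "'g::ab_group_add set \<Rightarrow> bool" where
  "additive_subgroup M \<longleftrightarrow> 0 \<in> M \<and> (\<forall>x\<in>M. \<forall>y\<in>M. x - y \<in> M)"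

lemma additive_subgroupD:
  assumes "additive_subgroup M"
  shows "0 \<in> M" and "\<lbrakk>x \<in> M; y \<in> M\<rbrakk> \<Longrightarrow> x - y \<in> M" and "x \<in> M \<Longrightarrow> - x \<in> M"
    and "\<lbrakk>x \<in> M; y \<in> M\<rbrakk> \<Longrightarrow> x + y \<in> M" and "x \<in> M \<Longrightarrow> nmul k x \<in> M"
proof -
  have zero: "0 \<in> M" and diff: "\<And>x y. \<lbrakk>x \<in> M; y \<in> M\<rbrakk> \<Longrightarrow> x - y \<in> M"
    using assms by (auto simp: additive_subgroup_def)
  have neg: "- x \<in> M" if "x \<in> M" for x using diff[OF zero that] by simp
  have add: "x + y \<in> M" if "x \<in> M" "y \<in> M" for x y using diff[OF that(1) neg[OF that(2)]] by simp
  show "0 \<in> M" "\<lbrakk>x \<in> M; y \<in> M\<rbrakk> \<Longrightarrow> x - y \<in> M" "x \<in> M \<Longrightarrow> - x \<in> M"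
    "\<lbrakk>x \<in> M; y \<in> M\<rbrakk> \<Longrightarrow> x + y \<in> M"
    by (fact zero diff neg add)+
  show "nmul k x \<in> M" if "x \<in> M"
    by (induction k) (simp_all add: add zero that)
qed

definition character_on :: "'g::ab_group_add set \<Rightarrow> ('g \<Rightarrow> complex) \<Rightarrow> bool" where
  "character_on M \<phi> \<longleftrightarrow> additive_subgroup M \<and> (\<forall>x\<in>M. cmod (\<phi> x) = 1) \<and>
    (\<forall>x\<in>M. \<forall>y\<in>M. \<phi> (x + y) = \<phi> x * \<phi> y)"

lemma character_on_zero: "character_on M \<phi> \<Longrightarrow> \<phi> 0 = 1"
  unfolding character_on_def additive_subgroup_def
  by (metis add_0 mult_cancel_right1 norm_zero zero_neq_one)

lemma character_on_nmul:
  assumes "character_on M \<phi>" "x \<in> M"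
  shows "\<phi> (nmul k x) = \<phi> x ^ k"
  using assms character_on_zero[OF assms(1)]
  by (induction k) (auto simp: character_on_def additive_subgroupD(5))

lemma unit_complex_root:
  assumes "cmod z = 1" "k > 0"
  obtains w where "w ^ k = z" "cmod w = 1"
proof -
  define w where "w = cis (Arg z / k)"
  have "w ^ k = cis (Arg z)" using assms(2) unfolding w_def Complex.DeMoivre by simp
  also have "\<dots> = z" using cis_Arg[of z] assms(1) by (cases "z = 0") (simp_all add: sgn_div_norm)
  finally show ?thesis using that[of w] by (simp add: w_def)
qed

text \<open>A character extends to the subgroup generated by one more element \<open>z\<close>; its value at \<open>z\<close>
  may be any \<open>k\<close>-th root of its value at \<open>k z\<close>, where \<open>k z\<close> is the first multiple in \<open>M\<close>.\<close>

lemma character_extend_step: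
  assumes \<phi>: "character_on M \<phi>" and k: "k > 0" "nmul k z \<in> M"
    and least: "\<And>j. \<lbrakk>0 < j; j < k\<rbrakk> \<Longrightarrow> nmul j z \<notin> M"
    and w: "w ^ k = \<phi> (nmul k z)" "cmod w = 1"
  obtains M' \<phi>' where "character_on M' \<phi>'" "M \<subseteq> M'" "z \<in> M'" "\<And>x. x \<in> M \<Longrightarrow> \<phi>' x = \<phi> x" "\<phi>' z = w"
proof -
  have M: "additive_subgroup M" using \<phi> by (simp add: character_on_def)
  note sub = additive_subgroupD[OF M]
  have nmul_mult: "nmul (k * t) z = nmul t (nmul k z)" for t
    by (induction t) (auto simp: nmul_add)
  \<comment> \<open>The multiples of \<open>z\<close> in \<open>M\<close> are the multiples of \<open>k z\<close>, as remainders modulo \<open>k\<close> are excluded.\<close>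
  have dvd: "k dvd j" if j: "nmul j z \<in> M" for j
  proof (rule ccontr)
    assume "\<not> k dvd j"
    then have "0 < j mod k" "j mod k < k" using k(1) by (auto simp: dvd_eq_mod_eq_0)
    moreover have "nmul j z = nmul (k * (j div k)) z + nmul (j mod k) z"
      by (simp add: nmul_add[symmetric])
    then have "nmul (j mod k) z = nmul j z - nmul (k * (j div k)) z" by simp
    then have "nmul (j mod k) z \<in> M"
      using sub(2)[OF j] sub(5)[OF k(2)] by (simp add: nmul_mult)
    ultimately show False using least by blast
  qed
  have w0: "w \<noteq> 0" using w(2) by auto
  \<comment> \<open>The prescribed value depends only on the element and not on its representation.\<close>
  have wd: "\<phi> x * w ^ i = \<phi> y * w ^ j" if xy: "x \<in> M" "y \<in> M" and eq: "x + nmul i z = y + nmul j z" and "i \<le> j"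
    for x y i j
  proof -
    obtain d where d: "j = i + d" using \<open>i \<le> j\<close> le_Suc_ex by blast
    have xd: "x = y + nmul d z" using eq by (simp add: d nmul_add)
    then have "nmul d z = x - y" by simp
    then have "nmul d z \<in> M" using sub(2)[OF xy] by simp
    then obtain t where t: "d = k * t" using dvd by (metis dvdE)
    have "\<phi> (nmul d z) = w ^ d"
      using character_on_nmul[OF \<phi> k(2), of t] w(1) by (simp add: t nmul_mult power_mult)
    then have "\<phi> x = \<phi> y * w ^ d"
      using \<phi> xy \<open>nmul d z \<in> M\<close> by (simp add: xd character_on_def)
    then show ?thesis by (simp add: d power_add)
  qed
  define M' where "M' = {x + nmul i z | x i. x \<in> M}"
  define \<phi>' where "\<phi>' u = (SOME v. \<exists>x\<in>M. \<exists>i. u = x + nmul i z \<and> v = \<phi> x * w ^ i)" for u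
  have \<phi>': "\<phi>' (x + nmul i z) = \<phi> x * w ^ i" if x: "x \<in> M" for x i
  proof -
    have "\<exists>y\<in>M. \<exists>j. x + nmul i z = y + nmul j z \<and> \<phi>' (x + nmul i z) = \<phi> y * w ^ j"
      unfolding \<phi>'_def by (rule someI_ex) (use x in blast)
    then obtain y j where y: "y \<in> M" "x + nmul i z = y + nmul j z" "\<phi>' (x + nmul i z) = \<phi> y * w ^ j" by blast
    show ?thesis
      using wd[OF x y(1,2)] wd[OF y(1) x y(2)[symmetric]] y(3) by (cases "i \<le> j") auto
  qed
  have add': "u + v \<in> M' \<and> \<phi>' (u + v) = \<phi>' u * \<phi>' v" if "u \<in> M'" "v \<in> M'" for u v
  proof -
    obtain x i where u: "u = x + nmul i z" "x \<in> M" using \<open>u \<in> M'\<close> unfolding M'_def by blast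
    obtain y j where v: "v = y + nmul j z" "y \<in> M" using \<open>v \<in> M'\<close> unfolding M'_def by blast
    note * = u v
    then have **: "u + v = (x + y) + nmul (i + j) z" by (simp add: nmul_add algebra_simps)
    have "x + y \<in> M" using * sub(4) by blast
    then have "\<phi>' (u + v) = \<phi> (x + y) * w ^ (i + j)" unfolding ** by (rule \<phi>')
    also have "\<dots> = \<phi>' u * \<phi>' v"
      using * \<phi> \<phi>' by (simp add: character_on_def power_add)
    finally have "\<phi>' (u + v) = \<phi>' u * \<phi>' v" .
    moreover have "u + v \<in> M'" unfolding ** M'_def using \<open>x + y \<in> M\<close> by blast
    ultimately show ?thesis by blast
  qed
  have sub': "M \<subseteq> M'" unfolding M'_def using add.right_neutral nmul.simps(1) by (metis (mono_tags, lifting) mem_Collect_eq subsetI)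
  \<comment> \<open>Only nonnegative multiples of \<open>z\<close> occur in \<open>M'\<close>; negatives are reached modulo \<open>k z \<in> M\<close>.\<close>
  have neg': "- u \<in> M'" if "u \<in> M'" for u
  proof -
    obtain x i where u: "u = x + nmul i z" "x \<in> M" using \<open>u \<in> M'\<close> by (auto simp: M'_def)
    have "i \<le> k * i" using k(1) by simp
    then have "nmul (k * i) z = nmul i z + nmul (k * i - i) z" by (simp add: nmul_add[symmetric])
    then have "- u = (- x - nmul (k * i) z) + nmul (k * i - i) z" by (simp add: u)
    moreover have "- x - nmul (k * i) z \<in> M" using sub(2)[OF sub(3)[OF u(2)]] sub(5)[OF k(2)] by (simp add: nmul_mult)
    ultimately show ?thesis unfolding M'_def by blast
  qed
  have "character_on M' \<phi>'"
    unfolding character_on_def additive_subgroup_def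
  proof (intro conjI ballI)
    show "0 \<in> M'" using sub' sub(1) by blast
    show "u - v \<in> M'" if "u \<in> M'" "v \<in> M'" for u v using add'[OF that(1) neg'[OF that(2)]] by simp
    show "cmod (\<phi>' u) = 1" if "u \<in> M'" for u
      using that \<phi>' \<phi> w(2) by (auto simp: M'_def character_on_def norm_mult norm_power)
  qed (use add' in blast)
  moreover have "\<phi>' x = \<phi> x" if "x \<in> M" for x using \<phi>'[OF that, of 0] by simp
  moreover have "\<phi>' z = w" using \<phi>'[OF sub(1), of 1] character_on_zero[OF \<phi>] by simp
  moreover have "z \<in> M'" unfolding M'_def using sub(1) by (auto intro!: exI[of _ 0] exI[of _ 1])
  ultimately show ?thesis using that sub' by blast
qed

text \<open>Sums over the cosets of \<open>L\<close> are written as sums over a fixed set \<open>X\<close> of representatives.\<close>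

locale finite_index_subgroup =
  fixes L :: "'g::ab_group_add set"
  assumes L: "additive_subgroup L"
    and finite_cosets: "finite (UNIV // {(x, y). x - y \<in> L})"
begin

abbreviation "R \<equiv> {(x, y). x - y \<in> L}"

definition r :: "'g \<Rightarrow> 'g" where "r x = (SOME y. x - y \<in> L)"

definition X :: "'g set" where "X = range r"

lemmas L_closed = additive_subgroupD[OF L]

lemma equiv_R: "equiv UNIV R"
proof (rule equivI)
  show "refl R" by (auto simp: refl_on_def L_closed)
  show "sym R" by (rule symI) (use L_closed(3) in fastforce)
  show "trans R"
  proof (rule transI)
    fix x y z assume "(x, y) \<in> R" "(y, z) \<in> R"
    then have "(x - y) + (y - z) \<in> L" by (intro L_closed(4)) auto
    then show "(x, z) \<in> R" by simp
  qed
qed auto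

lemma r: "x - r x \<in> L"
  unfolding r_def by (rule someI[of _ x]) (simp add: L_closed)

lemma r_cong: 
  assumes "x - y \<in> L"
  shows "r x = r y"
proof -
  have "x - z \<in> L \<longleftrightarrow> y - z \<in> L" for z
    using L_closed(4)[OF assms, of "y - z"] L_closed(2)[of "x - z" "x - y"] assms by auto
  then show ?thesis by (simp add: r_def)
qed

lemma r_eq_iff: "r x = r y \<longleftrightarrow> x - y \<in> L"
proof
  assume "r x = r y"
  then have "(x - r x) - (y - r y) = x - y" by simp
  then show "x - y \<in> L" using L_closed(2)[OF r[of x] r[of y]] by simp
qed (rule r_cong)

lemma r_r [simp]: "r (r x) = r x"
  using r_eq_iff[of x "r x"] r by metis

lemma card_X: "card X = card (UNIV // R)" and finite_X: "finite X"
proof -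
  define g where "g x = R `` {x}" for x
  have gr: "g x = g y \<longleftrightarrow> r x = r y" for x y
    unfolding g_def r_eq_iff using eq_equiv_class_iff[OF equiv_R, of x y] by simp
  have "bij_betw g X (UNIV // R)"
    unfolding bij_betw_def
  proof
    show "inj_on g X" by (rule inj_onI) (auto simp: gr X_def)
    show "g ` X = UNIV // R"
    proof
      show "g ` X \<subseteq> UNIV // R" by (auto simp: g_def quotient_def)
      have "g x \<in> g ` X" for x using gr[of x "r x"] by (auto simp: X_def intro!: image_eqI[of _ _ "r x"])
      then show "UNIV // R \<subseteq> g ` X" by (auto simp: quotient_def g_def)
    qed
  qed
  then show "card X = card (UNIV // R)" "finite X"
    using finite_cosets by (auto simp: bij_betw_same_card bij_betw_finite)
qed

text \<open>By the pigeonhole principle two of the multiples \<open>0, x, \<dots>, card X x\<close> lie in the same coset.\<close>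

lemma multiple_in_L: "\<exists>k>0. k \<le> card X \<and> nmul k x \<in> L"
proof -
  have "\<not> inj_on (\<lambda>k. r (nmul k x)) {..card X}"
    using card_inj_on_le[of "\<lambda>k. r (nmul k x)" "{..card X}" X] finite_X by (auto simp: X_def)
  then obtain i j where ij: "i < j" "j \<le> card X" "r (nmul i x) = r (nmul j x)"
    unfolding inj_on_def by (metis atMost_iff linorder_neqE_nat)
  then have "nmul j x - nmul i x \<in> L" using r_eq_iff by metis
  moreover have "nmul j x = nmul i x + nmul (j - i) x" using ij(1) by (simp add: nmul_add[symmetric])
  ultimately have "nmul (j - i) x \<in> L" by simp
  then show ?thesis using ij by (intro exI[of _ "j - i"]) auto
qed

lemma first_multiple:
  assumes "L \<subseteq> M"
  obtains k where "k > 0" "nmul k x \<in> M" "\<And>j. \<lbrakk>0 < j; j < k\<rbrakk> \<Longrightarrow> nmul j x \<notin> M"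
proof -
  have ex: "\<exists>k. 0 < k \<and> nmul k x \<in> M" using multiple_in_L[of x] assms by blast
  show ?thesis
    using LeastI_ex[OF ex] not_less_Least[of _ "\<lambda>k. 0 < k \<and> nmul k x \<in> M"]
    by (intro that[of "LEAST k. 0 < k \<and> nmul k x \<in> M"]) auto
qed

text \<open>Adjoining the finitely many coset representatives one by one extends a character of an
  intermediate subgroup to the whole group.\<close>

lemma character_extend:
  assumes "character_on M \<phi>" "L \<subseteq> M"
  obtains \<omega> where "\<omega> \<in> dual_group" "\<And>x. x \<in> M \<Longrightarrow> \<omega> x = \<phi> x"
proof -
  have "\<exists>M' \<phi>'. character_on M' \<phi>' \<and> M \<subseteq> M' \<and> F \<subseteq> M' \<and> (\<forall>x\<in>M. \<phi>' x = \<phi> x)"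
    if "finite F" for F
    using that
  proof (induction F)
    case empty
    then show ?case using assms(1) by auto
  next
    case (insert z F)
    then obtain M' \<phi>' where M': "character_on M' \<phi>'" "M \<subseteq> M'" "F \<subseteq> M'" "\<forall>x\<in>M. \<phi>' x = \<phi> x" by auto
    then have "L \<subseteq> M'" using assms(2) by blast
    then obtain k where k: "k > 0" "nmul k z \<in> M'" "\<And>j. \<lbrakk>0 < j; j < k\<rbrakk> \<Longrightarrow> nmul j z \<notin> M'"
      using first_multiple[of M' z] by blast
    obtain w where w: "w ^ k = \<phi>' (nmul k z)" "cmod w = 1"
      using unit_complex_root[of "\<phi>' (nmul k z)" k] M'(1) k by (auto simp: character_on_def)
    obtain M'' \<phi>'' where "character_on M'' \<phi>''" "M' \<subseteq> M''" "z \<in> M''" "\<And>x. x \<in> M' \<Longrightarrow> \<phi>'' x = \<phi>' x"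
      using character_extend_step[OF M'(1) k w] by blast
    then show ?case using M' by (intro exI[of _ M''] exI[of _ \<phi>'']) auto
  qed
  from this[OF finite_X] obtain M' \<phi>' where
    M': "character_on M' \<phi>'" "M \<subseteq> M'" "X \<subseteq> M'" "\<forall>x\<in>M. \<phi>' x = \<phi> x" by blast
  have "x \<in> M'" for x
  proof -
    have "r x \<in> M'" "x - r x \<in> M'" using M'(2,3) assms(2) r by (auto simp: X_def)
    then have "(x - r x) + r x \<in> M'"
      using M'(1) additive_subgroupD(4) unfolding character_on_def by blast
    then show ?thesis by simp
  qed
  then have "\<phi>' \<in> dual_group" using M'(1) by (simp add: character_on_def dual_group_def)
  then show ?thesis using that M'(4) by blast
qed

definition annihilator :: "'g character set" where
  "annihilator = {\<omega> \<in> dual_group. \<forall>x\<in>L. \<omega> x = 1}"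

text \<open>Adjoin \<open>z\<close> to \<open>L\<close>, sending it to a primitive \<open>k\<close>-th root of unity, where \<open>k > 1\<close> is the order of
  \<open>z\<close> modulo \<open>L\<close>, and extend.\<close>

lemma annihilator_separates:
  assumes "z \<notin> L"
  obtains \<omega> where "\<omega> \<in> annihilator" "\<omega> z \<noteq> 1"
proof -
  have L1: "character_on L (\<lambda>_. 1)" using L by (simp add: character_on_def)
  obtain k where k: "k > 0" "nmul k z \<in> L" "\<And>j. \<lbrakk>0 < j; j < k\<rbrakk> \<Longrightarrow> nmul j z \<notin> L"
    using first_multiple[OF order_refl, of z] by blast
  have "k \<noteq> 1" using k(2) assms by auto
  define w where "w = cis (2 * pi / k)"
  have w: "w ^ k = 1" "cmod w = 1"
    using k(1) by (simp_all add: w_def Complex.DeMoivre)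
  have "w \<noteq> 1"
  proof
    assume "w = 1"
    then have "cos (2 * pi / k) = 1" by (simp add: w_def complex_eq_iff)
    then obtain n :: int where "2 * pi / k = real_of_int n * 2 * pi" using cos_one_2pi_int by blast
    then have "1 / real k = n" using pi_gt_zero k(1) by (simp add: field_simps)
    moreover have "0 < 1 / real k" "1 / real k < 1" using k(1) \<open>k \<noteq> 1\<close> by auto
    ultimately show False by (metis of_int_0_less_iff of_int_less_1_iff int_one_le_iff_zero_less not_le)
  qed
  obtain M' \<phi>' where M': "character_on M' \<phi>'" "L \<subseteq> M'" "z \<in> M'" "\<And>x. x \<in> L \<Longrightarrow> \<phi>' x = 1" "\<phi>' z = w"
    using character_extend_step[OF L1 k w(1) w(2)] by blast
  obtain \<omega> where "\<omega> \<in> dual_group" "\<And>x. x \<in> M' \<Longrightarrow> \<omega> x = \<phi>' x"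
    using character_extend[OF M'(1,2)] by blast
  moreover from this have "\<forall>x\<in>L. \<omega> x = 1" using M'(2,4) by (metis subsetD)
  ultimately show ?thesis using that[of \<omega>] M'(3,5) \<open>w \<noteq> 1\<close> by (simp add: annihilator_def)
qed

lemma annihilator_r: "\<omega> \<in> annihilator \<Longrightarrow> \<omega> (r x) = \<omega> x"
proof -
  assume \<omega>: "\<omega> \<in> annihilator"
  have "\<omega> ((x - r x) + r x) = \<omega> (x - r x) * \<omega> (r x)"
    using \<omega> unfolding annihilator_def dual_group_def by blast
  then show ?thesis using \<omega> r[of x] by (simp add: annihilator_def)
qed

text \<open>Such a character is determined by its values on \<open>X\<close>, which are roots of unity of bounded order.\<close>

lemma finite_annihilator: "finite annihilator"
proof -
  have fin: "finite (\<Union>k\<in>{1..card X}. {z :: complex. z ^ k = 1})"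
    by (auto intro!: finite_nth_roots)
  have "inj_on (\<lambda>\<omega>. restrict \<omega> X) annihilator"
  proof (rule inj_onI, rule ext)
    fix \<omega> \<omega>' x assume \<omega>: "\<omega> \<in> annihilator" "\<omega>' \<in> annihilator" "restrict \<omega> X = restrict \<omega>' X"
    have "\<omega> (r x) = \<omega>' (r x)" using fun_cong[OF \<omega>(3), of "r x"] by (simp add: X_def)
    then show "\<omega> x = \<omega>' x" using \<omega>(1,2) annihilator_r by metis
  qed
  moreover have "\<omega> x \<in> (\<Union>k\<in>{1..card X}. {z. z ^ k = 1})" if \<omega>: "\<omega> \<in> annihilator" for \<omega> x
  proof -
    obtain k where k: "k > 0" "k \<le> card X" "nmul k x \<in> L" using multiple_in_L by blast
    have "character_on UNIV \<omega>"
      using \<omega> by (auto simp: annihilator_def dual_group_def character_on_def additive_subgroup_def)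
    then have "\<omega> x ^ k = 1" using character_on_nmul[of UNIV \<omega> x k] \<omega> k(3) by (simp add: annihilator_def)
    then show "\<omega> x \<in> (\<Union>k\<in>{1..card X}. {z. z ^ k = 1})" using k by (intro UN_I[of k]) auto
  qed
  then have "(\<lambda>\<omega>. restrict \<omega> X) ` annihilator \<subseteq> X \<rightarrow>\<^sub>E (\<Union>k\<in>{1..card X}. {z. z ^ k = 1})"
    by (auto simp: PiE_iff)
  ultimately show ?thesis
    by (rule inj_on_finite) (intro finite_PiE finite_X fin)
qed

text \<open>Both orthogonality relations, summed over all pairs: a nontrivial character sums to zero over
  the cosets, and the characters sum to zero at a point off \<open>L\<close> because some character moves it.\<close>

lemma card_annihilator: "card annihilator = card (UNIV // R)"
proof -
  have mult: "\<omega> (x + y) = \<omega> x * \<omega> y" if "\<omega> \<in> annihilator" for \<omega> x y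
    using that by (simp add: annihilator_def dual_group_def)
  have one: "(\<lambda>_. 1) \<in> annihilator" by (simp add: annihilator_def dual_group_def)
  have sum_X: "(\<Sum>x\<in>X. \<omega> x) = (if \<omega> = (\<lambda>_. 1) then of_nat (card X) else 0)" if \<omega>: "\<omega> \<in> annihilator" for \<omega>
  proof (cases "\<omega> = (\<lambda>_. 1)")
    case False
    then obtain y where y: "\<omega> y \<noteq> 1" by blast
    have "bij_betw (\<lambda>x. r (x + y)) X X"
    proof (rule bij_betw_byWitness[where f' = "\<lambda>x. r (x - y)"])
      have 1: "r (r x + z) = r (x + z)" for x z
        unfolding r_eq_iff using L_closed(3)[OF r[of x]] by simp
      show "\<forall>x\<in>X. r (r (x + y) - y) = x"
        using 1[of _ "- y"] by (auto simp: X_def)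
      show "\<forall>x\<in>X. r (r (x - y) + y) = x"
        using 1 by (auto simp: X_def)
    qed (auto simp: X_def)
    then have "(\<Sum>x\<in>X. \<omega> x) = (\<Sum>x\<in>X. \<omega> (r (x + y)))"
      by (rule sum.reindex_bij_betw[symmetric])
    also have "\<dots> = (\<Sum>x\<in>X. \<omega> x) * \<omega> y"
      by (simp add: annihilator_r[OF \<omega>] mult[OF \<omega>] sum_distrib_right)
    finally have "(\<Sum>x\<in>X. \<omega> x) * (\<omega> y - 1) = 0" by (simp add: algebra_simps)
    then show ?thesis using y False by simp
  qed simp
  have sum_ann: "(\<Sum>\<omega>\<in>annihilator. \<omega> x) = (if x \<in> L then of_nat (card annihilator) else 0)" for x
  proof (cases "x \<in> L")
    case True
    then show ?thesis by (simp add: annihilator_def)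
  next
    case False
    then obtain \<eta> where \<eta>: "\<eta> \<in> annihilator" "\<eta> x \<noteq> 1" by (rule annihilator_separates)
    have \<eta>0: "\<eta> y \<noteq> 0" for y using \<eta>(1) by (auto simp: annihilator_def dual_group_def dest!: spec[of _ y])
    have "bij_betw (\<lambda>\<omega>. char_mult \<omega> \<eta>) annihilator annihilator"
      by (rule bij_betw_byWitness[where f' = "\<lambda>\<omega>. char_mult \<omega> (char_inv \<eta>)"])
        (use \<eta>(1) \<eta>0 in \<open>auto simp: char_mult_def char_inv_def annihilator_def dual_group_def norm_mult norm_inverse\<close>)
    then have "(\<Sum>\<omega>\<in>annihilator. \<omega> x) = (\<Sum>\<omega>\<in>annihilator. char_mult \<omega> \<eta> x)"
      by (rule sum.reindex_bij_betw[symmetric])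
    also have "\<dots> = (\<Sum>\<omega>\<in>annihilator. \<omega> x) * \<eta> x"
      by (simp add: char_mult_def sum_distrib_right)
    finally have "(\<Sum>\<omega>\<in>annihilator. \<omega> x) * (\<eta> x - 1) = 0" by (simp add: algebra_simps)
    then show ?thesis using \<eta>(2) False by simp
  qed
  have "X \<inter> L = {r 0}"
  proof -
    have "x = r 0" if "x \<in> X" "x \<in> L" for x
      using that r_eq_iff[of x 0] by (auto simp: X_def)
    moreover have "r 0 \<in> L" using L_closed(3)[OF r[of 0]] by simp
    ultimately show ?thesis by (auto simp: X_def)
  qed
  then have "of_nat (card annihilator) = (\<Sum>x\<in>X. (if x \<in> L then of_nat (card annihilator) else 0 :: complex))"
    by (simp add: sum.If_cases finite_X)
  also have "\<dots> = (\<Sum>x\<in>X. \<Sum>\<omega>\<in>annihilator. \<omega> x)" by (simp add: sum_ann)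
  also have "\<dots> = (\<Sum>\<omega>\<in>annihilator. \<Sum>x\<in>X. \<omega> x)" by (rule sum.swap)
  also have "\<dots> = (\<Sum>\<omega>\<in>annihilator. if \<omega> = (\<lambda>_. 1) then of_nat (card X) else 0)"
    by (intro sum.cong refl sum_X)
  also have "\<dots> = of_nat (card X)"
    using one by (simp add: finite_annihilator)
  finally show ?thesis by (simp add: card_X)
qed

end

section \<open>The dual group and its Haar measure\<close>

lemma dual_groupD:
  assumes "\<omega> \<in> dual_group"
  shows "cmod (\<omega> x) = 1" and "\<omega> (x + y) = \<omega> x * \<omega> y" and "\<omega> x \<noteq> 0" and "\<omega> 0 = 1"
proof -
  show 1: "cmod (\<omega> x) = 1" and 2: "\<omega> (x + y) = \<omega> x * \<omega> y" for x y
    using assms by (auto simp: dual_group_def)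
  show 3: "\<omega> x \<noteq> 0" for x using 1[of x] by auto
  show "\<omega> 0 = 1" using 2[of 0 0] 3[of 0] by simp
qed

lemma char_mult_closed [simp]:
  "\<lbrakk>\<omega> \<in> dual_group; \<zeta> \<in> dual_group\<rbrakk> \<Longrightarrow> char_mult \<omega> \<zeta> \<in> dual_group"
  by (auto simp: dual_group_def char_mult_def norm_mult)

lemma char_inv_closed [simp]: "\<omega> \<in> dual_group \<Longrightarrow> char_inv \<omega> \<in> dual_group"
  by (auto simp: dual_group_def char_inv_def norm_inverse)

lemma char_mult_commute: "char_mult a b = char_mult b a"
  by (simp add: char_mult_def mult.commute)

lemma char_mult_inv [simp]:
  assumes "a \<in> dual_group"
  shows "char_mult a (char_mult (char_inv a) b) = b" "char_mult (char_inv a) (char_mult a b) = b"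
  using dual_groupD(3)[OF assms]
  by (simp_all add: char_mult_def char_inv_def fun_eq_iff mult.assoc[symmetric])

lemma char_inv_inv [simp]: "char_inv (char_inv a) = a"
  by (simp add: char_inv_def)

lemma dual_endo_mult: "dual_endo \<alpha> (char_mult a b) = char_mult (dual_endo \<alpha> a) (dual_endo \<alpha> b)"
  by (simp add: dual_endo_def char_mult_def)

lemma dual_endo_inv: "dual_endo \<alpha> (char_inv a) = char_inv (dual_endo \<alpha> a)"
  by (simp add: dual_endo_def char_inv_def)

lemma coordinate_measurable [measurable]:
  "(\<lambda>\<omega> :: 'g::countable \<Rightarrow> complex. \<omega> x) \<in> borel_measurable borel"
  using measurable_product_then_coordinatewise[of "\<lambda>\<omega>. \<omega>" borel x] by simp

lemma dual_group_borel [measurable]: "(dual_group :: 'g::{ab_group_add,countable} character set) \<in> sets borel"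
proof -
  have a: "(\<lambda>\<omega> :: 'g \<Rightarrow> complex. cmod (\<omega> x)) -` {1} \<in> sets borel" for x
    using measurable_sets[OF measurable_compose[OF coordinate_measurable[of x] borel_measurable_norm], of "{1}"] by simp
  have b: "(\<lambda>\<omega> :: 'g \<Rightarrow> complex. \<omega> (x + y) - \<omega> x * \<omega> y) -` {0} \<in> sets borel" for x y
    using measurable_sets[OF borel_measurable_diff[OF coordinate_measurable[of "x + y"]
      borel_measurable_times[OF coordinate_measurable[of x] coordinate_measurable[of y]]], of "{0}"] by simp
  have e: "(dual_group :: 'g character set) = (\<Inter>x. (\<lambda>\<omega>. cmod (\<omega> x)) -` {1}) \<inter>
      (\<Inter>x. \<Inter>y. (\<lambda>\<omega>. \<omega> (x + y) - \<omega> x * \<omega> y) -` {0})"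
    by (auto simp: dual_group_def)
  show ?thesis
    unfolding e by (intro sets.Int sets.countable_INT'' a b) simp_all
qed

lemma haar_space: "haar_measure \<mu> \<Longrightarrow> space \<mu> = dual_group"
  by (auto simp: haar_measure_def dest!: sets_eq_imp_space_eq simp: space_restrict_space)

lemma haar_total: "haar_measure \<mu> \<Longrightarrow> emeasure \<mu> (space \<mu>) = 1"
  by (simp add: haar_space) (simp add: haar_measure_def)

lemma haar_finite: "haar_measure \<mu> \<Longrightarrow> finite_measure \<mu>"
  by (rule finite_measureI) (simp add: haar_total)

lemma measurable_into_haar:
  assumes "haar_measure \<mu>" "\<And>x. x \<in> space M \<Longrightarrow> f x \<in> dual_group"
    and "\<And>\<gamma>. (\<lambda>x. f x \<gamma>) \<in> borel_measurable M"
  shows "f \<in> measurable M \<mu>"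
proof -
  have "f \<in> measurable M (restrict_space borel dual_group)"
    by (rule measurable_restrict_space2) (use assms(2,3) in \<open>auto intro: measurable_coordinatewise_then_product\<close>)
  then show ?thesis using assms(1) by (simp add: haar_measure_def cong: measurable_cong_sets)
qed

lemma haar_coordinate_measurable:
  assumes "haar_measure \<mu>"
  shows "(\<lambda>\<omega>. \<omega> x) \<in> borel_measurable \<mu>"
proof -
  have "(\<lambda>\<omega>. \<omega> x) \<in> borel_measurable (restrict_space borel dual_group)"
    by (rule measurable_restrict_space1) measurable
  then show ?thesis using assms by (simp add: haar_measure_def cong: measurable_cong_sets)
qed

lemma haar_mult_measurable:
  assumes \<mu>: "haar_measure \<mu>" and \<nu>: "haar_measure \<nu>" and \<theta>: "haar_measure \<theta>"
  shows "(\<lambda>p. char_mult (fst p) (snd p)) \<in> measurable (\<mu> \<Otimes>\<^sub>M \<nu>) \<theta>"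
proof (rule measurable_into_haar[OF \<theta>])
  show "(\<lambda>p. char_mult (fst p) (snd p) \<gamma>) \<in> borel_measurable (\<mu> \<Otimes>\<^sub>M \<nu>)" for \<gamma>
    unfolding char_mult_def
    by (rule borel_measurable_times[OF
          measurable_compose[OF measurable_fst haar_coordinate_measurable[OF \<mu>]]
          measurable_compose[OF measurable_snd haar_coordinate_measurable[OF \<nu>]]])
qed (use haar_space[OF \<mu>] haar_space[OF \<nu>] in \<open>auto simp: space_pair_measure\<close>)

lemma haar_translate:
  assumes \<mu>: "haar_measure \<mu>" and \<kappa>: "\<kappa> \<in> dual_group" and f: "f \<in> borel_measurable \<mu>"
  shows "(\<integral>\<^sup>+\<omega>. f (char_mult \<kappa> \<omega>) \<partial>\<mu>) = (\<integral>\<^sup>+\<omega>. f \<omega> \<partial>\<mu>)"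
    and "char_mult \<kappa> \<in> measurable \<mu> \<mu>"
proof -
  have meas: "char_mult \<kappa>' \<in> measurable \<mu> \<mu>" if "\<kappa>' \<in> dual_group" for \<kappa>'
  proof (rule measurable_into_haar[OF \<mu>])
    show "(\<lambda>\<omega>. char_mult \<kappa>' \<omega> \<gamma>) \<in> borel_measurable \<mu>" for \<gamma>
      unfolding char_mult_def
      by (rule borel_measurable_times[OF borel_measurable_const haar_coordinate_measurable[OF \<mu>]])
  qed (use that haar_space[OF \<mu>] in simp)
  then show *: "char_mult \<kappa> \<in> measurable \<mu> \<mu>" using \<kappa> by blast
  have "distr \<mu> \<mu> (char_mult \<kappa>) = \<mu>"
  proof (rule measure_eqI)
    fix A assume "A \<in> sets (distr \<mu> \<mu> (char_mult \<kappa>))"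
    then have A: "A \<in> sets \<mu>" by simp
    then have AG: "A \<subseteq> dual_group" using sets.sets_into_space haar_space[OF \<mu>] by blast
    have "char_mult \<kappa> -` A \<inter> space \<mu> = char_mult (char_inv \<kappa>) ` A"
    proof safe
      fix \<omega> assume "char_mult \<kappa> \<omega> \<in> A"
      then show "\<omega> \<in> char_mult (char_inv \<kappa>) ` A" using \<kappa> by (intro image_eqI[of _ _ "char_mult \<kappa> \<omega>"]) auto
    qed (use \<kappa> AG haar_space[OF \<mu>] in auto)
    then show "emeasure (distr \<mu> \<mu> (char_mult \<kappa>)) A = emeasure \<mu> A"
      using \<mu> A \<kappa> by (simp add: emeasure_distr[OF *] haar_measure_def)
  qed simp
  then show "(\<integral>\<^sup>+\<omega>. f (char_mult \<kappa> \<omega>) \<partial>\<mu>) = (\<integral>\<^sup>+\<omega>. f \<omega> \<partial>\<mu>)"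
    using nn_integral_distr[OF *, of f] f by simp
qed

text \<open>Uniqueness: averaging a function over all products with respect to both measures, in either
  order, returns its integral against each of them.\<close>

lemma haar_unique:
  assumes \<mu>: "haar_measure \<mu>" and \<nu>: "haar_measure \<nu>" and f: "f \<in> borel_measurable \<mu>"
  shows "(\<integral>\<^sup>+\<omega>. f \<omega> \<partial>\<mu>) = (\<integral>\<^sup>+\<omega>. f \<omega> \<partial>\<nu>)"
proof -
  interpret \<mu>: finite_measure \<mu> by (rule haar_finite[OF \<mu>])
  interpret \<nu>: finite_measure \<nu> by (rule haar_finite[OF \<nu>])
  interpret pair_sigma_finite \<mu> \<nu> ..
  have f': "f \<in> borel_measurable \<nu>" using f \<mu> \<nu> by (simp add: haar_measure_def cong: measurable_cong_sets)
  have "(\<lambda>p. f (char_mult (fst p) (snd p))) \<in> borel_measurable (\<mu> \<Otimes>\<^sub>M \<nu>)"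
    by (rule measurable_compose[OF haar_mult_measurable[OF \<mu> \<nu> \<mu>] f])
  then have "(\<integral>\<^sup>+\<eta>. (\<integral>\<^sup>+\<omega>. f (char_mult \<omega> \<eta>) \<partial>\<mu>) \<partial>\<nu>) = (\<integral>\<^sup>+\<omega>. (\<integral>\<^sup>+\<eta>. f (char_mult \<omega> \<eta>) \<partial>\<nu>) \<partial>\<mu>)"
    using Fubini[of "\<lambda>p. f (char_mult (fst p) (snd p))"] by simp
  moreover have "(\<integral>\<^sup>+\<eta>. (\<integral>\<^sup>+\<omega>. f (char_mult \<omega> \<eta>) \<partial>\<mu>) \<partial>\<nu>) = (\<integral>\<^sup>+\<eta>. (\<integral>\<^sup>+\<omega>. f \<omega> \<partial>\<mu>) \<partial>\<nu>)"
  proof (rule nn_integral_cong)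
    fix \<eta> assume "\<eta> \<in> space \<nu>"
    then have "\<eta> \<in> dual_group" by (simp add: haar_space[OF \<nu>])
    then show "(\<integral>\<^sup>+\<omega>. f (char_mult \<omega> \<eta>) \<partial>\<mu>) = (\<integral>\<^sup>+\<omega>. f \<omega> \<partial>\<mu>)"
      using haar_translate(1)[OF \<mu> _ f, of \<eta>] by (simp add: char_mult_commute[of _ \<eta>])
  qed
  moreover have "(\<integral>\<^sup>+\<omega>. (\<integral>\<^sup>+\<eta>. f (char_mult \<omega> \<eta>) \<partial>\<nu>) \<partial>\<mu>) = (\<integral>\<^sup>+\<omega>. (\<integral>\<^sup>+\<eta>. f \<eta> \<partial>\<nu>) \<partial>\<mu>)"
    by (rule nn_integral_cong) (use haar_translate(1)[OF \<nu> _ f'] haar_space[OF \<mu>] in auto)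
  ultimately show ?thesis
    by (simp add: haar_total \<mu> \<nu>)
qed

text \<open>The cross-section makes \<open>\<alpha>\<^sup>*\<close> surjective, and describes its fibres as translates of the kernel
  by a point that varies measurably.\<close>

locale dual_system =
  fixes \<alpha> :: "'g::{ab_group_add,countable} \<Rightarrow> 'g"
    and \<mu> :: "'g character measure"
    and c :: "'g character \<Rightarrow> 'g character"
  assumes additive: "\<alpha> (x + y) = \<alpha> x + \<alpha> y"
    and index: "image_index \<alpha> > 0"
    and haar: "haar_measure \<mu>"
    and c_measurable: "c \<in> measurable \<mu> \<mu>"
    and c_section: "\<omega> \<in> dual_group \<Longrightarrow> dual_endo \<alpha> (c \<omega>) = \<omega>"
begin

abbreviation "N \<equiv> image_index \<alpha>"

lemma alpha_zero: "\<alpha> 0 = 0"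
  using additive[of 0 0] by simp

lemma alpha_neg: "\<alpha> (- x) = - \<alpha> x"
  using additive[of x "- x"] by (simp add: alpha_zero minus_unique)

sublocale finite_measure \<mu>
  by (rule haar_finite[OF haar])

lemma space_mu [simp]: "space \<mu> = dual_group"
  by (rule haar_space[OF haar])

lemma sets_mu: "sets \<mu> = sets (restrict_space borel dual_group)"
  using haar by (simp add: haar_measure_def)

lemmas coordinate [measurable] = haar_coordinate_measurable[OF haar]

lemma c_closed [simp]: "\<omega> \<in> dual_group \<Longrightarrow> c \<omega> \<in> dual_group"
  using measurable_space[OF c_measurable] by simp

lemma dual_endo_closed [simp]: "\<omega> \<in> dual_group \<Longrightarrow> dual_endo \<alpha> \<omega> \<in> dual_group"
  by (auto simp: dual_group_def dual_endo_def additive)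

lemma dual_endo_measurable: "dual_endo \<alpha> \<in> measurable \<mu> \<mu>"
proof (rule measurable_into_haar[OF haar])
  show "(\<lambda>\<omega>. dual_endo \<alpha> \<omega> \<gamma>) \<in> borel_measurable \<mu>" for \<gamma>
    unfolding dual_endo_def by (rule coordinate)
qed simp

sublocale quot: finite_index_subgroup "range \<alpha>"
proof
  show "additive_subgroup (range \<alpha>)"
    unfolding additive_subgroup_def
  proof (intro conjI ballI)
    show "0 \<in> range \<alpha>" using alpha_zero by (metis rangeI)
    show "x - y \<in> range \<alpha>" if xy: "x \<in> range \<alpha>" "y \<in> range \<alpha>" for x y
    proof -
      obtain a b where "x = \<alpha> a" "y = \<alpha> b" using xy by blast
      then have "x - y = \<alpha> (a + (- b))" by (simp add: additive alpha_neg del: add_uminus_conv_diff)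
      then show ?thesis by blast
    qed
  qed
  show "finite (UNIV // {(x, y). x - y \<in> range \<alpha>})"
    using index unfolding image_index_def by (rule card_ge_0_finite)
qed

lemma dual_ker_annihilator: "dual_ker \<alpha> = quot.annihilator"
  by (auto simp: dual_ker_def quot.annihilator_def dual_endo_def fun_eq_iff)

lemma finite_ker [simp]: "finite (dual_ker \<alpha>)"
  by (simp add: dual_ker_annihilator quot.finite_annihilator)

lemma card_ker: "card (dual_ker \<alpha>) = N"
  by (simp add: dual_ker_annihilator quot.card_annihilator image_index_def)

lemma ker_dual: "\<kappa> \<in> dual_ker \<alpha> \<Longrightarrow> \<kappa> \<in> dual_group"
  by (simp add: dual_ker_def)

lemma dual_endo_ker_mult: "\<kappa> \<in> dual_ker \<alpha> \<Longrightarrow> dual_endo \<alpha> (char_mult \<kappa> \<omega>) = dual_endo \<alpha> \<omega>"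
  by (simp add: dual_endo_mult) (simp add: dual_ker_def char_mult_def)

lemma fiber_eq:
  assumes "\<eta> \<in> dual_group"
  shows "dual_fiber \<alpha> (dual_endo \<alpha> \<eta>) = (\<lambda>\<kappa>. char_mult \<kappa> \<eta>) ` dual_ker \<alpha>"
proof (intro equalityI subsetI)
  fix \<zeta> assume \<zeta>: "\<zeta> \<in> dual_fiber \<alpha> (dual_endo \<alpha> \<eta>)"
  then have \<zeta>': "\<zeta> \<in> dual_group" "dual_endo \<alpha> \<zeta> = dual_endo \<alpha> \<eta>" by (auto simp: dual_fiber_def)
  have "char_mult \<zeta> (char_inv \<eta>) \<in> dual_ker \<alpha>"
    using \<zeta>' assms dual_groupD(3)[OF dual_endo_closed[OF assms]]
    by (simp add: dual_ker_def dual_endo_mult dual_endo_inv) (simp add: char_mult_def char_inv_def)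
  moreover have "\<zeta> = char_mult (char_mult \<zeta> (char_inv \<eta>)) \<eta>"
    using dual_groupD(3)[OF assms] by (simp add: char_mult_def char_inv_def fun_eq_iff mult.assoc)
  ultimately show "\<zeta> \<in> (\<lambda>\<kappa>. char_mult \<kappa> \<eta>) ` dual_ker \<alpha>" by blast
next
  fix \<zeta> assume "\<zeta> \<in> (\<lambda>\<kappa>. char_mult \<kappa> \<eta>) ` dual_ker \<alpha>"
  then show "\<zeta> \<in> dual_fiber \<alpha> (dual_endo \<alpha> \<eta>)"
    using assms by (auto simp: dual_fiber_def ker_dual dual_endo_ker_mult)
qed

lemma fiber_eq_section: "\<omega> \<in> dual_group \<Longrightarrow> dual_fiber \<alpha> \<omega> = (\<lambda>\<kappa>. char_mult \<kappa> (c \<omega>)) ` dual_ker \<alpha>"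
  using fiber_eq[of "c \<omega>"] c_section by simp

lemma inj_char_mult: "\<eta> \<in> dual_group \<Longrightarrow> inj_on (\<lambda>\<kappa>. char_mult \<kappa> \<eta>) A"
  by (rule inj_onI) (metis char_mult_commute char_mult_inv(2))

lemma finite_fiber [simp]: "\<omega> \<in> dual_group \<Longrightarrow> finite (dual_fiber \<alpha> \<omega>)"
  by (simp add: fiber_eq_section)

lemma sum_fiber:
  assumes "\<eta> \<in> dual_group"
  shows "(\<Sum>\<zeta>\<in>dual_fiber \<alpha> (dual_endo \<alpha> \<eta>). F \<zeta>) = (\<Sum>\<kappa>\<in>dual_ker \<alpha>. F (char_mult \<kappa> \<eta>))"
  unfolding fiber_eq[OF assms] by (subst sum.reindex) (auto simp: inj_char_mult assms)

lemma sum_fiber_section: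
  "\<omega> \<in> dual_group \<Longrightarrow> (\<Sum>\<zeta>\<in>dual_fiber \<alpha> \<omega>. F \<zeta>) = (\<Sum>\<kappa>\<in>dual_ker \<alpha>. F (char_mult \<kappa> (c \<omega>)))"
  using sum_fiber[of "c \<omega>" F] c_section by simp

lemma fiberD: "\<zeta> \<in> dual_fiber \<alpha> \<omega> \<Longrightarrow> \<zeta> \<in> dual_group" "\<zeta> \<in> dual_fiber \<alpha> \<omega> \<Longrightarrow> dual_endo \<alpha> \<zeta> = \<omega>"
  by (auto simp: dual_fiber_def)

lemma translate_measurable: "\<kappa> \<in> dual_group \<Longrightarrow> char_mult \<kappa> \<in> measurable \<mu> \<mu>"
  by (rule haar_translate(2)[OF haar, where f="\<lambda>_. 0"]) auto

lemma sum_fiber_measurable: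
  fixes F :: "'g character \<Rightarrow> 'b::{second_countable_topology, topological_comm_monoid_add}"
  assumes F: "F \<in> borel_measurable \<mu>"
  shows "(\<lambda>\<omega>. \<Sum>\<zeta>\<in>dual_fiber \<alpha> \<omega>. F \<zeta>) \<in> borel_measurable \<mu>"
proof (subst measurable_cong[where g="\<lambda>\<omega>. \<Sum>\<kappa>\<in>dual_ker \<alpha>. F (char_mult \<kappa> (c \<omega>))"])
  have "(\<lambda>\<omega>. F (char_mult \<kappa> (c \<omega>))) \<in> borel_measurable \<mu>" if "\<kappa> \<in> dual_ker \<alpha>" for \<kappa>
    by (intro measurable_compose[OF c_measurable] measurable_compose[OF translate_measurable F] ker_dual that)
  then show "(\<lambda>\<omega>. \<Sum>\<kappa>\<in>dual_ker \<alpha>. F (char_mult \<kappa> (c \<omega>))) \<in> borel_measurable \<mu>"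
    by (rule borel_measurable_sum)
qed (simp add: sum_fiber_section)

text \<open>A translation on the target lifts along the surjective homomorphism \<open>\<alpha>\<^sup>*\<close> to a translation on the
  source, where \<open>\<mu>\<close> is invariant. By uniqueness of Haar measure, \<open>\<alpha>\<^sup>*\<close> then preserves \<open>\<mu>\<close>.\<close>

lemma haar_image: "haar_measure (distr \<mu> \<mu> (dual_endo \<alpha>))"
  unfolding haar_measure_def
proof (intro conjI ballI)
  have "dual_endo \<alpha> -` dual_group \<inter> dual_group = dual_group" by auto
  then show "emeasure (distr \<mu> \<mu> (dual_endo \<alpha>)) dual_group = 1"
    using sets.top[of \<mu>] haar_total[OF haar] by (simp add: emeasure_distr[OF dual_endo_measurable])
  fix \<omega> :: "'g character" and A
  assume \<omega>: "\<omega> \<in> dual_group" and "A \<in> sets (distr \<mu> \<mu> (dual_endo \<alpha>))"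
  then have A: "A \<in> sets \<mu>" by simp
  then have AG: "A \<subseteq> dual_group" using sets.sets_into_space by fastforce
  have img: "char_mult \<eta> ` B = char_mult (char_inv \<eta>) -` B \<inter> dual_group"
    if "\<eta> \<in> dual_group" "B \<subseteq> dual_group" for \<eta> B
  proof safe
    fix x assume "char_mult (char_inv \<eta>) x \<in> B"
    then show "x \<in> char_mult \<eta> ` B"
      using that by (intro image_eqI[of _ _ "char_mult (char_inv \<eta>) x"]) auto
  qed (use that in auto)
  have meas: "char_mult \<eta> ` B \<in> sets \<mu>" if "\<eta> \<in> dual_group" "B \<in> sets \<mu>" for \<eta> B
  proof -
    have "B \<subseteq> dual_group" using sets.sets_into_space[OF that(2)] by simp
    then show ?thesis
      using img[OF that(1)] measurable_sets[OF translate_measurable[OF char_inv_closed[OF that(1)]] that(2)] by simp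
  qed
  have pre: "dual_endo \<alpha> -` A \<inter> dual_group \<in> sets \<mu>"
    using measurable_sets[OF dual_endo_measurable A] by simp
  have "dual_endo \<alpha> -` (char_mult \<omega> ` A) \<inter> dual_group = char_mult (c \<omega>) ` (dual_endo \<alpha> -` A \<inter> dual_group)"
    using \<omega> AG by (subst (1 2) img) (auto simp: dual_endo_mult dual_endo_inv c_section)
  then show "emeasure (distr \<mu> \<mu> (dual_endo \<alpha>)) (char_mult \<omega> ` A) = emeasure (distr \<mu> \<mu> (dual_endo \<alpha>)) A"
    using haar \<omega> A pre meas[OF \<omega> A] by (simp add: emeasure_distr[OF dual_endo_measurable] haar_measure_def)
qed (simp add: sets_mu)

lemma nn_integral_dual_endo:
  assumes F: "F \<in> borel_measurable \<mu>"
  shows "(\<integral>\<^sup>+\<omega>. F (dual_endo \<alpha> \<omega>) \<partial>\<mu>) = (\<integral>\<^sup>+\<omega>. F \<omega> \<partial>\<mu>)"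
  using haar_unique[OF haar haar_image F] nn_integral_distr[OF dual_endo_measurable, of F] F by simp

text \<open>Integrating the sum over the fibres: pulled back along \<open>\<alpha>\<^sup>*\<close>, it is a sum of \<open>N\<close> translates.\<close>

lemma nn_integral_sum_fiber:
  assumes F: "F \<in> borel_measurable \<mu>"
  shows "(\<integral>\<^sup>+\<omega>. (\<Sum>\<zeta>\<in>dual_fiber \<alpha> \<omega>. F \<zeta>) \<partial>\<mu>) = of_nat N * (\<integral>\<^sup>+\<omega>. F \<omega> \<partial>\<mu>)"
proof -
  have "(\<integral>\<^sup>+\<omega>. (\<Sum>\<zeta>\<in>dual_fiber \<alpha> \<omega>. F \<zeta>) \<partial>\<mu>) = (\<integral>\<^sup>+\<eta>. (\<Sum>\<zeta>\<in>dual_fiber \<alpha> (dual_endo \<alpha> \<eta>). F \<zeta>) \<partial>\<mu>)"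
    by (rule nn_integral_dual_endo[symmetric]) (rule sum_fiber_measurable[OF F])
  also have "\<dots> = (\<integral>\<^sup>+\<eta>. (\<Sum>\<kappa>\<in>dual_ker \<alpha>. F (char_mult \<kappa> \<eta>)) \<partial>\<mu>)"
    by (rule nn_integral_cong) (simp add: sum_fiber)
  also have "\<dots> = (\<Sum>\<kappa>\<in>dual_ker \<alpha>. \<integral>\<^sup>+\<eta>. F (char_mult \<kappa> \<eta>) \<partial>\<mu>)"
    by (rule nn_integral_sum) (intro measurable_compose[OF translate_measurable F] ker_dual)
  also have "\<dots> = (\<Sum>\<kappa>\<in>dual_ker \<alpha>. \<integral>\<^sup>+\<eta>. F \<eta> \<partial>\<mu>)"
    by (intro sum.cong refl haar_translate(1)[OF haar _ F] ker_dual)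
  finally show ?thesis by (simp add: card_ker)
qed

text \<open>A null set meets almost no fibre: its indicator function has fibre sums of integral zero.\<close>

lemma AE_fiber:
  assumes "AE \<eta> in \<mu>. P \<eta>"
  shows "AE \<omega> in \<mu>. \<forall>\<zeta>\<in>dual_fiber \<alpha> \<omega>. P \<zeta>"
proof -
  obtain Z where Z: "{\<eta> \<in> space \<mu>. \<not> P \<eta>} \<subseteq> Z" "emeasure \<mu> Z = 0" "Z \<in> sets \<mu>"
    using assms by (rule AE_E)
  have ind: "indicator Z \<in> borel_measurable \<mu>" using Z(3) by simp
  have "(\<integral>\<^sup>+\<omega>. (\<Sum>\<zeta>\<in>dual_fiber \<alpha> \<omega>. indicator Z \<zeta> :: ennreal) \<partial>\<mu>) = 0"
    unfolding nn_integral_sum_fiber[OF ind] using Z by simp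
  then have "AE \<omega> in \<mu>. (\<Sum>\<zeta>\<in>dual_fiber \<alpha> \<omega>. indicator Z \<zeta> :: ennreal) = 0"
    by (subst (asm) nn_integral_0_iff_AE) (rule sum_fiber_measurable[OF ind])
  then show ?thesis using AE_space
  proof eventually_elim
    case (elim \<omega>)
    then have "\<zeta> \<notin> Z" if "\<zeta> \<in> dual_fiber \<alpha> \<omega>" for \<zeta>
      using that by (auto simp: indicator_def split: if_splits)
    then show ?case using Z(1) fiberD(1) by auto
  qed
qed

text \<open>Preimages of null sets under \<open>\<alpha>\<^sup>*\<close> are null sets, since \<open>\<alpha>\<^sup>*\<close> preserves Haar measure.\<close>

lemma AE_dual_endo:
  assumes "AE \<omega> in \<mu>. P \<omega>"
  shows "AE \<eta> in \<mu>. P (dual_endo \<alpha> \<eta>)"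
proof -
  obtain Z where Z: "{\<eta> \<in> space \<mu>. \<not> P \<eta>} \<subseteq> Z" "emeasure \<mu> Z = 0" "Z \<in> sets \<mu>"
    using assms by (rule AE_E)
  have ind: "indicator Z \<in> borel_measurable \<mu>" using Z(3) by simp
  have "(\<integral>\<^sup>+\<eta>. (indicator Z (dual_endo \<alpha> \<eta>) :: ennreal) \<partial>\<mu>) = 0"
    unfolding nn_integral_dual_endo[OF ind] using Z by simp
  then have "AE \<eta> in \<mu>. (indicator Z (dual_endo \<alpha> \<eta>) :: ennreal) = 0"
    by (subst (asm) nn_integral_0_iff_AE) (rule measurable_compose[OF dual_endo_measurable ind])
  then show ?thesis using AE_space
  proof eventually_elim
    case (elim \<eta>)
    then have "dual_endo \<alpha> \<eta> \<notin> Z" "dual_endo \<alpha> \<eta> \<in> space \<mu>"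
      by (auto simp: indicator_def split: if_splits)
    then show ?case using Z(1) by blast
  qed
qed

end

section \<open>Families of square-integrable functions\<close>

lemma summable_on_iff_nn_integral:
  fixes a :: "'i \<Rightarrow> real"
  assumes "\<And>i. i \<in> I \<Longrightarrow> 0 \<le> a i"
  shows "a summable_on I \<longleftrightarrow> (\<integral>\<^sup>+i. ennreal (a i) \<partial>count_space I) < \<infinity>"
    and "a summable_on I \<Longrightarrow> ennreal (infsum a I) = (\<integral>\<^sup>+i. ennreal (a i) \<partial>count_space I)"
proof -
  have "a summable_on I \<longleftrightarrow> integrable (count_space I) a"
    using abs_summable_equivalent[of a I] summable_on_iff_abs_summable_on_real[of a I]
    by (simp add: abs_summable_on_def)
  also have "\<dots> \<longleftrightarrow> (\<integral>\<^sup>+i. ennreal (norm (a i)) \<partial>count_space I) < \<infinity>"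
    by (simp add: integrable_iff_bounded)
  also have "(\<integral>\<^sup>+i. ennreal (norm (a i)) \<partial>count_space I) = (\<integral>\<^sup>+i. ennreal (a i) \<partial>count_space I)"
    by (rule nn_integral_cong) (use assms in simp)
  finally show "a summable_on I \<longleftrightarrow> (\<integral>\<^sup>+i. ennreal (a i) \<partial>count_space I) < \<infinity>" .
  show "ennreal (infsum a I) = (\<integral>\<^sup>+i. ennreal (a i) \<partial>count_space I)" if "a summable_on I"
  proof -
    have "Infinite_Set_Sum.abs_summable_on a I"
      using that abs_summable_equivalent[of a I] summable_on_iff_abs_summable_on_real[of a I] by simp
    then show ?thesis
      using nn_integral_conv_infsetsum[of a I] infsetsum_infsum[of a I] assms by simp
  qed
qed

lemma nn_integral_count_space_Times:
  assumes "finite B"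
  shows "(\<integral>\<^sup>+p. f p \<partial>count_space (A \<times> B)) = (\<integral>\<^sup>+a. (\<Sum>b\<in>B. f (a, b)) \<partial>count_space A)"
proof -
  have "(\<integral>\<^sup>+p. f p \<partial>count_space (A \<times> B)) = (\<integral>\<^sup>+p. f p * indicator (A \<times> B) p \<partial>count_space UNIV)"
    by (rule nn_integral_count_space_indicator) simp
  also have "\<dots> = (\<integral>\<^sup>+a. \<integral>\<^sup>+b. f (a, b) * indicator (A \<times> B) (a, b) \<partial>count_space UNIV \<partial>count_space UNIV)"
    by (rule nn_integral_fst_count_space[symmetric])
  also have "\<dots> = (\<integral>\<^sup>+a. (\<integral>\<^sup>+b. f (a, b) \<partial>count_space B) * indicator A a \<partial>count_space UNIV)"
    by (rule nn_integral_cong)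
      (subst nn_integral_count_space_indicator, auto simp: indicator_def intro!: nn_integral_cong)
  also have "\<dots> = (\<integral>\<^sup>+a. (\<integral>\<^sup>+b. f (a, b) \<partial>count_space B) \<partial>count_space A)"
    by (rule nn_integral_count_space_indicator[symmetric]) simp
  finally show ?thesis using assms by (simp add: nn_integral_count_space_finite)
qed

definition fam_class :: "('i, 'x) mfam \<Rightarrow> ('i \<Rightarrow> 'x \<Rightarrow> complex) \<Rightarrow> 'i \<Rightarrow> ('x \<Rightarrow> complex) set" where
  "fam_class K f = (\<lambda>i\<in>fst K. l2_class (snd K i) (f i))"

definition fam_fun :: "('i, 'x) mfam \<Rightarrow> ('i \<Rightarrow> ('x \<Rightarrow> complex) set) \<Rightarrow> 'i \<Rightarrow> 'x \<Rightarrow> complex" where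
  "fam_fun K F i = l2_fun (snd K i) (F i)"

definition fam_measurable :: "('i, 'x) mfam \<Rightarrow> ('i \<Rightarrow> 'x \<Rightarrow> complex) \<Rightarrow> bool" where
  "fam_measurable K f \<longleftrightarrow> (\<forall>i\<in>fst K. f i \<in> borel_measurable (snd K i))"

definition fam_energy :: "('i, 'x) mfam \<Rightarrow> ('i \<Rightarrow> 'x \<Rightarrow> complex) \<Rightarrow> ennreal" where
  "fam_energy K f = (\<integral>\<^sup>+i. (\<integral>\<^sup>+x. ennreal ((cmod (f i x))\<^sup>2) \<partial>snd K i) \<partial>count_space (fst K))"

lemma hilbert_family_L2: "hilbert_family (fst K) (\<lambda>i. L2 (snd K i))"
  by (rule hilbert_family.intro) (rule complex_inner_space_L2)

lemma hilbert_space_L2_sum: "hilbert_space (L2_sum K)"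
  unfolding L2_sum_def by (rule hilbert_family.hilbert_space_hsum[OF hilbert_family_L2 hilbert_space_L2])

lemma complex_inner_space_L2_sum: "complex_inner_space (L2_sum K)"
  using hilbert_space_L2_sum by (rule hilbert_space.axioms)

text \<open>The squared norm is computed in the extended nonnegative reals, where sums and integrals exist
  and commute unconditionally; finiteness of the result expresses membership.\<close>

lemma fam_class_norm:
  assumes f: "fam_measurable K f"
  shows fam_class_closed_iff: "fam_class K f \<in> hcarrier (L2_sum K) \<longleftrightarrow> fam_energy K f < \<infinity>"
    and fam_class_energy: "fam_class K f \<in> hcarrier (L2_sum K)
      \<Longrightarrow> ennreal ((hnorm (L2_sum K) (fam_class K f))\<^sup>2) = fam_energy K f"
proof -
  interpret hilbert_family "fst K" "\<lambda>i. L2 (snd K i)" by (rule hilbert_family_L2)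
  let ?a = "\<lambda>i. (hnorm (L2 (snd K i)) (fam_class K f i))\<^sup>2"
  have part: "fam_energy K f = (\<integral>\<^sup>+i. ennreal (?a i) \<partial>count_space (fst K))"
    if "\<And>i. i \<in> fst K \<Longrightarrow> square_integrable (snd K i) (f i)"
    unfolding fam_energy_def by (rule nn_integral_cong) (simp add: fam_class_def L2_norm_nn that)
  have comp: "fam_class K f i \<in> hcarrier (L2 (snd K i)) \<longleftrightarrow> square_integrable (snd K i) (f i)"
    if "i \<in> fst K" for i
    using that f l2_class_in_L2[of "snd K i" "f i"] l2_class_in_L2D[of "snd K i" "f i"]
    by (auto simp: fam_class_def fam_measurable_def)
  have iff: "fam_class K f \<in> hcarrier (L2_sum K) \<longleftrightarrow>
      (\<forall>i\<in>fst K. square_integrable (snd K i) (f i)) \<and> ?a summable_on fst K"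
    unfolding L2_sum_def hsum_carrier_iff using comp by (auto simp: fam_class_def)
  have "square_integrable (snd K i) (f i)" if fin: "fam_energy K f < \<infinity>" and i: "i \<in> fst K" for i
  proof -
    have "(\<integral>\<^sup>+j. (\<integral>\<^sup>+x. ennreal ((cmod (f j x))\<^sup>2) \<partial>snd K j) * indicator {i} j \<partial>count_space (fst K)) \<le> fam_energy K f"
      unfolding fam_energy_def by (rule nn_integral_mono) (auto simp: indicator_def)
    moreover have "(\<integral>\<^sup>+j. (\<integral>\<^sup>+x. ennreal ((cmod (f j x))\<^sup>2) \<partial>snd K j) * indicator {i} j \<partial>count_space (fst K))
        = (\<integral>\<^sup>+x. ennreal ((cmod (f i x))\<^sup>2) \<partial>snd K i)"
      using i by (subst nn_integral_indicator_singleton) auto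
    ultimately show ?thesis
      using fin i f by (subst square_integrable_iff) (auto simp: fam_measurable_def intro: le_less_trans)
  qed
  then show closed: "fam_class K f \<in> hcarrier (L2_sum K) \<longleftrightarrow> fam_energy K f < \<infinity>"
    unfolding iff using part summable_on_iff_nn_integral(1)[of "fst K" ?a] by auto
  assume c: "fam_class K f \<in> hcarrier (L2_sum K)"
  then have "?a summable_on fst K" using iff by blast
  then show "ennreal ((hnorm (L2_sum K) (fam_class K f))\<^sup>2) = fam_energy K f"
    using part c iff summable_on_iff_nn_integral(2)[of "fst K" ?a] norm_sq_hsum[of "fam_class K f"]
    unfolding L2_sum_def by simp
qed

lemma L2_sum_carrierD:
  assumes "F \<in> hcarrier (L2_sum K)"
  shows "fam_measurable K (fam_fun K F)" and "fam_class K (fam_fun K F) = F"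
proof -
  interpret hilbert_family "fst K" "\<lambda>i. L2 (snd K i)" by (rule hilbert_family_L2)
  have F: "F \<in> hcarrier S" using assms by (simp add: L2_sum_def)
  note Fi = l2_fun_square_integrable[OF carrierD(1)[OF F]]
  show "fam_measurable K (fam_fun K F)"
    using Fi(1) by (simp add: fam_measurable_def fam_fun_def)
  show "fam_class K (fam_fun K F) = F"
    by (rule extensionalityI[of _ "fst K"]) (auto simp: fam_class_def fam_fun_def Fi(2) carrierD(3)[OF F])
qed

lemma L2_sum_cases:
  assumes "F \<in> hcarrier (L2_sum K)"
  obtains f where "fam_measurable K f" "F = fam_class K f" "fam_energy K f < \<infinity>"
  using L2_sum_carrierD[OF assms] assms that[of "fam_fun K F"] fam_class_closed_iff by metis

lemma fam_class_eqI:
  "(\<And>i. i \<in> fst K \<Longrightarrow> AE x in snd K i. f i x = g i x) \<Longrightarrow> fam_class K f = fam_class K g"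
  unfolding fam_class_def by (rule restrict_ext) (rule l2_class_eqI)

lemma fam_fun_class_AE:
  "\<lbrakk>fam_measurable K f; i \<in> fst K\<rbrakk> \<Longrightarrow> AE x in snd K i. fam_fun K (fam_class K f) i x = f i x"
  using l2_fun_class_AE[of "f i" "snd K i"] by (simp add: fam_fun_def fam_class_def fam_measurable_def)

lemma fam_class_add:
  assumes "fam_measurable K f" "fam_measurable K g"
  shows "hadd (L2_sum K) (fam_class K f) (fam_class K g) = fam_class K (\<lambda>i x. f i x + g i x)"
  using assms
  by (auto simp: L2_sum_def hsum_def fam_class_def fam_measurable_def L2_add intro!: restrict_ext)

lemma fam_class_scale:
  assumes "fam_measurable K f"
  shows "hscale (L2_sum K) a (fam_class K f) = fam_class K (\<lambda>i x. a * f i x)"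
  using assms
  by (auto simp: L2_sum_def hsum_def fam_class_def fam_measurable_def L2_scale intro!: restrict_ext)

lemma L2_sum_zero: "hzero (L2_sum K) = fam_class K (\<lambda>_ _. 0)"
  by (simp add: L2_sum_def hsum_def fam_class_def L2_zero)

lemma fam_measurable_add:
  "\<lbrakk>fam_measurable K f; fam_measurable K g\<rbrakk> \<Longrightarrow> fam_measurable K (\<lambda>i x. f i x + g i x)"
  unfolding fam_measurable_def by (intro ballI borel_measurable_add) auto

lemma fam_measurable_scale: "fam_measurable K f \<Longrightarrow> fam_measurable K (\<lambda>i x. a * f i x)"
  unfolding fam_measurable_def by (intro ballI borel_measurable_times borel_measurable_const) auto

text \<open>Since the norm of a class is the energy of any representative, isometry and linearity need only be
  checked on representing functions, where no null sets intervene.\<close>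

lemma unitary_op_fam_classI:
  assumes on_class: "\<And>f. fam_measurable K f \<Longrightarrow> U (fam_class K f) = fam_class L (u f)"
    and meas: "\<And>f. fam_measurable K f \<Longrightarrow> fam_measurable L (u f)"
    and add: "\<And>f g. u (\<lambda>i x. f i x + g i x) = (\<lambda>i x. u f i x + u g i x)"
    and scale: "\<And>a f. u (\<lambda>i x. a * f i x) = (\<lambda>i x. a * u f i x)"
    and energy: "\<And>f. fam_measurable K f \<Longrightarrow> fam_energy L (u f) = fam_energy K f"
    and surj: "\<And>g. fam_measurable L g \<Longrightarrow> \<exists>f. fam_measurable K f \<and> fam_class L (u f) = fam_class L g"
  shows "unitary_op (L2_sum K) (L2_sum L) U"
proof (rule unitary_opI[OF complex_inner_space_L2_sum complex_inner_space_L2_sum])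
  interpret K: complex_inner_space "L2_sum K" by (rule complex_inner_space_L2_sum)
  interpret L: complex_inner_space "L2_sum L" by (rule complex_inner_space_L2_sum)
  have closed: "U (fam_class K f) \<in> hcarrier (L2_sum L)"
    if "fam_measurable K f" "fam_energy K f < \<infinity>" for f
    using that by (simp add: on_class fam_class_closed_iff meas energy)
  show "linear_op (L2_sum K) (L2_sum L) U"
    unfolding linear_op_def
  proof (intro conjI ballI allI)
    fix F assume "F \<in> hcarrier (L2_sum K)"
    then obtain f where f: "fam_measurable K f" "F = fam_class K f" "fam_energy K f < \<infinity>" by (rule L2_sum_cases)
    show "U F \<in> hcarrier (L2_sum L)" unfolding f(2) by (rule closed[OF f(1,3)])
    show "U (hscale (L2_sum K) a F) = hscale (L2_sum L) a (U F)" for a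
      using f by (simp add: fam_class_scale on_class fam_measurable_scale meas scale)
    fix G assume "G \<in> hcarrier (L2_sum K)"
    then obtain g where g: "fam_measurable K g" "G = fam_class K g" by (rule L2_sum_cases)
    show "U (hadd (L2_sum K) F G) = hadd (L2_sum L) (U F) (U G)"
      using f g by (simp add: fam_class_add on_class fam_measurable_add meas add)
  qed
  show "hnorm (L2_sum L) (U F) = hnorm (L2_sum K) F" if F: "F \<in> hcarrier (L2_sum K)" for F
  proof -
    obtain f where f: "fam_measurable K f" "F = fam_class K f" "fam_energy K f < \<infinity>"
      using F by (rule L2_sum_cases)
    have "ennreal ((hnorm (L2_sum L) (U F))\<^sup>2) = ennreal ((hnorm (L2_sum K) F)\<^sup>2)"
      using closed[OF f(1,3)] F f fam_class_energy[OF f(1)] fam_class_energy[OF meas[OF f(1)]]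
      by (simp add: on_class energy)
    moreover have "U F \<in> hcarrier (L2_sum L)" using closed[OF f(1,3)] f(2) by simp
    ultimately show ?thesis using F by (simp add: power2_eq_iff_nonneg)
  qed
  show "\<exists>F\<in>hcarrier (L2_sum K). U F = G" if G: "G \<in> hcarrier (L2_sum L)" for G
  proof -
    obtain g where g: "fam_measurable L g" "G = fam_class L g" "fam_energy L g < \<infinity>"
      using G by (rule L2_sum_cases)
    obtain f where f: "fam_measurable K f" "fam_class L (u f) = fam_class L g"
      using surj[OF g(1)] by blast
    have "fam_class L (u f) \<in> hcarrier (L2_sum L)" using G f(2) g(2) by simp
    then have "fam_energy K f < \<infinity>"
      using fam_class_closed_iff[OF meas[OF f(1)]] energy[OF f(1)] by simp
    then show ?thesis
      using f g(2) by (intro bexI[of _ "fam_class K f"]) (simp_all add: on_class fam_class_closed_iff)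
  qed
qed

section \<open>Families of measures on the dual group\<close>

text \<open>The measures that occur live on Borel subsets of the dual group and carry the Borel structure
  restricted to their space; this class of families is stable under dilation.\<close>

definition dual_fam :: "('i, 'g::{ab_group_add,countable} character) mfam \<Rightarrow> bool" where
  "dual_fam K \<longleftrightarrow> countable (fst K) \<and> (\<forall>i\<in>fst K.
    sets (snd K i) = sets (restrict_space borel (space (snd K i))) \<and>
    space (snd K i) \<in> sets borel \<and> space (snd K i) \<subseteq> dual_group \<and> finite_measure (snd K i))"

lemma dual_famD:
  assumes "dual_fam K"
  shows "countable (fst K)"
    and "i \<in> fst K \<Longrightarrow> sets (snd K i) = sets (restrict_space borel (space (snd K i)))"
    and "i \<in> fst K \<Longrightarrow> space (snd K i) \<in> sets borel"
    and "i \<in> fst K \<Longrightarrow> space (snd K i) \<subseteq> dual_group"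
    and "i \<in> fst K \<Longrightarrow> finite_measure (snd K i)"
  using assms by (auto simp: dual_fam_def)

lemma dual_fam_coordinate_measurable:
  assumes "dual_fam K" "i \<in> fst K"
  shows "(\<lambda>\<omega>. \<omega> \<gamma>) \<in> borel_measurable (snd K i)"
proof -
  have "(\<lambda>\<omega>. \<omega> \<gamma>) \<in> borel_measurable (restrict_space borel (space (snd K i)))"
    by (rule measurable_restrict_space1) (rule coordinate_measurable)
  then show ?thesis using dual_famD(2)[OF assms] by (simp cong: measurable_cong_sets)
qed

lemma mult_rep_class:
  assumes "fam_measurable K f"
  shows "mult_rep K \<gamma> (fam_class K f) = fam_class K (\<lambda>i \<omega>. \<omega> \<gamma> * f i \<omega>)"
proof -
  have "mult_rep K \<gamma> (fam_class K f) = fam_class K (\<lambda>i \<omega>. \<omega> \<gamma> * fam_fun K (fam_class K f) i \<omega>)"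
    by (simp add: mult_rep_def fam_class_def fam_fun_def cong: restrict_cong)
  also have "\<dots> = fam_class K (\<lambda>i \<omega>. \<omega> \<gamma> * f i \<omega>)"
  proof (rule fam_class_eqI)
    fix i assume "i \<in> fst K"
    from fam_fun_class_AE[OF assms this]
    show "AE \<omega> in snd K i. \<omega> \<gamma> * fam_fun K (fam_class K f) i \<omega> = \<omega> \<gamma> * f i \<omega>"
      by eventually_elim simp
  qed
  finally show ?thesis .
qed

lemma mult_rep_measurable:
  "\<lbrakk>dual_fam K; fam_measurable K f\<rbrakk> \<Longrightarrow> fam_measurable K (\<lambda>i \<omega>. \<omega> \<gamma> * f i \<omega>)"
  unfolding fam_measurable_def
  by (intro ballI borel_measurable_times) (auto intro: dual_fam_coordinate_measurable)

lemma mult_rep_add: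
  assumes K: "dual_fam K" and F: "F \<in> hcarrier (L2_sum K)"
  shows "mult_rep K (\<gamma> + \<gamma>') F = mult_rep K \<gamma> (mult_rep K \<gamma>' F)" "mult_rep K 0 F = F"
proof -
  obtain f where f: "fam_measurable K f" "F = fam_class K f"
    using F by (rule L2_sum_cases)
  have d: "\<omega> \<in> dual_group" if "i \<in> fst K" "\<omega> \<in> space (snd K i)" for i \<omega>
    using dual_famD(4)[OF K] that by blast
  show "mult_rep K (\<gamma> + \<gamma>') F = mult_rep K \<gamma> (mult_rep K \<gamma>' F)"
    unfolding f(2) mult_rep_class[OF f(1)] mult_rep_class[OF mult_rep_measurable[OF K f(1)]]
    by (rule fam_class_eqI, rule AE_I2) (simp add: dual_groupD(2)[OF d])
  show "mult_rep K 0 F = F"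
    unfolding f(2) mult_rep_class[OF f(1)]
    by (rule fam_class_eqI, rule AE_I2) (simp add: dual_groupD(4)[OF d])
qed

lemma mult_rep_unitary:
  assumes K: "dual_fam K"
  shows "unitary_rep (L2_sum K) (mult_rep K)"
  unfolding unitary_rep_def
proof (intro conjI allI ballI)
  have d: "\<omega> \<in> dual_group" if "i \<in> fst K" "\<omega> \<in> space (snd K i)" for i \<omega>
    using dual_famD(4)[OF K] that by blast
  show "unitary_op (L2_sum K) (L2_sum K) (mult_rep K \<gamma>)" for \<gamma>
  proof (rule unitary_op_fam_classI[where u="\<lambda>f i \<omega>. \<omega> \<gamma> * f i \<omega>"])
    show "fam_energy K (\<lambda>i \<omega>. \<omega> \<gamma> * f i \<omega>) = fam_energy K f" for f
      unfolding fam_energy_def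
      by (intro nn_integral_cong) (simp add: norm_mult dual_groupD(1)[OF d])
    show "\<exists>f. fam_measurable K f \<and> fam_class K (\<lambda>i \<omega>. \<omega> \<gamma> * f i \<omega>) = fam_class K g"
      if g: "fam_measurable K g" for g
    proof (intro exI conjI)
      show "fam_measurable K (\<lambda>i \<omega>. \<omega> (- \<gamma>) * g i \<omega>)" by (rule mult_rep_measurable[OF K g])
      have "\<omega> \<gamma> * (\<omega> (- \<gamma>) * g i \<omega>) = g i \<omega>" if "i \<in> fst K" "\<omega> \<in> space (snd K i)" for i \<omega>
        using dual_groupD(2)[OF d[OF that], of \<gamma> "- \<gamma>"] dual_groupD(4)[OF d[OF that]]
        by (simp add: mult.assoc[symmetric])
      then show "fam_class K (\<lambda>i \<omega>. \<omega> \<gamma> * (\<omega> (- \<gamma>) * g i \<omega>)) = fam_class K g"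
        by (intro fam_class_eqI AE_I2)
    qed
  qed (simp_all add: mult_rep_class mult_rep_measurable[OF K] distrib_left mult.left_commute)
qed (use mult_rep_add[OF K] in auto)

text \<open>Otherwise one of the four functions \<open>\<plusminus>Re f\<close>, \<open>\<plusminus>Im f\<close> would be positive on a set of positive
  measure, and its integral over that set would be positive.\<close>

lemma AE_zero_if_borel_integrals_zero:
  fixes f :: "'x::topological_space \<Rightarrow> complex"
  assumes sets: "sets M = sets (restrict_space borel (space M))"
    and f: "integrable M f"
    and zero: "\<And>A. A \<in> sets borel \<Longrightarrow> (\<integral>x. indicator A x *\<^sub>R f x \<partial>M) = 0"
  shows "AE x in M. f x = 0"
proof -
  have pos: "AE x in M. Re (u * f x) \<le> 0" for u
  proof -
    let ?A = "{x \<in> space M. 0 < Re (u * f x)}"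
    have [measurable]: "f \<in> borel_measurable M" using f by simp
    have "?A \<in> sets M" by measurable
    then obtain B where B: "B \<in> sets borel" "?A = space M \<inter> B"
      unfolding sets by (auto simp: sets_restrict_space)
    have "(\<integral>x. indicator ?A x * Re (u * f x) \<partial>M) = Re (\<integral>x. u * (indicator B x *\<^sub>R f x) \<partial>M)"
    proof -
      have "space M \<inter> B \<in> sets M" using \<open>?A \<in> sets M\<close> unfolding B(2) .
      then have "integrable M (\<lambda>x. indicator (space M \<inter> B) x *\<^sub>R f x)"
        using f by (rule integrable_mult_indicator)
      then have "integrable M (\<lambda>x. indicator B x *\<^sub>R f x)"
        by (rule Bochner_Integration.integrable_cong[THEN iffD1, rotated -1]) (auto simp: indicator_def)
      then have "integrable M (\<lambda>x. u * (indicator B x *\<^sub>R f x))"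
        by (intro integrable_mult_right)
      then have "Re (\<integral>x. u * (indicator B x *\<^sub>R f x) \<partial>M) = (\<integral>x. Re (u * (indicator B x *\<^sub>R f x)) \<partial>M)"
        by (rule integral_Re[symmetric])
      also have "\<dots> = (\<integral>x. indicator ?A x * Re (u * f x) \<partial>M)"
      proof (rule Bochner_Integration.integral_cong)
        fix x assume "x \<in> space M"
        then have "indicator ?A x = (indicator B x :: real)" unfolding B(2) by (simp add: indicator_def)
        then show "Re (u * (indicator B x *\<^sub>R f x)) = indicator ?A x * Re (u * f x)"
          by (simp only:) (simp add: indicator_def)
      qed simp
      finally show ?thesis by simp
    qed
    also have "\<dots> = 0" by (simp only: integral_mult_right_zero zero[OF B(1)]) simp
    finally have "(\<integral>x. indicator ?A x * Re (u * f x) \<partial>M) = 0" .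
    moreover have "integrable M (\<lambda>x. indicator ?A x * Re (u * f x))"
      using integrable_mult_indicator[OF \<open>?A \<in> sets M\<close>, of "\<lambda>x. Re (u * f x)"] f by simp
    ultimately have "AE x in M. indicator ?A x * Re (u * f x) = 0"
      by (subst (asm) integral_nonneg_eq_0_iff_AE) (auto simp: indicator_def)
    then show ?thesis using AE_space
      by eventually_elim (auto simp: indicator_def split: if_splits)
  qed
  from pos[of 1] pos[of "-1"] pos[of \<i>] pos[of "-\<i>"] show ?thesis
    by eventually_elim (auto simp: complex_eq_iff)
qed

text \<open>The indicator functions of a countable basis of open sets closed under intersection are total: a
  function orthogonal to them has vanishing integrals over a Dynkin system that contains the basis,
  hence over all Borel sets.\<close>

lemma countable_total_L2:
  fixes M :: "'x::second_countable_topology measure"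
  assumes sets: "sets M = sets (restrict_space borel (space M))" and fin: "finite_measure M"
  shows "\<exists>S. countable_total (L2 M) S"
proof -
  interpret finite_measure M by fact
  obtain B :: "'x set set" where B: "countable B" "topological_basis B"
    using ex_countable_basis by auto
  define \<B> where "\<B> = Inter ` {F. finite F \<and> F \<subseteq> B}"
  have "countable \<B>" unfolding \<B>_def by (intro countable_image countable_Collect_finite_subset B)
  have "B \<subseteq> \<B>" unfolding \<B>_def by (auto intro!: image_eqI[of _ _ "{b}" for b])
  moreover have "open b" if "b \<in> \<B>" for b
    using that B(2) by (auto simp: \<B>_def topological_basis_def intro!: open_Inter)
  ultimately have basis: "topological_basis \<B>"
    using B(2) unfolding topological_basis_def by (meson subset_trans)
  have UNIV: "UNIV \<in> \<B>" unfolding \<B>_def by (rule image_eqI[of _ _ "{}"]) auto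
  have "\<B> \<subseteq> Pow UNIV" by simp
  have "Int_stable \<B>"
    unfolding Int_stable_def \<B>_def
  proof safe
    fix F G assume "finite F" "F \<subseteq> B" "finite G" "G \<subseteq> B"
    then show "\<Inter>F \<inter> \<Inter>G \<in> Inter ` {F. finite F \<and> F \<subseteq> B}"
      by (intro image_eqI[of _ _ "F \<union> G"]) auto
  qed
  have borel: "sets borel = sigma_sets UNIV \<B>"
    unfolding borel_eq_countable_basis[OF \<open>countable \<B>\<close> basis] by (rule sets_measure_of) simp
  have inM: "A \<inter> space M \<in> sets M" if "A \<in> sets borel" for A
    unfolding sets using that by (auto simp: sets_restrict_space)
  have ind: "square_integrable M (indicator A)" if "A \<in> sets borel" for A
  proof -
    have "indicator (A \<inter> space M) \<in> borel_measurable M" using inM[OF that] by simp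
    then have [measurable]: "(indicator A :: _ \<Rightarrow> complex) \<in> borel_measurable M"
      by (rule measurable_cong[THEN iffD1, rotated]) (auto simp: indicator_def)
    have "(\<integral>\<^sup>+x. ennreal ((cmod (indicator A x))\<^sup>2) \<partial>M) \<le> (\<integral>\<^sup>+x. 1 \<partial>M)"
      by (rule nn_integral_mono) (auto simp: indicator_def)
    also have "\<dots> < \<infinity>" using emeasure_finite[of "space M"] by (simp add: less_top[symmetric])
    finally show ?thesis by (simp add: square_integrable_iff)
  qed
  have "countable_total (L2 M) ((\<lambda>A. l2_class M (indicator A)) ` \<B>)"
    unfolding countable_total_def
  proof (intro conjI ballI impI)
    show "(\<lambda>A. l2_class M (indicator A)) ` \<B> \<subseteq> hcarrier (L2 M)"
      using ind borel by (auto intro!: l2_class_in_L2)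
    show "countable ((\<lambda>A. l2_class M (indicator A)) ` \<B>)" using \<open>countable \<B>\<close> by simp
    fix F assume "F \<in> hcarrier (L2 M)"
      and orth: "\<forall>s\<in>(\<lambda>A. l2_class M (indicator A)) ` \<B>. hinner (L2 M) F s = 0"
    then obtain f where f: "square_integrable M f" "F = l2_class M f" by (auto simp: L2_carrier_iff)
    have fint: "integrable M f"
      using square_integrable_mult[OF f(1) ind[OF sets.top]] by simp
    have set_int: "(\<integral>x. f x * cnj (indicator A x) \<partial>M) = (\<integral>x. indicator A x *\<^sub>R f x \<partial>M)" for A
      by (rule Bochner_Integration.integral_cong) (auto simp: indicator_def)
    have zero: "(\<integral>x. indicator A x *\<^sub>R f x \<partial>M) = 0" if "A \<in> sets borel" for A
    proof -
      have "A \<in> sigma_sets UNIV \<B>" using that borel by simp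
      from \<open>Int_stable \<B>\<close> \<open>\<B> \<subseteq> Pow UNIV\<close> this show ?thesis
      proof (induction rule: sigma_sets_induct_disjoint)
        case (basic A)
        then have "hinner (L2 M) F (l2_class M (indicator A)) = 0" using orth by blast
        moreover have "A \<in> sets borel" using basic borel by auto
        ultimately show ?case using f ind[of A] by (simp add: L2_inner set_int)
      next
        case empty
        show ?case by simp
      next
        case (compl A)
        have "integrable M (\<lambda>x. f x * cnj (indicator A x))"
          by (rule square_integrable_mult[OF f(1) ind]) (use compl borel in simp)
        then have int: "integrable M (\<lambda>x. indicator A x *\<^sub>R f x)"
          by (rule Bochner_Integration.integrable_cong[THEN iffD1, rotated -1]) (auto simp: indicator_def)
        have "(\<integral>x. f x \<partial>M) = 0"
          using orth UNIV f ind[OF sets.top] by (auto simp: L2_inner dest!: bspec[of _ _ "l2_class M (indicator UNIV)"])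
        moreover have "(\<integral>x. indicator (UNIV - A) x *\<^sub>R f x \<partial>M) = (\<integral>x. f x - indicator A x *\<^sub>R f x \<partial>M)"
          by (rule Bochner_Integration.integral_cong) (auto simp: indicator_def)
        ultimately show ?case using compl int fint by simp
      next
        case (union A)
        have A: "A i \<inter> space M \<in> sets M" for i using union(2) borel by (intro inM) auto
        have eq: "(\<integral>x. indicator (C \<inter> space M) x *\<^sub>R f x \<partial>M) = (\<integral>x. indicator C x *\<^sub>R f x \<partial>M)" for C
          by (rule Bochner_Integration.integral_cong) (auto simp: indicator_def)
        have "(LINT x:(\<Union>i. A i \<inter> space M)|M. f x) = (\<Sum>i. (LINT x:(A i \<inter> space M)|M. f x))"
        proof (rule lebesgue_integral_countable_add[OF A])
          show "(A i \<inter> space M) \<inter> (A j \<inter> space M) = {}" if "i \<noteq> j" for i j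
            using union(1) that by (auto simp: disjoint_family_on_def)
          show "set_integrable M (\<Union>i. A i \<inter> space M) f"
            unfolding set_integrable_def 
            by (rule integrable_mult_indicator[OF sets.countable_UN fint]) (use A in blast)
        qed
        moreover have "(\<Union>i. A i \<inter> space M) = (\<Union>i. A i) \<inter> space M" by blast
        ultimately show ?case using union(3) by (simp add: set_lebesgue_integral_def eq)
      qed
    qed
    have "AE x in M. f x = 0" by (rule AE_zero_if_borel_integrals_zero[OF sets fint zero])
    then show "F = hzero (L2 M)" unfolding f(2) L2_zero by (rule l2_class_eqI)
  qed
  then show ?thesis by blast
qed

lemma countable_total_L2_sum:
  assumes K: "dual_fam K"
  shows "\<exists>S. countable_total (L2_sum K) S"
proof -
  have "\<forall>i\<in>fst K. \<exists>S. countable_total (L2 (snd K i)) S"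
    using countable_total_L2 dual_famD(2,5)[OF K] by blast
  then obtain S where "\<And>i. i \<in> fst K \<Longrightarrow> countable_total (L2 (snd K i)) (S i)" by metis
  then show ?thesis
    unfolding L2_sum_def
    by (intro countable_total_hsum dual_famD(1)[OF K] complex_inner_space_L2)
qed

section \<open>Square matrices with orthogonal rows\<close>

context
  fixes R :: "'r set" and P :: "'p set" and u :: "'r \<Rightarrow> 'p \<Rightarrow> complex" and N :: nat
  assumes R: "finite R" and P: "finite P"
    and rows: "\<And>r r'. \<lbrakk>r \<in> R; r' \<in> R\<rbrakk>
      \<Longrightarrow> (\<Sum>p\<in>P. u r p * cnj (u r' p)) = of_nat N * (if r = r' then 1 else 0)"
begin

lemma row_combination_norm:
  "(\<Sum>p\<in>P. (\<Sum>r\<in>R. a r * u r p) * cnj (\<Sum>r\<in>R. a r * u r p)) = of_nat N * (\<Sum>r\<in>R. a r * cnj (a r))"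
proof -
  have "(\<Sum>p\<in>P. (\<Sum>r\<in>R. a r * u r p) * cnj (\<Sum>r\<in>R. a r * u r p))
      = (\<Sum>p\<in>P. \<Sum>r\<in>R. \<Sum>r'\<in>R. a r * cnj (a r') * (u r p * cnj (u r' p)))"
    by (simp add: sum_product mult_ac)
  also have "\<dots> = (\<Sum>r\<in>R. \<Sum>p\<in>P. \<Sum>r'\<in>R. a r * cnj (a r') * (u r p * cnj (u r' p)))"
    by (rule sum.swap)
  also have "\<dots> = (\<Sum>r\<in>R. \<Sum>r'\<in>R. \<Sum>p\<in>P. a r * cnj (a r') * (u r p * cnj (u r' p)))"
    by (intro sum.cong refl sum.swap)
  also have "\<dots> = (\<Sum>r\<in>R. \<Sum>r'\<in>R. a r * cnj (a r') * (of_nat N * (if r = r' then 1 else 0)))"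
    by (intro sum.cong refl) (simp add: sum_distrib_left[symmetric] rows)
  also have "\<dots> = (\<Sum>r\<in>R. \<Sum>r'\<in>R. if r = r' then of_nat N * (a r * cnj (a r)) else 0)"
    by (intro sum.cong refl) auto
  also have "\<dots> = of_nat N * (\<Sum>r\<in>R. a r * cnj (a r))"
    using R by (simp add: sum_distrib_left)
  finally show ?thesis .
qed

lemma row_combination_norm_real:
  "(\<Sum>p\<in>P. (cmod (\<Sum>r\<in>R. a r * u r p))\<^sup>2) = real N * (\<Sum>r\<in>R. (cmod (a r))\<^sup>2)"
proof -
  have "complex_of_real (\<Sum>p\<in>P. (cmod (\<Sum>r\<in>R. a r * u r p))\<^sup>2) = complex_of_real (real N * (\<Sum>r\<in>R. (cmod (a r))\<^sup>2))"
    using row_combination_norm[of a]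
    by (simp add: complex_norm_square del: of_real_power cnj_sum)
  then show ?thesis by (simp only: of_real_eq_iff)
qed

text \<open>When the matrix is square, the columns are orthogonal as well.  The distance of \<open>N\<close> times a
  unit vector from its projection to the rows is \<open>N\<^sup>2 - N \<Sum>\<^sub>r |u r p|\<^sup>2\<close>; summed over \<open>p\<close> these
  nonnegative numbers give \<open>N\<^sup>2 |P| - N\<^sup>2 |R| = 0\<close>.\<close>

lemma columns_orthogonal:
  assumes card: "card R = card P" and pq: "p \<in> P" "q \<in> P"
  shows "(\<Sum>r\<in>R. cnj (u r p) * u r q) = of_nat N * (if p = q then 1 else 0)"
proof -
  define t where "t p q = (\<Sum>r\<in>R. cnj (u r p) * u r q)" for p q
  define e where "e p q = of_nat N * (if p = q then 1 else 0) - t p q" for p q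
  have cnj_t: "cnj (t p p) = t p p" for p by (simp add: t_def mult.commute)
  have err: "(\<Sum>q\<in>P. e p q * cnj (e p q)) = of_nat N * of_nat N - of_nat N * t p p" if p: "p \<in> P" for p
  proof -
    have "(\<Sum>q\<in>P. t p q * cnj (t p q)) = of_nat N * t p p"
      unfolding t_def using row_combination_norm[of "\<lambda>r. cnj (u r p)"] by (simp del: cnj_sum)
    moreover have "e p q * cnj (e p q) = t p q * cnj (t p q) +
        (if p = q then of_nat N * of_nat N - of_nat N * t p p - of_nat N * cnj (t p p) else 0)" for q
      by (simp add: e_def algebra_simps)
    ultimately show ?thesis using P p by (simp add: sum.distrib cnj_t)
  qed
  have "(\<Sum>p\<in>P. t p p) = (\<Sum>r\<in>R. \<Sum>p\<in>P. u r p * cnj (u r p))"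
    unfolding t_def by (subst sum.swap) (simp add: mult.commute)
  also have "\<dots> = of_nat (card R) * of_nat N"
    by (simp add: rows)
  finally have "(\<Sum>p\<in>P. \<Sum>q\<in>P. e p q * cnj (e p q)) = 0"
    by (simp add: err sum_subtractf sum_distrib_left[symmetric] card mult_ac)
  then have "complex_of_real (\<Sum>p\<in>P. \<Sum>q\<in>P. (cmod (e p q))\<^sup>2) = 0"
    by (simp add: complex_norm_square del: of_real_power)
  then have "(\<Sum>p\<in>P. \<Sum>q\<in>P. (cmod (e p q))\<^sup>2) = 0" by (simp only: of_real_eq_0_iff)
  then have "\<forall>p\<in>P. (\<Sum>q\<in>P. (cmod (e p q))\<^sup>2) = 0"
    by (subst (asm) sum_nonneg_eq_0_iff) (auto intro: sum_nonneg P)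
  then have "(\<Sum>q\<in>P. (cmod (e p q))\<^sup>2) = 0" using pq(1) by blast
  then have "\<forall>q\<in>P. (cmod (e p q))\<^sup>2 = 0"
    by (subst (asm) sum_nonneg_eq_0_iff) (auto intro: P)
  then have "e p q = 0" using pq(2) by simp
  then show ?thesis by (simp add: e_def t_def)
qed

text \<open>Exchanging the two sums leaves the inner products of the columns, which are orthogonal.\<close>

lemma row_expansion:
  assumes card: "card R = card P" and N: "N > 0" and p: "p \<in> P"
  shows "(\<Sum>r\<in>R. ((\<Sum>q\<in>P. F q * cnj (u r q)) / of_nat N) * u r p) = F p"
proof -
  have "(\<Sum>r\<in>R. ((\<Sum>q\<in>P. F q * cnj (u r q)) / of_nat N) * u r p)
      = (\<Sum>r\<in>R. \<Sum>q\<in>P. F q / of_nat N * (cnj (u r q) * u r p))"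
    by (intro sum.cong refl) (simp add: sum_distrib_left sum_divide_distrib mult_ac)
  also have "\<dots> = (\<Sum>q\<in>P. F q / of_nat N * (\<Sum>r\<in>R. cnj (u r q) * u r p))"
    by (subst sum.swap) (simp add: sum_distrib_left)
  also have "\<dots> = (\<Sum>q\<in>P. if q = p then F p else 0)"
    by (intro sum.cong refl) (use columns_orthogonal[OF card _ p] N in auto)
  finally show ?thesis using P p by simp
qed

end

section \<open>Spaces given by a multiplicity function\<close>

context dual_system
begin

lemma level_sets [measurable]: "r \<in> measurable \<mu> (count_space UNIV) \<Longrightarrow> level r i \<in> sets \<mu>"
proof -
  assume "r \<in> measurable \<mu> (count_space UNIV)"
  then have "r -` {i..} \<inter> space \<mu> \<in> sets \<mu>" by (rule measurable_sets) simp
  moreover have "r -` {i..} \<inter> space \<mu> = level r i" by (auto simp: level_def)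
  ultimately show ?thesis by simp
qed

lemma level_subset: "level r i \<subseteq> dual_group"
  by (auto simp: level_def)

lemma level_Int [simp]: "level r i \<inter> dual_group = level r i" "{\<omega> \<in> dual_group. \<omega> \<in> level r i} = level r i"
  using level_subset by auto

lemma fst_level_fam [simp]: "fst (level_fam \<mu> r) = {1..}"
  by (simp add: level_fam_def)

lemma snd_level_fam [simp]: "snd (level_fam \<mu> r) i = restrict_space \<mu> (level r i)"
  by (simp add: level_fam_def)

lemma space_restrict_level [simp]: "space (restrict_space \<mu> (level r i)) = level r i"
  by (auto simp: space_restrict_space level_def)

lemma sets_restrict_mu:
  assumes "S \<subseteq> dual_group"
  shows "sets (restrict_space \<mu> S) = sets (restrict_space borel S)"
proof -
  have "sets (restrict_space \<mu> S) = sets (restrict_space (restrict_space borel dual_group) S)"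
    by (rule sets_restrict_space_cong) (rule sets_mu)
  also have "\<dots> = sets (restrict_space borel S)"
    using assms by (auto simp: sets_restrict_space image_image Int_absorb1 Int_assoc[symmetric] intro!: image_cong)
  finally show ?thesis .
qed

lemma dual_fam_level:
  assumes r: "r \<in> measurable \<mu> (count_space UNIV)"
  shows "dual_fam (level_fam \<mu> r)"
  unfolding dual_fam_def
proof (intro conjI ballI)
  fix i :: nat
  have "level r i \<in> sets (restrict_space borel dual_group)" using level_sets[OF r] sets_mu by simp
  then show "space (snd (level_fam \<mu> r) i) \<in> sets borel"
    using sets_restrict_space_iff[of dual_group borel "level r i"] dual_group_borel by simp
  show sub: "space (snd (level_fam \<mu> r) i) \<subseteq> dual_group" by (simp add: level_subset)
  show "finite_measure (snd (level_fam \<mu> r) i)"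
    using finite_measure_restrict_space[OF finite_measure_axioms] level_sets[OF r] by simp
  show "sets (snd (level_fam \<mu> r) i) = sets (restrict_space borel (space (snd (level_fam \<mu> r) i)))"
    using sets_restrict_mu[OF level_subset] by simp
qed simp

lemma AE_level:
  assumes r: "r \<in> measurable \<mu> (count_space UNIV)"
  shows "(AE \<omega> in restrict_space \<mu> (level r i). Q \<omega>) \<longleftrightarrow> (AE \<omega> in \<mu>. \<omega> \<in> level r i \<longrightarrow> Q \<omega>)"
  by (rule AE_restrict_space_iff) (use level_sets[OF r] in simp)

text \<open>Representing functions may be taken to be defined and measurable on the whole dual group.\<close>

lemma level_L2_cases:
  assumes r: "r \<in> measurable \<mu> (count_space UNIV)" and F: "F \<in> hcarrier (L2_sum (level_fam \<mu> r))"
  obtains f where "\<And>i. f i \<in> borel_measurable \<mu>" "F = fam_class (level_fam \<mu> r) f"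
proof -
  define f where "f i = (if i \<ge> 1 then fam_fun (level_fam \<mu> r) F i else (\<lambda>_. 0))" for i :: nat
  have "f i \<in> borel_measurable \<mu>" for i
  proof (cases "i \<ge> 1")
    case True
    then have "fam_fun (level_fam \<mu> r) F i \<in> borel_measurable (restrict_space \<mu> (level r i))"
      using L2_sum_carrierD(1)[OF F] by (simp add: fam_measurable_def)
    then have "(\<lambda>\<omega>. if \<omega> \<in> level r i then fam_fun (level_fam \<mu> r) F i \<omega> else 0) \<in> borel_measurable \<mu>"
      using level_sets[OF r, of i] by (subst measurable_If_restrict_space_iff) auto
    also have "(\<lambda>\<omega>. if \<omega> \<in> level r i then fam_fun (level_fam \<mu> r) F i \<omega> else 0) = f i"
      using True by (auto simp: f_def fam_fun_def l2_fun_zero_off)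
    finally show ?thesis .
  qed (simp add: f_def)
  moreover have "F = fam_class (level_fam \<mu> r) f"
    using L2_sum_carrierD(2)[OF F] by (simp add: fam_class_def f_def cong: restrict_cong)
  ultimately show ?thesis by (rule that)
qed

lemma fam_measurable_level:
  "(\<And>i. f i \<in> borel_measurable \<mu>) \<Longrightarrow> fam_measurable (level_fam \<mu> r) f"
  by (auto simp: fam_measurable_def intro: measurable_restrict_space1)

lemma level_energy:
  assumes r: "r \<in> measurable \<mu> (count_space UNIV)" and f: "\<And>i. f i \<in> borel_measurable \<mu>"
  shows "fam_energy (level_fam \<mu> r) f = (\<integral>\<^sup>+\<omega>. (\<Sum>i\<in>{1..r \<omega>}. ennreal ((cmod (f i \<omega>))\<^sup>2)) \<partial>\<mu>)"
proof -
  have [measurable]: "f i \<in> borel_measurable \<mu>" "level r i \<in> sets \<mu>" for i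
    using f level_sets[OF r] by auto
  have "fam_energy (level_fam \<mu> r) f
      = (\<integral>\<^sup>+i. (\<integral>\<^sup>+\<omega>. ennreal ((cmod (f i \<omega>))\<^sup>2) * indicator (level r i) \<omega> \<partial>\<mu>) \<partial>count_space {1..})"
    unfolding fam_energy_def fst_level_fam snd_level_fam
    by (intro nn_integral_cong) (simp add: nn_integral_restrict_space)
  also have "\<dots> = (\<integral>\<^sup>+\<omega>. (\<integral>\<^sup>+i. ennreal ((cmod (f i \<omega>))\<^sup>2) * indicator (level r i) \<omega> \<partial>count_space {1..}) \<partial>\<mu>)"
    by (rule nn_integral_count_space_nn_integral[symmetric]) simp_all
  also have "\<dots> = (\<integral>\<^sup>+\<omega>. (\<Sum>i\<in>{1..r \<omega>}. ennreal ((cmod (f i \<omega>))\<^sup>2)) \<partial>\<mu>)"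
  proof (rule nn_integral_cong)
    fix \<omega> assume \<omega>: "\<omega> \<in> space \<mu>"
    have "(\<integral>\<^sup>+i. ennreal ((cmod (f i \<omega>))\<^sup>2) * indicator (level r i) \<omega> \<partial>count_space {1..})
        = (\<Sum>i\<in>{1..r \<omega>}. ennreal ((cmod (f i \<omega>))\<^sup>2) * indicator (level r i) \<omega>)"
      by (rule nn_integral_count_space') (auto simp: level_def indicator_def split: if_splits)
    also have "\<dots> = (\<Sum>i\<in>{1..r \<omega>}. ennreal ((cmod (f i \<omega>))\<^sup>2))"
      by (rule sum.cong) (use \<omega> in \<open>auto simp: level_def\<close>)
    finally show "(\<integral>\<^sup>+i. ennreal ((cmod (f i \<omega>))\<^sup>2) * indicator (level r i) \<omega> \<partial>count_space {1..})
        = (\<Sum>i\<in>{1..r \<omega>}. ennreal ((cmod (f i \<omega>))\<^sup>2))" .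
  qed
  finally show ?thesis .
qed

lemma level_sum_measurable:
  fixes f :: "nat \<Rightarrow> 'g character \<Rightarrow> 'b::{second_countable_topology, topological_comm_monoid_add}"
  assumes r: "r \<in> measurable \<mu> (count_space UNIV)" and f: "\<And>i. i \<ge> 1 \<Longrightarrow> f i \<in> borel_measurable \<mu>"
  shows "(\<lambda>\<omega>. \<Sum>i\<in>{1..r \<omega>}. f i \<omega>) \<in> borel_measurable \<mu>"
  by (rule measurable_compose_countable[OF _ r]) (auto intro!: borel_measurable_sum f)

text \<open>Changing a representative on a null set changes its pullback along \<open>\<alpha>\<^sup>*\<close> on a null set only.  The
  sum over \<open>i\<close> stops at \<open>r(\<alpha>\<^sup>*\<eta>)\<close>, because the components above that level vanish there.\<close>

lemma ruelle_class:
  assumes r: "r \<in> measurable \<mu> (count_space UNIV)" and m: "m \<in> measurable \<mu> (count_space UNIV)"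
    and f: "\<And>i. f i \<in> borel_measurable \<mu>"
  shows "ruelle \<mu> \<alpha> r m A (fam_class (level_fam \<mu> r) f) =
    fam_class (level_fam \<mu> m) (\<lambda>j \<eta>. \<Sum>i\<in>{1..r (dual_endo \<alpha> \<eta>)}. A i j \<eta> * f i (dual_endo \<alpha> \<eta>))"
proof -
  let ?F = "fam_class (level_fam \<mu> r) f"
  let ?l = "\<lambda>i. l2_fun (restrict_space \<mu> (level r i)) (?F i)"
  have "AE \<omega> in \<mu>. \<forall>i. i \<ge> 1 \<longrightarrow> \<omega> \<in> level r i \<longrightarrow> ?l i \<omega> = f i \<omega>"
    unfolding AE_all_countable
  proof (intro allI)
    fix i
    show "AE \<omega> in \<mu>. i \<ge> 1 \<longrightarrow> \<omega> \<in> level r i \<longrightarrow> ?l i \<omega> = f i \<omega>"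
    proof (cases "i \<ge> 1")
      case True
      then have "AE \<omega> in restrict_space \<mu> (level r i). ?l i \<omega> = f i \<omega>"
        using fam_fun_class_AE[OF fam_measurable_level[of f r, OF f], of i]
        unfolding fam_fun_def snd_level_fam fst_level_fam by simp
      then show ?thesis by (simp add: AE_level[OF r])
    qed simp
  qed
  then have "AE \<eta> in \<mu>. \<forall>i. i \<ge> 1 \<longrightarrow> dual_endo \<alpha> \<eta> \<in> level r i \<longrightarrow> ?l i (dual_endo \<alpha> \<eta>) = f i (dual_endo \<alpha> \<eta>)"
    by (rule AE_dual_endo)
  then have ae: "AE \<eta> in \<mu>. (\<Sum>\<^sub>\<infinity>i\<in>{1..}. A i j \<eta> * ?l i (dual_endo \<alpha> \<eta>))
      = (\<Sum>i\<in>{1..r (dual_endo \<alpha> \<eta>)}. A i j \<eta> * f i (dual_endo \<alpha> \<eta>))" for j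
    using AE_space
  proof eventually_elim
    case (elim \<eta>)
    then have d: "dual_endo \<alpha> \<eta> \<in> dual_group" by simp
    have "(\<Sum>\<^sub>\<infinity>i\<in>{1..}. A i j \<eta> * ?l i (dual_endo \<alpha> \<eta>))
        = (\<Sum>\<^sub>\<infinity>i\<in>{1..r (dual_endo \<alpha> \<eta>)}. A i j \<eta> * ?l i (dual_endo \<alpha> \<eta>))"
    proof (rule infsum_cong_neutral)
      fix i assume "i \<in> {1..} - {1..r (dual_endo \<alpha> \<eta>)}"
      then have "dual_endo \<alpha> \<eta> \<notin> level r i" by (auto simp: level_def)
      then show "A i j \<eta> * ?l i (dual_endo \<alpha> \<eta>) = 0" by (simp add: l2_fun_zero_off)
    qed auto
    also have "\<dots> = (\<Sum>i\<in>{1..r (dual_endo \<alpha> \<eta>)}. A i j \<eta> * f i (dual_endo \<alpha> \<eta>))"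
      using elim(1) d by (simp add: level_def)
    finally show ?case .
  qed
  have "ruelle \<mu> \<alpha> r m A ?F =
      fam_class (level_fam \<mu> m) (\<lambda>j \<eta>. \<Sum>\<^sub>\<infinity>i\<in>{1..}. A i j \<eta> * ?l i (dual_endo \<alpha> \<eta>))"
    by (simp add: ruelle_def fam_class_def)
  also have "\<dots> = fam_class (level_fam \<mu> m) (\<lambda>j \<eta>. \<Sum>i\<in>{1..r (dual_endo \<alpha> \<eta>)}. A i j \<eta> * f i (dual_endo \<alpha> \<eta>))"
  proof (rule fam_class_eqI)
    fix j
    show "AE \<eta> in snd (level_fam \<mu> m) j. (\<Sum>\<^sub>\<infinity>i\<in>{1..}. A i j \<eta> * ?l i (dual_endo \<alpha> \<eta>))
        = (\<Sum>i\<in>{1..r (dual_endo \<alpha> \<eta>)}. A i j \<eta> * f i (dual_endo \<alpha> \<eta>))"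
      unfolding snd_level_fam AE_level[OF m] using ae[of j] by eventually_elim (rule impI)
  qed
  finally show ?thesis .
qed

end

section \<open>A filter and its complement fold into one unitary\<close>

locale filter_system = dual_system \<alpha> \<mu> c
  for \<alpha> :: "'g::{ab_group_add,countable} \<Rightarrow> 'g" and \<mu> c +
  fixes m :: "'g character \<Rightarrow> nat" and H G :: "'g fmatrix"
  assumes m_measurable: "m \<in> measurable \<mu> (count_space UNIV)"
    and consistent: "consistency_inequality \<mu> \<alpha> m"
    and filter: "filter_matrix \<mu> \<alpha> m H"
    and complementary: "complementary_filter \<mu> \<alpha> m H G"
begin

abbreviation "m' \<equiv> co_mult \<alpha> m"

lemma co_mult_measurable: "m' \<in> measurable \<mu> (count_space UNIV)"
proof -
  have mb: "m \<in> borel_measurable \<mu>"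
    using m_measurable by (rule measurable_compose) simp
  have "(\<lambda>\<omega>. \<Sum>\<zeta>\<in>dual_fiber \<alpha> \<omega>. m \<zeta>) \<in> borel_measurable \<mu>"
    by (rule sum_fiber_measurable[OF mb])
  then have "(\<lambda>\<omega>. \<Sum>\<zeta>\<in>dual_fiber \<alpha> \<omega>. m \<zeta>) \<in> measurable \<mu> (count_space UNIV)"
    by (rule measurable_compose) (auto simp: measurable_def intro!: borel_open open_discrete)
  then show ?thesis
    using m_measurable unfolding co_mult_def[abs_def] by measurable
qed

text \<open>Over a point \<open>\<omega>\<close>, the rows are indexed by the filter rows \<open>i \<le> m \<omega>\<close> and the complementary
  rows \<open>k \<le> m' \<omega>\<close>, the columns by the pairs of a point of the fibre and a level of it.\<close>

definition rows :: "'g character \<Rightarrow> (nat + nat) set" where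
  "rows \<omega> = {1..m \<omega>} <+> {1..m' \<omega>}"

definition columns :: "'g character \<Rightarrow> ('g character \<times> nat) set" where
  "columns \<omega> = (SIGMA \<zeta>:dual_fiber \<alpha> \<omega>. {1..m \<zeta>})"

definition entry :: "nat + nat \<Rightarrow> 'g character \<times> nat \<Rightarrow> complex" where
  "entry r p = (case r of Inl i \<Rightarrow> H i (snd p) (fst p) | Inr k \<Rightarrow> G k (snd p) (fst p))"

text \<open>The points over which the consistency inequality, the support conditions and the countably many
  filter equations all hold literally.\<close>

definition regular :: "'g character \<Rightarrow> bool" where
  "regular \<omega> \<longleftrightarrow> \<omega> \<in> dual_group \<and> m \<omega> \<le> (\<Sum>\<zeta>\<in>dual_fiber \<alpha> \<omega>. m \<zeta>) \<and>
    (\<forall>\<zeta>\<in>dual_fiber \<alpha> \<omega>. \<forall>i\<ge>1. \<forall>j\<ge>1. \<zeta> \<notin> level m j \<longrightarrow> H i j \<zeta> = 0 \<and> G i j \<zeta> = 0) \<and>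
    (\<forall>i\<ge>1. \<forall>i'\<ge>1.
      filter_product \<alpha> H H i i' \<omega> = of_nat N * (if i = i' then 1 else 0) * indicator (level m i) \<omega> \<and>
      filter_product \<alpha> G G i i' \<omega> = of_nat N * (if i = i' then 1 else 0) * indicator (level m' i) \<omega> \<and>
      filter_product \<alpha> G H i i' \<omega> = 0)"

lemma AE_regular: "AE \<omega> in \<mu>. regular \<omega>"
proof -
  have supp: "AE \<zeta> in \<mu>. \<forall>i j. i \<ge> 1 \<longrightarrow> j \<ge> 1 \<longrightarrow> \<zeta> \<notin> level m j \<longrightarrow> H i j \<zeta> = 0 \<and> G i j \<zeta> = 0"
    unfolding AE_all_countable
  proof (intro allI)
    fix i j :: nat
    show "AE \<zeta> in \<mu>. i \<ge> 1 \<longrightarrow> j \<ge> 1 \<longrightarrow> \<zeta> \<notin> level m j \<longrightarrow> H i j \<zeta> = 0 \<and> G i j \<zeta> = 0"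
    proof (cases "i \<ge> 1 \<and> j \<ge> 1")
      case True
      then have "AE \<zeta> in \<mu>. \<zeta> \<notin> level m j \<longrightarrow> H i j \<zeta> = 0" "AE \<zeta> in \<mu>. \<zeta> \<notin> level m j \<longrightarrow> G i j \<zeta> = 0"
        using filter complementary
        unfolding filter_matrix_def complementary_filter_def supported_matrix_def by blast+
      then show ?thesis by eventually_elim auto
    qed auto
  qed
  have prod: "AE \<omega> in \<mu>. \<forall>i i'. i \<ge> 1 \<longrightarrow> i' \<ge> 1 \<longrightarrow>
      filter_product \<alpha> H H i i' \<omega> = of_nat N * (if i = i' then 1 else 0) * indicator (level m i) \<omega> \<and>
      filter_product \<alpha> G G i i' \<omega> = of_nat N * (if i = i' then 1 else 0) * indicator (level m' i) \<omega> \<and>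
      filter_product \<alpha> G H i i' \<omega> = 0"
    unfolding AE_all_countable
  proof (intro allI)
    fix i i' :: nat
    show "AE \<omega> in \<mu>. i \<ge> 1 \<longrightarrow> i' \<ge> 1 \<longrightarrow>
      filter_product \<alpha> H H i i' \<omega> = of_nat N * (if i = i' then 1 else 0) * indicator (level m i) \<omega> \<and>
      filter_product \<alpha> G G i i' \<omega> = of_nat N * (if i = i' then 1 else 0) * indicator (level m' i) \<omega> \<and>
      filter_product \<alpha> G H i i' \<omega> = 0"
    proof (cases "i \<ge> 1 \<and> i' \<ge> 1")
      case True
      then have "AE \<omega> in \<mu>. filter_product \<alpha> H H i i' \<omega> = of_nat N * (if i = i' then 1 else 0) * indicator (level m i) \<omega>"
        "AE \<omega> in \<mu>. filter_product \<alpha> G G i i' \<omega> = of_nat N * (if i = i' then 1 else 0) * indicator (level m' i) \<omega>"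
        "AE \<omega> in \<mu>. filter_product \<alpha> G H i i' \<omega> = 0"
        using filter complementary unfolding filter_matrix_def complementary_filter_def by blast+
      then show ?thesis by eventually_elim blast
    qed auto
  qed
  show ?thesis
    using AE_fiber[OF supp] prod consistent[unfolded consistency_inequality_def] AE_space
    by eventually_elim (simp add: regular_def)
qed

context
  fixes \<omega> :: "'g character"
  assumes regular: "regular \<omega>"
begin

lemma regular_dual: "\<omega> \<in> dual_group"
  using regular by (simp add: regular_def)

lemma finite_rows: "finite (rows \<omega>)"
  by (simp add: rows_def)

lemma finite_columns: "finite (columns \<omega>)"
  unfolding columns_def by (rule finite_SigmaI) (auto simp: regular_dual)

text \<open>The complementary multiplicity is defined so that the matrix is square.\<close>

lemma card_rows_columns: "card (rows \<omega>) = card (columns \<omega>)"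
  using regular finite_fiber[OF regular_dual]
  by (simp add: rows_def columns_def card_Plus card_SigmaI regular_def co_mult_def)

lemma sum_columns:
  "(\<Sum>p\<in>columns \<omega>. F p) = (\<Sum>\<zeta>\<in>dual_fiber \<alpha> \<omega>. \<Sum>j\<in>{1..m \<zeta>}. F (\<zeta>, j))"
  unfolding columns_def by (simp add: sum.Sigma regular_dual)

lemma filter_product_columns:
  assumes B: "\<And>\<zeta> j. \<lbrakk>\<zeta> \<in> dual_fiber \<alpha> \<omega>; j \<ge> 1; \<zeta> \<notin> level m j\<rbrakk> \<Longrightarrow> B i' j \<zeta> = 0"
  shows "filter_product \<alpha> A B i i' \<omega> = (\<Sum>p\<in>columns \<omega>. A i (snd p) (fst p) * cnj (B i' (snd p) (fst p)))"
proof -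
  have "(\<Sum>\<^sub>\<infinity>j\<in>{1..}. A i j \<zeta> * cnj (B i' j \<zeta>)) = (\<Sum>j\<in>{1..m \<zeta>}. A i j \<zeta> * cnj (B i' j \<zeta>))"
    if \<zeta>: "\<zeta> \<in> dual_fiber \<alpha> \<omega>" for \<zeta>
  proof -
    have "(\<Sum>\<^sub>\<infinity>j\<in>{1..}. A i j \<zeta> * cnj (B i' j \<zeta>)) = (\<Sum>\<^sub>\<infinity>j\<in>{1..m \<zeta>}. A i j \<zeta> * cnj (B i' j \<zeta>))"
      by (rule infsum_cong_neutral) (use B[OF \<zeta>] in \<open>auto simp: level_def\<close>)
    then show ?thesis by simp
  qed
  then show ?thesis
    by (simp add: filter_product_def sum_columns)
qed

lemma rows_orthogonal:
  assumes r: "r \<in> rows \<omega>" "r' \<in> rows \<omega>"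
  shows "(\<Sum>p\<in>columns \<omega>. entry r p * cnj (entry r' p)) = of_nat N * (if r = r' then 1 else 0)"
proof -
  have supp: "H i j \<zeta> = 0" "G i j \<zeta> = 0"
    if "\<zeta> \<in> dual_fiber \<alpha> \<omega>" "i \<ge> 1" "j \<ge> 1" "\<zeta> \<notin> level m j" for i j \<zeta>
    using regular that by (auto simp: regular_def)
  have HH: "(\<Sum>p\<in>columns \<omega>. H i (snd p) (fst p) * cnj (H i' (snd p) (fst p))) = of_nat N * (if i = i' then 1 else 0)"
    if "i \<in> {1..m \<omega>}" "i' \<in> {1..m \<omega>}" for i i'
    using that regular filter_product_columns[of H i' H i] supp by (simp add: regular_def level_def)
  have GG: "(\<Sum>p\<in>columns \<omega>. G i (snd p) (fst p) * cnj (G i' (snd p) (fst p))) = of_nat N * (if i = i' then 1 else 0)"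
    if "i \<in> {1..m' \<omega>}" "i' \<in> {1..m' \<omega>}" for i i'
    using that regular filter_product_columns[of G i' G i] supp by (simp add: regular_def level_def)
  have GH: "(\<Sum>p\<in>columns \<omega>. G k (snd p) (fst p) * cnj (H i (snd p) (fst p))) = 0"
    if "k \<ge> 1" "i \<ge> 1" for k i
    using that regular filter_product_columns[of H i G k] supp by (simp add: regular_def)
  have HG: "(\<Sum>p\<in>columns \<omega>. H i (snd p) (fst p) * cnj (G k (snd p) (fst p))) = 0"
    if "k \<ge> 1" "i \<ge> 1" for k i
    using arg_cong[OF GH[OF that], of cnj] by (simp add: mult.commute)
  show ?thesis
    using r by (auto simp: rows_def entry_def HH GG GH HG split: if_splits)
qed

text \<open>Off its level set, the filter equation gives row \<open>i\<close> norm zero.\<close>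

lemma row_vanishes_off_level:
  assumes "i \<ge> 1" "\<omega> \<notin> level m i" "\<zeta> \<in> dual_fiber \<alpha> \<omega>" "j \<ge> 1"
  shows "H i j \<zeta> = 0"
proof (cases "\<zeta> \<in> level m j")
  case True
  have supp: "H i j \<zeta> = 0"
    if "\<zeta> \<in> dual_fiber \<alpha> \<omega>" "j \<ge> 1" "\<zeta> \<notin> level m j" for j \<zeta>
    using regular that assms(1) by (auto simp: regular_def)
  have "(\<Sum>p\<in>columns \<omega>. H i (snd p) (fst p) * cnj (H i (snd p) (fst p))) = 0"
    using filter_product_columns[of H i H i] supp regular assms(1,2) by (simp add: regular_def)
  then have "complex_of_real (\<Sum>p\<in>columns \<omega>. (cmod (H i (snd p) (fst p)))\<^sup>2) = 0"
    by (simp add: complex_norm_square del: of_real_power)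
  then have "(\<Sum>p\<in>columns \<omega>. (cmod (H i (snd p) (fst p)))\<^sup>2) = 0" by (simp only: of_real_eq_0_iff)
  then have "\<forall>p\<in>columns \<omega>. (cmod (H i (snd p) (fst p)))\<^sup>2 = 0"
    by (subst (asm) sum_nonneg_eq_0_iff) (auto simp: finite_columns)
  moreover have "(\<zeta>, j) \<in> columns \<omega>" using True assms(3,4) by (auto simp: columns_def level_def)
  ultimately show ?thesis by force
next
  case False
  then show ?thesis using regular assms by (auto simp: regular_def)
qed

end

definition fold_fun :: "(nat \<Rightarrow> 'g character \<Rightarrow> complex) \<Rightarrow> (nat \<Rightarrow> 'g character \<Rightarrow> complex)
    \<Rightarrow> nat \<Rightarrow> 'g character \<Rightarrow> complex" where
  "fold_fun f g j \<eta> = (\<Sum>i\<in>{1..m (dual_endo \<alpha> \<eta>)}. H i j \<eta> * f i (dual_endo \<alpha> \<eta>)) +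
    (\<Sum>k\<in>{1..m' (dual_endo \<alpha> \<eta>)}. G k j \<eta> * g k (dual_endo \<alpha> \<eta>))"

lemma fold_fun_rows:
  assumes "\<zeta> \<in> dual_fiber \<alpha> \<omega>"
  shows "fold_fun f g j \<zeta> = (\<Sum>r\<in>rows \<omega>. case_sum (\<lambda>i. f i \<omega>) (\<lambda>k. g k \<omega>) r * entry r (\<zeta>, j))"
  using fiberD(2)[OF assms] by (simp add: fold_fun_def rows_def sum.Plus entry_def mult.commute)

lemma filter_entry_measurable: "\<lbrakk>i \<ge> 1; j \<ge> 1\<rbrakk> \<Longrightarrow> H i j \<in> borel_measurable \<mu>"
  "\<lbrakk>i \<ge> 1; j \<ge> 1\<rbrakk> \<Longrightarrow> G i j \<in> borel_measurable \<mu>"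
  using filter complementary
  unfolding filter_matrix_def complementary_filter_def supported_matrix_def by blast+

lemma pullback_sum_measurable:
  fixes r :: "'g character \<Rightarrow> nat"
  assumes r: "r \<in> measurable \<mu> (count_space UNIV)"
    and h: "\<And>i. i \<ge> 1 \<Longrightarrow> h i \<in> borel_measurable \<mu>" and f: "\<And>i. f i \<in> borel_measurable \<mu>"
  shows "(\<lambda>\<eta>. \<Sum>i\<in>{1..r (dual_endo \<alpha> \<eta>)}. h i \<eta> * f i (dual_endo \<alpha> \<eta>) :: complex) \<in> borel_measurable \<mu>"
proof (rule level_sum_measurable[where r="\<lambda>\<eta>. r (dual_endo \<alpha> \<eta>)"])
  show "(\<lambda>\<eta>. r (dual_endo \<alpha> \<eta>)) \<in> measurable \<mu> (count_space UNIV)"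
    by (rule measurable_compose[OF dual_endo_measurable r])
  show "(\<lambda>\<eta>. h i \<eta> * f i (dual_endo \<alpha> \<eta>)) \<in> borel_measurable \<mu>" if "i \<ge> 1" for i
    by (intro borel_measurable_times h that measurable_compose[OF dual_endo_measurable f])
qed

lemma fold_fun_measurable:
  assumes "\<And>i. f i \<in> borel_measurable \<mu>" "\<And>k. g k \<in> borel_measurable \<mu>" "j \<ge> 1"
  shows "fold_fun f g j \<in> borel_measurable \<mu>"
  unfolding fold_fun_def[abs_def]
  by (intro borel_measurable_add pullback_sum_measurable m_measurable co_mult_measurable
      filter_entry_measurable assms)

lemma ennreal_norm_sum:
  "(\<Sum>i\<in>A. ennreal ((cmod (f i))\<^sup>2)) = ennreal (\<Sum>i\<in>A. (cmod (f i))\<^sup>2)"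
  by (rule sum_ennreal) simp

text \<open>The fibre sums of the energy density of the folded function are \<open>N\<close> times the energy density
  downstairs, because the rows are orthogonal; integration divides the fibre sums by \<open>N\<close>.\<close>

lemma fold_energy:
  assumes f: "\<And>i. f i \<in> borel_measurable \<mu>" and g: "\<And>k. g k \<in> borel_measurable \<mu>"
  shows "fam_energy (level_fam \<mu> m) (fold_fun f g) = fam_energy (level_fam \<mu> m) f + fam_energy (level_fam \<mu> m') g"
proof -
  define t where "t j = (if j \<ge> 1 then fold_fun f g j else (\<lambda>_. 0))" for j
  have t: "t j \<in> borel_measurable \<mu>" for j
    by (simp add: t_def fold_fun_measurable f g)
  define \<Phi> where "\<Phi> \<eta> = (\<Sum>j\<in>{1..m \<eta>}. ennreal ((cmod (t j \<eta>))\<^sup>2))" for \<eta>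
  have \<Phi>: "\<Phi> \<in> borel_measurable \<mu>"
    unfolding \<Phi>_def[abs_def]
    by (rule level_sum_measurable[OF m_measurable]) (use t in measurable)
  have sums: "AE \<omega> in \<mu>. (\<Sum>\<zeta>\<in>dual_fiber \<alpha> \<omega>. \<Phi> \<zeta>) = of_nat N *
      ((\<Sum>i\<in>{1..m \<omega>}. ennreal ((cmod (f i \<omega>))\<^sup>2)) + (\<Sum>k\<in>{1..m' \<omega>}. ennreal ((cmod (g k \<omega>))\<^sup>2)))"
    using AE_regular
  proof eventually_elim
    case (elim \<omega>)
    let ?a = "case_sum (\<lambda>i. f i \<omega>) (\<lambda>k. g k \<omega>)"
    have "(\<Sum>\<zeta>\<in>dual_fiber \<alpha> \<omega>. \<Phi> \<zeta>) = ennreal (\<Sum>\<zeta>\<in>dual_fiber \<alpha> \<omega>. \<Sum>j\<in>{1..m \<zeta>}. (cmod (fold_fun f g j \<zeta>))\<^sup>2)"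
      unfolding \<Phi>_def ennreal_norm_sum
      by (subst sum_ennreal) (auto simp: t_def intro!: sum_nonneg sum.cong arg_cong[of _ _ ennreal])
    also have "(\<Sum>\<zeta>\<in>dual_fiber \<alpha> \<omega>. \<Sum>j\<in>{1..m \<zeta>}. (cmod (fold_fun f g j \<zeta>))\<^sup>2)
        = (\<Sum>p\<in>columns \<omega>. (cmod (\<Sum>r\<in>rows \<omega>. ?a r * entry r p))\<^sup>2)"
      unfolding sum_columns[OF elim] by (simp add: fold_fun_rows)
    also have "\<dots> = real N * (\<Sum>r\<in>rows \<omega>. (cmod (?a r))\<^sup>2)"
      by (rule row_combination_norm_real[OF finite_rows[OF elim] finite_columns[OF elim] rows_orthogonal[OF elim]])
    also have "(\<Sum>r\<in>rows \<omega>. (cmod (?a r))\<^sup>2) = (\<Sum>i\<in>{1..m \<omega>}. (cmod (f i \<omega>))\<^sup>2) + (\<Sum>k\<in>{1..m' \<omega>}. (cmod (g k \<omega>))\<^sup>2)"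
      by (simp add: rows_def sum.Plus)
    finally show ?case
      unfolding ennreal_norm_sum
      by (simp add: ennreal_mult ennreal_plus sum_nonneg ennreal_of_nat_eq_real_of_nat)
  qed
  have meas: "(\<lambda>\<omega>. \<Sum>i\<in>{1..r \<omega>}. ennreal ((cmod (f' i \<omega>))\<^sup>2)) \<in> borel_measurable \<mu>"
    if "r \<in> measurable \<mu> (count_space UNIV)" "\<And>i. f' i \<in> borel_measurable \<mu>" for r and f' :: "nat \<Rightarrow> _"
  proof (rule level_sum_measurable[OF that(1)])
    show "(\<lambda>\<omega>. ennreal ((cmod (f' i \<omega>))\<^sup>2)) \<in> borel_measurable \<mu>" for i
      using that(2)[of i] by measurable
  qed
  note meas = meas[OF m_measurable f] meas[OF co_mult_measurable g]
  have "of_nat N * (\<integral>\<^sup>+\<eta>. \<Phi> \<eta> \<partial>\<mu>) = (\<integral>\<^sup>+\<omega>. (\<Sum>\<zeta>\<in>dual_fiber \<alpha> \<omega>. \<Phi> \<zeta>) \<partial>\<mu>)"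
    by (rule nn_integral_sum_fiber[OF \<Phi>, symmetric])
  also have "\<dots> = (\<integral>\<^sup>+\<omega>. of_nat N *
      ((\<Sum>i\<in>{1..m \<omega>}. ennreal ((cmod (f i \<omega>))\<^sup>2)) + (\<Sum>k\<in>{1..m' \<omega>}. ennreal ((cmod (g k \<omega>))\<^sup>2))) \<partial>\<mu>)"
    by (rule nn_integral_cong_AE[OF sums])
  also have "\<dots> = of_nat N * (fam_energy (level_fam \<mu> m) f + fam_energy (level_fam \<mu> m') g)"
    using meas by (simp add: nn_integral_cmult nn_integral_add level_energy m_measurable co_mult_measurable f g)
  finally have "of_nat N * (\<integral>\<^sup>+\<eta>. \<Phi> \<eta> \<partial>\<mu>) = of_nat N * (fam_energy (level_fam \<mu> m) f + fam_energy (level_fam \<mu> m') g)" .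
  then have "(\<integral>\<^sup>+\<eta>. \<Phi> \<eta> \<partial>\<mu>) = fam_energy (level_fam \<mu> m) f + fam_energy (level_fam \<mu> m') g"
    using index by (simp add: ennreal_mult_cancel_left)
  moreover have "fam_energy (level_fam \<mu> m) (fold_fun f g) = fam_energy (level_fam \<mu> m) t"
    unfolding fam_energy_def by (intro nn_integral_cong) (auto simp: t_def)
  moreover have "fam_energy (level_fam \<mu> m) t = (\<integral>\<^sup>+\<eta>. \<Phi> \<eta> \<partial>\<mu>)"
    unfolding \<Phi>_def by (rule level_energy[OF m_measurable t])
  ultimately show ?thesis by simp
qed

text \<open>Surjectivity: since the matrix over a regular point is square, a function upstairs is recovered
  from its coefficients with respect to the rows.\<close>

lemma fold_surj:
  assumes h: "\<And>j. h j \<in> borel_measurable \<mu>"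
  obtains f g where "\<And>i. f i \<in> borel_measurable \<mu>" "\<And>k. g k \<in> borel_measurable \<mu>"
    "fam_class (level_fam \<mu> m) (fold_fun f g) = fam_class (level_fam \<mu> m) h"
proof -
  define coef where "coef A \<omega> = (\<Sum>\<zeta>\<in>dual_fiber \<alpha> \<omega>. \<Sum>j\<in>{1..m \<zeta>}. h j \<zeta> * cnj (A j \<zeta>)) / of_nat N"
    for A :: "nat \<Rightarrow> 'g character \<Rightarrow> complex" and \<omega>
  define f where "f i = (if i \<ge> 1 then coef (H i) else (\<lambda>_. 0))" for i :: nat
  define g where "g k = (if k \<ge> 1 then coef (G k) else (\<lambda>_. 0))" for k :: nat
  have coef: "coef A \<in> borel_measurable \<mu>" if A: "\<And>j. j \<ge> 1 \<Longrightarrow> A j \<in> borel_measurable \<mu>" for A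
    unfolding coef_def[abs_def]
    by (intro borel_measurable_divide borel_measurable_const sum_fiber_measurable
        level_sum_measurable[OF m_measurable] borel_measurable_times h borel_measurable_cnj A)
  have "f i \<in> borel_measurable \<mu>" for i
    by (simp add: f_def coef filter_entry_measurable)
  moreover have "g k \<in> borel_measurable \<mu>" for k
    by (simp add: g_def coef filter_entry_measurable)
  moreover have "fam_class (level_fam \<mu> m) (fold_fun f g) = fam_class (level_fam \<mu> m) h"
  proof (rule fam_class_eqI)
    fix j assume "j \<in> fst (level_fam \<mu> m)"
    then have j: "j \<ge> 1" by simp
    show "AE \<eta> in snd (level_fam \<mu> m) j. fold_fun f g j \<eta> = h j \<eta>"
      unfolding snd_level_fam AE_level[OF m_measurable]
      using AE_dual_endo[OF AE_regular] AE_space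
    proof eventually_elim
      case (elim \<eta>)
      let ?\<omega> = "dual_endo \<alpha> \<eta>"
      show ?case
      proof
        assume \<eta>: "\<eta> \<in> level m j"
        have fib: "\<eta> \<in> dual_fiber \<alpha> ?\<omega>" using elim(2) by (simp add: dual_fiber_def)
        have p: "(\<eta>, j) \<in> columns ?\<omega>" using \<eta> j fib by (auto simp: columns_def level_def)
        have coef_eq: "case_sum (\<lambda>i. f i ?\<omega>) (\<lambda>k. g k ?\<omega>) r
            = (\<Sum>q\<in>columns ?\<omega>. h (snd q) (fst q) * cnj (entry r q)) / of_nat N" if "r \<in> rows ?\<omega>" for r
          using that unfolding sum_columns[OF elim(1)]
          by (auto simp: rows_def f_def g_def coef_def entry_def)
        have "fold_fun f g j \<eta> = (\<Sum>r\<in>rows ?\<omega>.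
            ((\<Sum>q\<in>columns ?\<omega>. h (snd q) (fst q) * cnj (entry r q)) / of_nat N) * entry r (\<eta>, j))"
          unfolding fold_fun_rows[OF fib] by (intro sum.cong refl) (simp only: coef_eq)
        also have "\<dots> = h j \<eta>"
          using row_expansion[OF finite_rows[OF elim(1)] finite_columns[OF elim(1)] rows_orthogonal[OF elim(1)]
            card_rows_columns[OF elim(1)] index p, of "\<lambda>q. h (snd q) (fst q)"] by simp
        finally show "fold_fun f g j \<eta> = h j \<eta>" .
      qed
    qed
  qed
  ultimately show ?thesis by (rule that)
qed

lemma ruelle_fold:
  assumes f: "\<And>i. f i \<in> borel_measurable \<mu>" and g: "\<And>k. g k \<in> borel_measurable \<mu>"
  shows "hadd (L2_sum (level_fam \<mu> m)) (ruelle \<mu> \<alpha> m m H (fam_class (level_fam \<mu> m) f))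
      (ruelle \<mu> \<alpha> m' m G (fam_class (level_fam \<mu> m') g)) = fam_class (level_fam \<mu> m) (fold_fun f g)"
proof -
  have meas: "fam_measurable (level_fam \<mu> m) (\<lambda>j \<eta>. \<Sum>i\<in>{1..r (dual_endo \<alpha> \<eta>)}. A i j \<eta> * f i (dual_endo \<alpha> \<eta>))"
    if "r \<in> measurable \<mu> (count_space UNIV)" "\<And>i. f i \<in> borel_measurable \<mu>"
      "\<And>i j. \<lbrakk>i \<ge> 1; j \<ge> 1\<rbrakk> \<Longrightarrow> A i j \<in> borel_measurable \<mu>" for r :: "_ \<Rightarrow> nat" and f A
    unfolding fam_measurable_def snd_level_fam fst_level_fam
    by (intro ballI measurable_restrict_space1 pullback_sum_measurable that)
      auto
  show ?thesis
    unfolding ruelle_class[OF m_measurable m_measurable f] ruelle_class[OF co_mult_measurable m_measurable g]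
    unfolding fold_fun_def[abs_def]
    by (intro fam_class_add meas m_measurable co_mult_measurable f g filter_entry_measurable)
qed

definition fold_op :: "(nat \<Rightarrow> ('g character \<Rightarrow> complex) set) \<times> (nat \<Rightarrow> ('g character \<Rightarrow> complex) set)
    \<Rightarrow> nat \<Rightarrow> ('g character \<Rightarrow> complex) set" where
  "fold_op x = hadd (L2_sum (level_fam \<mu> m)) (ruelle \<mu> \<alpha> m m H (fst x)) (ruelle \<mu> \<alpha> m' m G (snd x))"

lemma fold_unitary:
  "unitary_op (hprod (L2_sum (level_fam \<mu> m)) (L2_sum (level_fam \<mu> m'))) (L2_sum (level_fam \<mu> m)) fold_op"
proof -
  let ?V = "L2_sum (level_fam \<mu> m)" and ?W = "L2_sum (level_fam \<mu> m')"
  let ?cV = "fam_class (level_fam \<mu> m)" and ?cW = "fam_class (level_fam \<mu> m')"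
  note inner = complex_inner_space_L2_sum
  interpret V: complex_inner_space ?V by (rule inner)
  interpret VW: complex_inner_space "hprod ?V ?W" by (intro complex_inner_space_hprod inner)
  have cases: "\<exists>f g. (\<forall>i. f i \<in> borel_measurable \<mu>) \<and> (\<forall>k. g k \<in> borel_measurable \<mu>) \<and> x = (?cV f, ?cW g)"
    if x: "x \<in> hcarrier (hprod ?V ?W)" for x
  proof -
    have "fst x \<in> hcarrier ?V" "snd x \<in> hcarrier ?W" using x by auto
    then obtain f g where "\<And>i. f i \<in> borel_measurable \<mu>" "fst x = ?cV f"
      "\<And>k. g k \<in> borel_measurable \<mu>" "snd x = ?cW g"
      using level_L2_cases[OF m_measurable] level_L2_cases[OF co_mult_measurable] by metis
    then show ?thesis by (metis prod.collapse)
  qed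
  have fold: "fold_op (?cV f, ?cW g) = ?cV (fold_fun f g)"
    if "\<forall>i. f i \<in> borel_measurable \<mu>" "\<forall>k. g k \<in> borel_measurable \<mu>" for f g
    using that by (simp add: fold_op_def ruelle_fold)
  have lev: "fam_measurable (level_fam \<mu> r) f" if "\<forall>i. f i \<in> borel_measurable \<mu>" for f r
    using that by (simp add: fam_measurable_level)
  have foldm: "fam_measurable (level_fam \<mu> m) (fold_fun f g)"
    if "\<forall>i. f i \<in> borel_measurable \<mu>" "\<forall>k. g k \<in> borel_measurable \<mu>" for f g
    using that by (auto simp: fam_measurable_def intro!: measurable_restrict_space1 fold_fun_measurable)
  have closed_iff: "(?cV f, ?cW g) \<in> hcarrier (hprod ?V ?W) \<longleftrightarrow> ?cV (fold_fun f g) \<in> hcarrier ?V"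
    if "\<forall>i. f i \<in> borel_measurable \<mu>" "\<forall>k. g k \<in> borel_measurable \<mu>" for f g
    using that by (simp add: fam_class_closed_iff lev foldm fold_energy)
  show ?thesis
  proof (rule unitary_opI[OF VW.complex_inner_space_axioms inner])
    show "linear_op (hprod ?V ?W) ?V fold_op"
      unfolding linear_op_def
    proof (intro conjI ballI allI)
      fix x assume x: "x \<in> hcarrier (hprod ?V ?W)"
      obtain f g where f: "\<forall>i. f i \<in> borel_measurable \<mu>" and g: "\<forall>k. g k \<in> borel_measurable \<mu>"
        and xfg: "x = (?cV f, ?cW g)" using cases[OF x] by blast
      have "?cV (fold_fun f g) \<in> hcarrier ?V" using closed_iff[OF f g] x by (simp only: xfg)
      then show "fold_op x \<in> hcarrier ?V" by (simp only: xfg fold[OF f g])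
      have "fold_fun (\<lambda>i x. a * f i x) (\<lambda>i x. a * g i x) = (\<lambda>j x. a * fold_fun f g j x)" for a
        by (simp add: fold_fun_def fun_eq_iff distrib_left sum_distrib_left mult_ac)
      moreover have "fold_op (?cV (\<lambda>i x. a * f i x), ?cW (\<lambda>i x. a * g i x))
          = ?cV (fold_fun (\<lambda>i x. a * f i x) (\<lambda>i x. a * g i x))" for a
        by (rule fold) (use f g in \<open>auto intro: borel_measurable_times\<close>)
      ultimately show "fold_op (hscale (hprod ?V ?W) a x) = hscale ?V a (fold_op x)" for a
        using f g by (simp add: xfg fam_class_scale lev fold foldm)
      fix y assume y: "y \<in> hcarrier (hprod ?V ?W)"
      obtain f' g' where f': "\<forall>i. f' i \<in> borel_measurable \<mu>" and g': "\<forall>k. g' k \<in> borel_measurable \<mu>"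
        and yfg: "y = (?cV f', ?cW g')" using cases[OF y] by blast
      have "fold_fun (\<lambda>i x. f i x + f' i x) (\<lambda>i x. g i x + g' i x) = (\<lambda>j x. fold_fun f g j x + fold_fun f' g' j x)"
        by (simp add: fold_fun_def fun_eq_iff distrib_left sum.distrib algebra_simps)
      moreover have "fold_op (?cV (\<lambda>i x. f i x + f' i x), ?cW (\<lambda>i x. g i x + g' i x))
          = ?cV (fold_fun (\<lambda>i x. f i x + f' i x) (\<lambda>i x. g i x + g' i x))"
        by (rule fold) (use f g f' g' in \<open>auto intro: borel_measurable_add\<close>)
      ultimately show "fold_op (hadd (hprod ?V ?W) x y) = hadd ?V (fold_op x) (fold_op y)"
        using f g f' g' by (simp add: xfg yfg fam_class_add lev fold foldm)
    qed
    show "hnorm ?V (fold_op x) = hnorm (hprod ?V ?W) x" if x: "x \<in> hcarrier (hprod ?V ?W)" for x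
    proof -
      obtain f g where f: "\<forall>i. f i \<in> borel_measurable \<mu>" and g: "\<forall>k. g k \<in> borel_measurable \<mu>"
        and xfg: "x = (?cV f, ?cW g)" using cases[OF x] by blast
      have c: "?cV f \<in> hcarrier ?V" "?cW g \<in> hcarrier ?W" "?cV (fold_fun f g) \<in> hcarrier ?V"
        using x closed_iff[OF f g] by (auto simp: xfg)
      have "ennreal ((hnorm ?V (fold_op x))\<^sup>2) = ennreal ((hnorm ?V (?cV f))\<^sup>2) + ennreal ((hnorm ?W (?cW g))\<^sup>2)"
        using c fam_class_energy[OF lev[OF f], of m] fam_class_energy[OF lev[OF g], of m'] fam_class_energy[OF foldm[OF f g]]
        by (simp add: xfg fold f g fold_energy)
      also have "\<dots> = ennreal ((hnorm (hprod ?V ?W) x)\<^sup>2)"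
        unfolding norm_sq_hprod[OF inner inner x] by (simp add: xfg ennreal_plus)
      finally have "(hnorm ?V (fold_op x))\<^sup>2 = (hnorm (hprod ?V ?W) x)\<^sup>2" by simp
      moreover have "fold_op x \<in> hcarrier ?V" using c(3) by (simp add: xfg fold f g)
      ultimately show ?thesis using x by (simp only: power2_eq_iff_nonneg V.hnorm_nonneg VW.hnorm_nonneg)
    qed
    show "\<exists>x\<in>hcarrier (hprod ?V ?W). fold_op x = y" if y: "y \<in> hcarrier ?V" for y
    proof -
      obtain h where h: "\<And>j. h j \<in> borel_measurable \<mu>" "y = ?cV h"
        by (rule level_L2_cases[OF m_measurable y], rule that) simp_all
      obtain f g where f: "\<forall>i. f i \<in> borel_measurable \<mu>" and g: "\<forall>k. g k \<in> borel_measurable \<mu>"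
        and fg: "?cV (fold_fun f g) = ?cV h"
        by (rule fold_surj[OF h(1)], rule that) simp_all
      have "(?cV f, ?cW g) \<in> hcarrier (hprod ?V ?W)"
        using closed_iff[OF f g] y h(2) fg by simp
      moreover have "fold_op (?cV f, ?cW g) = y" using fold[OF f g] fg h(2) by simp
      ultimately show ?thesis by blast
    qed
  qed
qed

text \<open>Both Ruelle operators compose with \<open>\<alpha>\<^sup>*\<close>, and \<open>(\<alpha>\<^sup>* \<omega>)(\<gamma>) = \<omega>(\<alpha> \<gamma>)\<close>.\<close>

lemma fold_rep:
  assumes v: "v \<in> hcarrier (L2_sum (level_fam \<mu> m))" and w: "w \<in> hcarrier (L2_sum (level_fam \<mu> m'))"
  shows "fold_op (mult_rep (level_fam \<mu> m) \<gamma> v, mult_rep (level_fam \<mu> m') \<gamma> w)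
    = mult_rep (level_fam \<mu> m) (\<alpha> \<gamma>) (fold_op (v, w))"
proof -
  obtain f where f: "\<And>i. f i \<in> borel_measurable \<mu>" "v = fam_class (level_fam \<mu> m) f"
    by (rule level_L2_cases[OF m_measurable v], rule that) simp_all
  obtain g where g: "\<And>i. g i \<in> borel_measurable \<mu>" "w = fam_class (level_fam \<mu> m') g"
    by (rule level_L2_cases[OF co_mult_measurable w], rule that) simp_all
  have rep: "(\<lambda>\<omega>. \<omega> \<gamma> * f' i \<omega>) \<in> borel_measurable \<mu>" if "\<And>i. f' i \<in> borel_measurable \<mu>" for f' :: "nat \<Rightarrow> _" and i
    using that by (intro borel_measurable_times coordinate)
  have foldm: "fam_measurable (level_fam \<mu> m) (fold_fun f g)"
    using f g by (auto simp: fam_measurable_def intro!: measurable_restrict_space1 fold_fun_measurable)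
  have "fold_fun (\<lambda>i \<omega>. \<omega> \<gamma> * f i \<omega>) (\<lambda>i \<omega>. \<omega> \<gamma> * g i \<omega>) = (\<lambda>j \<omega>. \<omega> (\<alpha> \<gamma>) * fold_fun f g j \<omega>)"
    by (simp add: fold_fun_def fun_eq_iff distrib_left sum_distrib_left mult_ac dual_endo_def[of \<alpha> _] )
  then show ?thesis
    using ruelle_fold[of "\<lambda>i \<omega>. \<omega> \<gamma> * f i \<omega>" "\<lambda>i \<omega>. \<omega> \<gamma> * g i \<omega>"] rep[OF f(1)] rep[OF g(1)] ruelle_fold[OF f(1) g(1)]
    by (simp add: fold_op_def f(2) g(2) mult_rep_class fam_measurable_level f(1) g(1) foldm)
qed

end

section \<open>Dilation by the dual endomorphism\<close>

context dual_system
begin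

lemma measurable_restrict_borel:
  assumes "h \<in> borel_measurable \<mu>" "S \<subseteq> dual_group"
  shows "h \<in> borel_measurable (restrict_space borel S)"
  using measurable_restrict_space1[OF assms(1), of S] sets_restrict_mu[OF assms(2)]
  by (simp cong: measurable_cong_sets)

lemma sets_mu_borel: "A \<in> sets \<mu> \<Longrightarrow> A \<in> sets borel"
  using sets_restrict_space_iff[of dual_group borel A] dual_group_borel sets_mu by simp

lemma sets_mu_iff: "A \<in> sets \<mu> \<longleftrightarrow> A \<in> sets borel \<and> A \<subseteq> dual_group"
  using sets_restrict_space_iff[of dual_group borel A] dual_group_borel sets_mu by auto

text \<open>The maps \<open>\<omega> \<mapsto> \<zeta>\<^sup>-\<^sup>1 c(\<omega>)\<close> are the inverse branches of \<open>\<alpha>\<^sup>*\<close>: the one for \<open>\<zeta>\<close> inverts it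
  on the set where the section shift equals \<open>\<zeta>\<close>.\<close>

definition branch :: "'g character \<Rightarrow> 'g character \<Rightarrow> 'g character" where
  "branch \<zeta> \<omega> = char_mult (char_inv \<zeta>) (c \<omega>)"

lemma branch_closed: "\<lbrakk>\<zeta> \<in> dual_ker \<alpha>; \<omega> \<in> dual_group\<rbrakk> \<Longrightarrow> branch \<zeta> \<omega> \<in> dual_group"
  by (simp add: branch_def ker_dual)

lemma dual_endo_branch:
  assumes "\<zeta> \<in> dual_ker \<alpha>" "\<omega> \<in> dual_group"
  shows "dual_endo \<alpha> (branch \<zeta> \<omega>) = \<omega>"
  using assms by (simp add: branch_def dual_endo_mult dual_endo_inv c_section)
    (simp add: dual_ker_def char_mult_def char_inv_def)

lemma section_shift_branch:
  assumes "\<zeta> \<in> dual_ker \<alpha>" "\<omega> \<in> dual_group"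
  shows "section_shift \<alpha> c (branch \<zeta> \<omega>) = \<zeta>"
  using dual_endo_branch[OF assms] dual_groupD(3)[OF c_closed[OF assms(2)]] dual_groupD(3)[OF ker_dual[OF assms(1)]]
  by (simp add: section_shift_def) (simp add: branch_def char_mult_def char_inv_def fun_eq_iff field_simps)

lemma branch_dual_endo:
  assumes "\<omega> \<in> dual_group"
  shows "branch (section_shift \<alpha> c \<omega>) (dual_endo \<alpha> \<omega>) = \<omega>"
  using dual_groupD(3)[OF c_closed[OF dual_endo_closed[OF assms]]] dual_groupD(3)[OF assms]
  by (simp add: branch_def section_shift_def char_mult_def char_inv_def fun_eq_iff field_simps)

lemma section_shift_ker:
  assumes "\<omega> \<in> dual_group"
  shows "section_shift \<alpha> c \<omega> \<in> dual_ker \<alpha>"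
proof -
  have "dual_endo \<alpha> (section_shift \<alpha> c \<omega>) = (\<lambda>_. 1)"
    using assms dual_groupD(3)[OF dual_endo_closed[OF assms]]
    by (simp add: section_shift_def dual_endo_mult dual_endo_inv c_section)
      (simp add: char_mult_def char_inv_def)
  then show ?thesis using assms by (simp add: dual_ker_def section_shift_def)
qed

lemma section_shift_measurable: "section_shift \<alpha> c \<in> measurable \<mu> \<mu>"
proof (rule measurable_into_haar[OF haar])
  have "(\<lambda>\<omega>. c (dual_endo \<alpha> \<omega>) \<gamma>) \<in> borel_measurable \<mu>" for \<gamma>
    by (intro measurable_compose[OF dual_endo_measurable] measurable_compose[OF c_measurable] coordinate)
  then show "(\<lambda>\<omega>. section_shift \<alpha> c \<omega> \<gamma>) \<in> borel_measurable \<mu>" for \<gamma>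
    unfolding section_shift_def char_mult_def char_inv_def
    by (intro borel_measurable_times borel_measurable_inverse coordinate)
qed (auto simp: section_shift_def)

text \<open>The pieces of the space of \<open>\<nu>\<close> on which \<open>\<alpha>\<^sup>*\<close> is injective.\<close>

definition part :: "'g character measure \<Rightarrow> 'g character \<Rightarrow> 'g character set" where
  "part \<nu> \<zeta> = {\<omega> \<in> space \<nu>. section_shift \<alpha> c \<omega> = \<zeta>}"

context
  fixes \<nu> :: "'g character measure"
  assumes sets_nu: "sets \<nu> = sets (restrict_space borel (space \<nu>))"
    and space_nu: "space \<nu> \<in> sets borel" "space \<nu> \<subseteq> dual_group"
    and finite_nu: "finite_measure \<nu>"
begin

lemma part_sets: "part \<nu> \<zeta> \<in> sets \<nu>"
proof -
  have "{\<zeta>} \<inter> dual_group \<in> sets \<mu>"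
    unfolding sets_mu_iff by (intro conjI sets.Int dual_group_borel) simp_all
  then have "section_shift \<alpha> c -` ({\<zeta>} \<inter> dual_group) \<inter> space \<mu> \<in> sets \<mu>"
    by (rule measurable_sets[OF section_shift_measurable])
  from sets_mu_borel[OF this]
  have "section_shift \<alpha> c -` ({\<zeta>} \<inter> dual_group) \<inter> dual_group \<in> sets borel" by simp
  moreover have "part \<nu> \<zeta> = space \<nu> \<inter> (section_shift \<alpha> c -` ({\<zeta>} \<inter> dual_group) \<inter> dual_group)"
    using space_nu(2) section_shift_ker ker_dual by (auto simp: part_def)
  ultimately show ?thesis unfolding sets_nu by (auto simp: sets_restrict_space)
qed

lemma part_image:
  assumes "\<zeta> \<in> dual_ker \<alpha>"
  shows "dual_endo \<alpha> ` part \<nu> \<zeta> = branch \<zeta> -` space \<nu> \<inter> dual_group"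
proof (intro equalityI subsetI)
  fix \<eta> assume "\<eta> \<in> dual_endo \<alpha> ` part \<nu> \<zeta>"
  then obtain \<omega> where \<omega>: "\<omega> \<in> part \<nu> \<zeta>" "\<eta> = dual_endo \<alpha> \<omega>" by blast
  then have "\<omega> \<in> dual_group" using space_nu(2) by (auto simp: part_def)
  then show "\<eta> \<in> branch \<zeta> -` space \<nu> \<inter> dual_group"
    using \<omega> branch_dual_endo[of \<omega>] by (auto simp: part_def)
next
  fix \<omega> assume "\<omega> \<in> branch \<zeta> -` space \<nu> \<inter> dual_group"
  then have \<omega>: "branch \<zeta> \<omega> \<in> space \<nu>" "\<omega> \<in> dual_group" by auto
  then show "\<omega> \<in> dual_endo \<alpha> ` part \<nu> \<zeta>"
    using dual_endo_branch[OF assms \<omega>(2)] section_shift_branch[OF assms \<omega>(2)]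
    by (intro image_eqI[of _ _ "branch \<zeta> \<omega>"]) (auto simp: part_def)
qed

lemma branch_coordinate_measurable:
  assumes "\<zeta> \<in> dual_ker \<alpha>"
  shows "(\<lambda>\<omega>. branch \<zeta> \<omega> \<gamma>) \<in> borel_measurable \<mu>"
  unfolding branch_def char_mult_def
  by (intro borel_measurable_times borel_measurable_const measurable_compose[OF c_measurable] coordinate)

lemma part_image_sets:
  assumes "\<zeta> \<in> dual_ker \<alpha>"
  shows "dual_endo \<alpha> ` part \<nu> \<zeta> \<in> sets borel" "dual_endo \<alpha> ` part \<nu> \<zeta> \<subseteq> dual_group"
proof -
  have "branch \<zeta> \<in> measurable \<mu> \<mu>"
    by (rule measurable_into_haar[OF haar]) (auto simp: branch_closed assms branch_coordinate_measurable)
  then have "branch \<zeta> -` space \<nu> \<inter> space \<mu> \<in> sets \<mu>"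
    by (rule measurable_sets) (use space_nu in \<open>simp add: sets_mu_iff\<close>)
  from sets_mu_borel[OF this]
  show "dual_endo \<alpha> ` part \<nu> \<zeta> \<in> sets borel" "dual_endo \<alpha> ` part \<nu> \<zeta> \<subseteq> dual_group"
    unfolding part_image[OF assms] by auto
qed

lemma dilate_measure_eq:
  "dilate_measure \<alpha> c \<nu> \<zeta> = scale_measure (of_nat N)
    (distr (restrict_space \<nu> (part \<nu> \<zeta>)) (restrict_space borel (dual_endo \<alpha> ` part \<nu> \<zeta>)) (dual_endo \<alpha>))"
  by (simp add: dilate_measure_def part_def Let_def)

lemma space_dilate_measure: "space (dilate_measure \<alpha> c \<nu> \<zeta>) = dual_endo \<alpha> ` part \<nu> \<zeta>"
  by (simp add: dilate_measure_eq space_scale_measure space_restrict_space)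

lemma sets_dilate_measure:
  "sets (dilate_measure \<alpha> c \<nu> \<zeta>) = sets (restrict_space borel (dual_endo \<alpha> ` part \<nu> \<zeta>))"
  by (simp add: dilate_measure_eq)

lemma space_restrict_part: "space (restrict_space \<nu> (part \<nu> \<zeta>)) = part \<nu> \<zeta>"
  by (auto simp: space_restrict_space part_def)

lemma dual_endo_part_measurable:
  "dual_endo \<alpha> \<in> measurable (restrict_space \<nu> (part \<nu> \<zeta>)) (restrict_space borel (dual_endo \<alpha> ` part \<nu> \<zeta>))"
proof (rule measurable_restrict_space2)
  show "dual_endo \<alpha> \<in> space (restrict_space \<nu> (part \<nu> \<zeta>)) \<rightarrow> dual_endo \<alpha> ` part \<nu> \<zeta>"
    by (auto simp: space_restrict_part)
  have "(\<lambda>\<omega>. \<omega> (\<alpha> \<gamma>)) \<in> borel_measurable \<nu>" for \<gamma>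
    using measurable_restrict_borel[OF coordinate space_nu(2)] sets_nu by (simp cong: measurable_cong_sets)
  then show "dual_endo \<alpha> \<in> borel_measurable (restrict_space \<nu> (part \<nu> \<zeta>))"
    unfolding dual_endo_def[abs_def]
    by (intro measurable_coordinatewise_then_product measurable_restrict_space1)
qed

lemma nn_integral_dilate_measure:
  assumes \<phi>: "\<phi> \<in> borel_measurable (dilate_measure \<alpha> c \<nu> \<zeta>)"
  shows "(\<integral>\<^sup>+\<omega>. \<phi> \<omega> \<partial>dilate_measure \<alpha> c \<nu> \<zeta>)
    = of_nat N * (\<integral>\<^sup>+\<omega>. \<phi> (dual_endo \<alpha> \<omega>) * indicator (part \<nu> \<zeta>) \<omega> \<partial>\<nu>)"
proof -
  have \<phi>': "\<phi> \<in> borel_measurable (restrict_space borel (dual_endo \<alpha> ` part \<nu> \<zeta>))"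
    using \<phi> by (simp add: sets_dilate_measure cong: measurable_cong_sets)
  then have "(\<integral>\<^sup>+\<omega>. \<phi> \<omega> \<partial>dilate_measure \<alpha> c \<nu> \<zeta>)
      = of_nat N * (\<integral>\<^sup>+\<omega>. \<phi> (dual_endo \<alpha> \<omega>) \<partial>restrict_space \<nu> (part \<nu> \<zeta>))"
    unfolding dilate_measure_eq
    by (subst nn_integral_scale_measure) (simp_all add: nn_integral_distr[OF dual_endo_part_measurable])
  then show ?thesis
    using part_sets by (simp add: nn_integral_restrict_space)
qed

lemma finite_dilate_measure: "finite_measure (dilate_measure \<alpha> c \<nu> \<zeta>)"
proof (rule finite_measureI)
  interpret \<nu>: finite_measure \<nu> by (rule finite_nu)
  have "emeasure (dilate_measure \<alpha> c \<nu> \<zeta>) (space (dilate_measure \<alpha> c \<nu> \<zeta>))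
      = (\<integral>\<^sup>+\<omega>. 1 \<partial>dilate_measure \<alpha> c \<nu> \<zeta>)" by simp
  also have "\<dots> = of_nat N * emeasure \<nu> (part \<nu> \<zeta>)"
    using part_sets by (subst nn_integral_dilate_measure) auto
  also have "\<dots> < \<infinity>"
    unfolding infinity_ennreal_def ennreal_mult_less_top
    using \<nu>.emeasure_finite[of "part \<nu> \<zeta>"] by (simp add: less_top[symmetric])
  finally show "emeasure (dilate_measure \<alpha> c \<nu> \<zeta>) (space (dilate_measure \<alpha> c \<nu> \<zeta>)) \<noteq> \<infinity>" by simp
qed

lemma branch_measurable:
  assumes \<zeta>: "\<zeta> \<in> dual_ker \<alpha>"
  shows "branch \<zeta> \<in> measurable (dilate_measure \<alpha> c \<nu> \<zeta>) \<nu>"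
proof -
  have "branch \<zeta> \<in> measurable (restrict_space borel (dual_endo \<alpha> ` part \<nu> \<zeta>)) (restrict_space borel (space \<nu>))"
  proof (rule measurable_restrict_space2)
    show "branch \<zeta> \<in> space (restrict_space borel (dual_endo \<alpha> ` part \<nu> \<zeta>)) \<rightarrow> space \<nu>"
      using part_image[OF \<zeta>] by (auto simp: space_restrict_space)
    show "branch \<zeta> \<in> borel_measurable (restrict_space borel (dual_endo \<alpha> ` part \<nu> \<zeta>))"
      by (rule measurable_coordinatewise_then_product)
        (rule measurable_restrict_borel[OF branch_coordinate_measurable[OF \<zeta>] part_image_sets(2)[OF \<zeta>]])
  qed
  then show ?thesis by (simp add: sets_dilate_measure sets_nu cong: measurable_cong_sets)
qed

lemma branch_part:
  assumes "\<omega> \<in> part \<nu> \<zeta>"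
  shows "branch \<zeta> (dual_endo \<alpha> \<omega>) = \<omega>"
  using assms space_nu(2) branch_dual_endo[of \<omega>] by (auto simp: part_def)

lemma nn_integral_branch:
  assumes \<zeta>: "\<zeta> \<in> dual_ker \<alpha>" and \<phi>: "\<phi> \<in> borel_measurable \<nu>"
  shows "(\<integral>\<^sup>+\<omega>. \<phi> (branch \<zeta> \<omega>) \<partial>dilate_measure \<alpha> c \<nu> \<zeta>)
    = of_nat N * (\<integral>\<^sup>+\<omega>. \<phi> \<omega> * indicator (part \<nu> \<zeta>) \<omega> \<partial>\<nu>)"
proof -
  have "(\<integral>\<^sup>+\<omega>. \<phi> (branch \<zeta> \<omega>) \<partial>dilate_measure \<alpha> c \<nu> \<zeta>)
      = of_nat N * (\<integral>\<^sup>+\<omega>. \<phi> (branch \<zeta> (dual_endo \<alpha> \<omega>)) * indicator (part \<nu> \<zeta>) \<omega> \<partial>\<nu>)"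
    by (rule nn_integral_dilate_measure) (rule measurable_compose[OF branch_measurable[OF \<zeta>] \<phi>])
  also have "(\<integral>\<^sup>+\<omega>. \<phi> (branch \<zeta> (dual_endo \<alpha> \<omega>)) * indicator (part \<nu> \<zeta>) \<omega> \<partial>\<nu>)
      = (\<integral>\<^sup>+\<omega>. \<phi> \<omega> * indicator (part \<nu> \<zeta>) \<omega> \<partial>\<nu>)"
    by (rule nn_integral_cong) (auto simp: indicator_def branch_part)
  finally show ?thesis .
qed

text \<open>Branches pull null sets back to null sets, because the dilated measure is an image of \<open>\<nu>\<close>.\<close>

lemma AE_branch:
  assumes \<zeta>: "\<zeta> \<in> dual_ker \<alpha>" and ae: "AE \<omega> in \<nu>. Q \<omega>"
  shows "AE \<omega> in dilate_measure \<alpha> c \<nu> \<zeta>. Q (branch \<zeta> \<omega>)"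
proof -
  obtain Z where Z: "{\<omega> \<in> space \<nu>. \<not> Q \<omega>} \<subseteq> Z" "emeasure \<nu> Z = 0" "Z \<in> sets \<nu>"
    using ae by (rule AE_E)
  have ind: "(indicator Z :: _ \<Rightarrow> ennreal) \<in> borel_measurable \<nu>" using Z(3) by simp
  have "(\<integral>\<^sup>+\<omega>. indicator Z \<omega> * indicator (part \<nu> \<zeta>) \<omega> \<partial>\<nu>) \<le> (\<integral>\<^sup>+\<omega>. indicator Z \<omega> \<partial>\<nu>)"
    by (rule nn_integral_mono) (auto simp: indicator_def)
  then have "(\<integral>\<^sup>+\<omega>. (indicator Z (branch \<zeta> \<omega>) :: ennreal) \<partial>dilate_measure \<alpha> c \<nu> \<zeta>) = 0"
    unfolding nn_integral_branch[OF \<zeta> ind] using Z by simp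
  then have "AE \<omega> in dilate_measure \<alpha> c \<nu> \<zeta>. (indicator Z (branch \<zeta> \<omega>) :: ennreal) = 0"
    by (subst (asm) nn_integral_0_iff_AE) (rule measurable_compose[OF branch_measurable[OF \<zeta>] ind])
  then show ?thesis using AE_space
  proof eventually_elim
    case (elim \<omega>)
    then have "branch \<zeta> \<omega> \<notin> Z" by (auto simp: indicator_def split: if_splits)
    moreover have "branch \<zeta> \<omega> \<in> space \<nu>" using measurable_space[OF branch_measurable[OF \<zeta>] elim(2)] .
    ultimately show ?case using Z(1) by blast
  qed
qed

end

lemma fst_dilate: "fst (dilate \<alpha> c K) = (\<lambda>((k, zs), \<zeta>). (k, \<zeta> # zs)) ` (fst K \<times> dual_ker \<alpha>)"
  by (force simp: dilate_def)

lemma dilate_index_cases: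
  assumes "i \<in> fst (dilate \<alpha> c K)"
  obtains k zs \<zeta> where "i = (k, \<zeta> # zs)" "(k, zs) \<in> fst K" "\<zeta> \<in> dual_ker \<alpha>"
  using assms by (auto simp: dilate_def)

lemma snd_dilate: "snd (dilate \<alpha> c K) (k, \<zeta> # zs) = dilate_measure \<alpha> c (snd K (k, zs)) \<zeta>"
  by (simp add: dilate_def)

lemma dual_fam_dilate:
  assumes K: "dual_fam K"
  shows "dual_fam (dilate \<alpha> c K)"
  unfolding dual_fam_def
proof (intro conjI ballI)
  show "countable (fst (dilate \<alpha> c K))"
    unfolding fst_dilate using dual_famD(1)[OF K]
    by (intro countable_image countable_SIGMA) (auto intro: countable_finite)
  fix i assume "i \<in> fst (dilate \<alpha> c K)"
  then obtain k zs \<zeta> where i: "i = (k, \<zeta> # zs)" "(k, zs) \<in> fst K" "\<zeta> \<in> dual_ker \<alpha>" by (rule dilate_index_cases)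
  note D = dual_famD(2-5)[OF K i(2)]
  show "sets (snd (dilate \<alpha> c K) i) = sets (restrict_space borel (space (snd (dilate \<alpha> c K) i)))"
    "finite_measure (snd (dilate \<alpha> c K) i)"
    unfolding i(1) snd_dilate using sets_dilate_measure[OF D] space_dilate_measure[OF D] finite_dilate_measure[OF D]
    by simp_all
  show "space (snd (dilate \<alpha> c K) i) \<in> sets borel" "space (snd (dilate \<alpha> c K) i) \<subseteq> dual_group"
    unfolding i(1) snd_dilate space_dilate_measure[OF D] by (rule part_image_sets[OF D i(3)])+
qed

definition dilate_fun :: "('g widx \<Rightarrow> 'g character \<Rightarrow> complex) \<Rightarrow> 'g widx \<Rightarrow> 'g character \<Rightarrow> complex" where
  "dilate_fun f = (\<lambda>i \<omega>. complex_of_real (1 / sqrt (real N)) * f (fst i, tl (snd i)) (branch (hd (snd i)) \<omega>))"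

lemma dilate_op_class:
  assumes K: "dual_fam K" and f: "fam_measurable K f"
  shows "dilate_op \<alpha> c K (fam_class K f) = fam_class (dilate \<alpha> c K) (dilate_fun f)"
proof -
  have "dilate_op \<alpha> c K (fam_class K f) = fam_class (dilate \<alpha> c K) (dilate_fun (fam_fun K (fam_class K f)))"
    unfolding dilate_op_def fam_class_def[of "dilate \<alpha> c K"]
    by (rule restrict_ext) (auto simp: dilate_fun_def fam_fun_def branch_def split: prod.split)
  also have "\<dots> = fam_class (dilate \<alpha> c K) (dilate_fun f)"
  proof (rule fam_class_eqI)
    fix i assume "i \<in> fst (dilate \<alpha> c K)"
    then obtain k zs \<zeta> where i: "i = (k, \<zeta> # zs)" "(k, zs) \<in> fst K" "\<zeta> \<in> dual_ker \<alpha>" by (rule dilate_index_cases)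
    show "AE \<omega> in snd (dilate \<alpha> c K) i. dilate_fun (fam_fun K (fam_class K f)) i \<omega> = dilate_fun f i \<omega>"
      unfolding i(1) snd_dilate
      using AE_branch[OF dual_famD(2-5)[OF K i(2)] i(3) fam_fun_class_AE[OF f i(2)]]
      by eventually_elim (simp add: dilate_fun_def)
  qed
  finally show ?thesis .
qed

lemma dilate_fun_measurable:
  assumes K: "dual_fam K" and f: "fam_measurable K f"
  shows "fam_measurable (dilate \<alpha> c K) (dilate_fun f)"
  unfolding fam_measurable_def
proof
  fix i assume "i \<in> fst (dilate \<alpha> c K)"
  then obtain k zs \<zeta> where i: "i = (k, \<zeta> # zs)" "(k, zs) \<in> fst K" "\<zeta> \<in> dual_ker \<alpha>" by (rule dilate_index_cases)
  have fi: "f (k, zs) \<in> borel_measurable (snd K (k, zs))" using f i(2) by (simp add: fam_measurable_def)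
  show "dilate_fun f i \<in> borel_measurable (snd (dilate \<alpha> c K) i)"
    unfolding i(1) snd_dilate dilate_fun_def fst_conv snd_conv list.sel
    by (intro borel_measurable_times borel_measurable_const
        measurable_compose[OF branch_measurable[OF dual_famD(2-5)[OF K i(2)] i(3)] fi])
qed

lemma sum_indicator_part:
  assumes "\<omega> \<in> space \<nu>" "space \<nu> \<subseteq> dual_group"
  shows "(\<Sum>\<zeta>\<in>dual_ker \<alpha>. indicator (part \<nu> \<zeta>) \<omega> :: ennreal) = 1"
proof -
  have "(\<Sum>\<zeta>\<in>dual_ker \<alpha>. indicator (part \<nu> \<zeta>) \<omega> :: ennreal)
      = (\<Sum>\<zeta>\<in>dual_ker \<alpha>. if section_shift \<alpha> c \<omega> = \<zeta> then 1 else 0)"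
    using assms(1) by (intro sum.cong refl) (auto simp: part_def indicator_def)
  also have "\<dots> = 1" using section_shift_ker[of \<omega>] assms by auto
  finally show ?thesis .
qed

text \<open>The factor \<open>N\<close> in the dilated measures cancels the factor \<open>1 / sqrt N\<close> in the operator, and
  the parts on which the branches live partition the original space.\<close>

lemma dilate_energy:
  assumes K: "dual_fam K" and f: "fam_measurable K f"
  shows "fam_energy (dilate \<alpha> c K) (dilate_fun f) = fam_energy K f"
proof -
  let ?e = "\<lambda>i. \<integral>\<^sup>+\<omega>. ennreal ((cmod (dilate_fun f i \<omega>))\<^sup>2) \<partial>snd (dilate \<alpha> c K) i"
  let ?b = "\<lambda>((k, zs), \<zeta>). (k, \<zeta> # zs)"
  have "bij_betw ?b (fst K \<times> dual_ker \<alpha>) (fst (dilate \<alpha> c K))"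
    unfolding fst_dilate by (rule inj_on_imp_bij_betw) (auto simp: inj_on_def)
  then have "fam_energy (dilate \<alpha> c K) (dilate_fun f) = (\<integral>\<^sup>+p. ?e (?b p) \<partial>count_space (fst K \<times> dual_ker \<alpha>))"
    unfolding fam_energy_def by (rule nn_integral_bij_count_space[symmetric])
  also have "\<dots> = (\<integral>\<^sup>+i. (\<Sum>\<zeta>\<in>dual_ker \<alpha>. ?e (?b (i, \<zeta>))) \<partial>count_space (fst K))"
    by (rule nn_integral_count_space_Times) simp
  also have "\<dots> = fam_energy K f"
    unfolding fam_energy_def
  proof (rule nn_integral_cong)
    fix i assume "i \<in> space (count_space (fst K))"
    then have iK: "i \<in> fst K" by simp
    obtain k zs where i: "i = (k, zs)" by (cases i)
    note D = dual_famD(2-5)[OF K iK]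
    have fi: "f i \<in> borel_measurable (snd K i)" using f iK by (simp add: fam_measurable_def)
    then have sq: "(\<lambda>\<omega>. ennreal ((cmod (f i \<omega>))\<^sup>2)) \<in> borel_measurable (snd K i)" by measurable
    have N0: "N > 0" by (rule index)
    have "?e (?b (i, \<zeta>)) = (\<integral>\<^sup>+\<omega>. ennreal ((cmod (f i \<omega>))\<^sup>2) * indicator (part (snd K i) \<zeta>) \<omega> \<partial>snd K i)"
      if \<zeta>: "\<zeta> \<in> dual_ker \<alpha>" for \<zeta>
    proof -
      have "?e (?b (i, \<zeta>)) = (\<integral>\<^sup>+\<omega>. ennreal (1 / real N) * ennreal ((cmod (f i (branch \<zeta> \<omega>)))\<^sup>2)
          \<partial>dilate_measure \<alpha> c (snd K i) \<zeta>)"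
        unfolding i by (simp add: snd_dilate dilate_fun_def norm_mult power_mult_distrib
            norm_divide power_divide ennreal_mult[symmetric])
      also have "\<dots> = ennreal (1 / real N) * (\<integral>\<^sup>+\<omega>. ennreal ((cmod (f i (branch \<zeta> \<omega>)))\<^sup>2)
          \<partial>dilate_measure \<alpha> c (snd K i) \<zeta>)"
        by (rule nn_integral_cmult) (rule measurable_compose[OF branch_measurable[OF D \<zeta>] sq])
      also have "\<dots> = (ennreal (1 / real N) * of_nat N) *
          (\<integral>\<^sup>+\<omega>. ennreal ((cmod (f i \<omega>))\<^sup>2) * indicator (part (snd K i) \<zeta>) \<omega> \<partial>snd K i)"
        unfolding nn_integral_branch[OF D \<zeta> sq] by (simp add: mult.assoc)
      also have "ennreal (1 / real N) * of_nat N = 1"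
        using N0 by (simp add: ennreal_of_nat_eq_real_of_nat ennreal_mult[symmetric])
      finally show ?thesis by simp
    qed
    then have "(\<Sum>\<zeta>\<in>dual_ker \<alpha>. ?e (?b (i, \<zeta>))) =
        (\<Sum>\<zeta>\<in>dual_ker \<alpha>. \<integral>\<^sup>+\<omega>. ennreal ((cmod (f i \<omega>))\<^sup>2) * indicator (part (snd K i) \<zeta>) \<omega> \<partial>snd K i)"
      by (intro sum.cong refl)
    also have "\<dots> = (\<integral>\<^sup>+\<omega>. (\<Sum>\<zeta>\<in>dual_ker \<alpha>. ennreal ((cmod (f i \<omega>))\<^sup>2) * indicator (part (snd K i) \<zeta>) \<omega>) \<partial>snd K i)"
      by (rule nn_integral_sum[symmetric])
        (intro borel_measurable_times_ennreal sq borel_measurable_indicator part_sets[OF D])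
    also have "\<dots> = (\<integral>\<^sup>+\<omega>. ennreal ((cmod (f i \<omega>))\<^sup>2) \<partial>snd K i)"
      by (rule nn_integral_cong) (simp add: sum_distrib_left[symmetric] sum_indicator_part D(3))
    finally show "(\<Sum>\<zeta>\<in>dual_ker \<alpha>. ?e (?b (i, \<zeta>))) = (\<integral>\<^sup>+\<omega>. ennreal ((cmod (f i \<omega>))\<^sup>2) \<partial>snd K i)" .
  qed
  finally show ?thesis .
qed

text \<open>On the part belonging to \<open>\<zeta>\<close>, a preimage of \<open>g\<close> is \<open>sqrt N g\<^sub>\<zeta> \<circ> \<alpha>\<^sup>*\<close>.\<close>

lemma dilate_surj:
  assumes K: "dual_fam K" and g: "fam_measurable (dilate \<alpha> c K) g"
  obtains f where "fam_measurable K f" "fam_class (dilate \<alpha> c K) (dilate_fun f) = fam_class (dilate \<alpha> c K) g"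
proof -
  define f where "f i \<omega> = (\<Sum>\<zeta>\<in>dual_ker \<alpha>. if \<omega> \<in> part (snd K i) \<zeta>
    then complex_of_real (sqrt (real N)) * g (fst i, \<zeta> # snd i) (dual_endo \<alpha> \<omega>) else 0)" for i \<omega>
  have "fam_measurable K f"
    unfolding fam_measurable_def
  proof
    fix i assume iK: "i \<in> fst K"
    obtain k zs where i: "i = (k, zs)" by (cases i)
    note D = dual_famD(2-5)[OF K iK]
    show "f i \<in> borel_measurable (snd K i)"
      unfolding f_def[abs_def]
    proof (rule borel_measurable_sum)
      fix \<zeta> assume \<zeta>: "\<zeta> \<in> dual_ker \<alpha>"
      have "(k, \<zeta> # zs) \<in> fst (dilate \<alpha> c K)" using iK \<zeta> unfolding fst_dilate i by force
      then have "g (k, \<zeta> # zs) \<in> borel_measurable (dilate_measure \<alpha> c (snd K i) \<zeta>)"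
        using g by (auto simp: fam_measurable_def snd_dilate i)
      then have "g (k, \<zeta> # zs) \<in> borel_measurable (restrict_space borel (dual_endo \<alpha> ` part (snd K i) \<zeta>))"
        by (simp add: sets_dilate_measure[OF D] cong: measurable_cong_sets)
      then have *: "(\<lambda>\<omega>. complex_of_real (sqrt (real N)) * g (k, \<zeta> # zs) (dual_endo \<alpha> \<omega>))
          \<in> borel_measurable (restrict_space (snd K i) (part (snd K i) \<zeta>))"
        by (intro borel_measurable_times borel_measurable_const measurable_compose[OF dual_endo_part_measurable[OF D]])
      have p: "{\<omega> \<in> space (snd K i). \<omega> \<in> part (snd K i) \<zeta>} = part (snd K i) \<zeta>" by (auto simp: part_def)
      show "(\<lambda>\<omega>. if \<omega> \<in> part (snd K i) \<zeta> then complex_of_real (sqrt (real N)) * g (fst i, \<zeta> # snd i) (dual_endo \<alpha> \<omega>) else 0)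
          \<in> borel_measurable (snd K i)"
        using * part_sets[OF D, of \<zeta>] by (subst measurable_If_restrict_space_iff) (simp_all add: p, simp add: i)
    qed
  qed
  moreover have "fam_class (dilate \<alpha> c K) (dilate_fun f) = fam_class (dilate \<alpha> c K) g"
  proof (rule fam_class_eqI, rule AE_I2)
    fix i \<omega> assume i: "i \<in> fst (dilate \<alpha> c K)" and \<omega>: "\<omega> \<in> space (snd (dilate \<alpha> c K) i)"
    obtain k zs \<zeta> where i': "i = (k, \<zeta> # zs)" "(k, zs) \<in> fst K" "\<zeta> \<in> dual_ker \<alpha>" using i by (rule dilate_index_cases)
    note D = dual_famD(2-5)[OF K i'(2)]
    have "\<omega> \<in> dual_endo \<alpha> ` part (snd K (k, zs)) \<zeta>"
      using \<omega> unfolding i'(1) snd_dilate space_dilate_measure[OF D] .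
    then have b: "branch \<zeta> \<omega> \<in> space (snd K (k, zs))" and \<omega>d: "\<omega> \<in> dual_group"
      unfolding part_image[OF D i'(3)] by auto
    have "f (k, zs) (branch \<zeta> \<omega>) = (\<Sum>\<zeta>'\<in>dual_ker \<alpha>. if \<zeta>' = \<zeta>
        then complex_of_real (sqrt (real N)) * g (k, \<zeta> # zs) \<omega> else 0)"
      unfolding f_def
      by (intro sum.cong refl)
        (auto simp: part_def b section_shift_branch[OF i'(3) \<omega>d] dual_endo_branch[OF i'(3) \<omega>d])
    also have "\<dots> = complex_of_real (sqrt (real N)) * g (k, \<zeta> # zs) \<omega>" using i'(3) by simp
    finally show "dilate_fun f i \<omega> = g i \<omega>"
      using index by (simp add: dilate_fun_def i'(1) mult.assoc[symmetric] of_real_mult[symmetric] del: of_real_mult)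
  qed
  ultimately show ?thesis by (rule that)
qed

lemma dilate_unitary:
  assumes K: "dual_fam K"
  shows "unitary_op (L2_sum K) (L2_sum (dilate \<alpha> c K)) (dilate_op \<alpha> c K)"
proof (rule unitary_op_fam_classI[where u=dilate_fun])
  show "\<exists>f. fam_measurable K f \<and> fam_class (dilate \<alpha> c K) (dilate_fun f) = fam_class (dilate \<alpha> c K) g"
    if "fam_measurable (dilate \<alpha> c K) g" for g
    by (rule dilate_surj[OF K that]) blast
qed (use dilate_op_class[OF K] dilate_fun_measurable[OF K] dilate_energy[OF K] in
    \<open>auto simp: dilate_fun_def distrib_left mult.left_commute\<close>)

lemma dilate_rep:
  assumes K: "dual_fam K" and F: "F \<in> hcarrier (L2_sum K)"
  shows "dilate_op \<alpha> c K (mult_rep K (\<alpha> \<gamma>) F) = mult_rep (dilate \<alpha> c K) \<gamma> (dilate_op \<alpha> c K F)"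
proof -
  obtain f where f: "fam_measurable K f" "F = fam_class K f"
    using F by (rule L2_sum_cases)
  show ?thesis
    unfolding f(2) mult_rep_class[OF f(1)] dilate_op_class[OF K f(1)]
      dilate_op_class[OF K mult_rep_measurable[OF K f(1)]] mult_rep_class[OF dilate_fun_measurable[OF K f(1)]]
  proof (rule fam_class_eqI, rule AE_I2)
    fix i \<omega> assume i: "i \<in> fst (dilate \<alpha> c K)" and \<omega>: "\<omega> \<in> space (snd (dilate \<alpha> c K) i)"
    obtain k zs \<zeta> where i': "i = (k, \<zeta> # zs)" "(k, zs) \<in> fst K" "\<zeta> \<in> dual_ker \<alpha>" using i by (rule dilate_index_cases)
    have "\<omega> \<in> dual_group" using dual_famD(4)[OF dual_fam_dilate[OF K] i] \<omega> by blast
    then have "branch \<zeta> \<omega> (\<alpha> \<gamma>) = \<omega> \<gamma>"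
      using fun_cong[OF dual_endo_branch[OF i'(3)], of \<omega> \<gamma>] by (simp add: dual_endo_def)
    then show "dilate_fun (\<lambda>i \<omega>. \<omega> (\<alpha> \<gamma>) * f i \<omega>) i \<omega> = \<omega> \<gamma> * dilate_fun f i \<omega>"
      by (simp add: dilate_fun_def i'(1))
  qed
qed

end

context ladder
begin

lemma in_core_iff: "f \<in> core \<longleftrightarrow> (\<exists>v\<in>hcarrier V0. f = (v, \<lambda>n. hzero (W n)))"
  by (cases f) (auto simp: core_def E_carrier)

lemma core_unitary: "unitary_op (E\<lparr>hcarrier := core\<rparr>) V0 fst"
  unfolding unitary_op_def linear_op_def
proof (intro conjI ballI allI)
  have "inj_on fst core" by (auto simp: inj_on_def in_core_iff)
  moreover have "fst ` core = hcarrier V0"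
  proof (intro equalityI subsetI)
    show "v \<in> fst ` core" if "v \<in> hcarrier V0" for v
      by (rule image_eqI[of _ _ "(v, \<lambda>n. hzero (W n))"]) (use that in \<open>auto simp: in_core_iff\<close>)
  qed (auto simp: in_core_iff)
  ultimately show "bij_betw fst (hcarrier (E\<lparr>hcarrier := core\<rparr>)) (hcarrier V0)"
    by (simp add: bij_betw_def)
  fix f g assume f: "f \<in> hcarrier (E\<lparr>hcarrier := core\<rparr>)" and g: "g \<in> hcarrier (E\<lparr>hcarrier := core\<rparr>)"
  have "(\<Sum>\<^sub>\<infinity>n. hinner (W n) (snd f n) (snd g n)) = 0"
    using f g by (intro infsum_0) (auto simp: in_core_iff)
  then show "hinner V0 (fst f) (fst g) = hinner (E\<lparr>hcarrier := core\<rparr>) f g"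
    by (simp add: E_def sum.hsum_simps)
qed (auto simp: in_core_iff E_simps)

lemma core_inverse: "v \<in> hcarrier V0 \<Longrightarrow> op_inverse (E\<lparr>hcarrier := core\<rparr>) fst v = (v, \<lambda>n. hzero (W n))"
  by (rule unitary_inverse_eqI[OF core_unitary]) (auto simp: in_core_iff)

lemma op_inverse_\<delta>: "f \<in> hcarrier E \<Longrightarrow> op_inverse E \<delta> f = T f"
  unfolding \<delta>_def by (rule op_inverse_op_inverse[OF T_unitary inner_spaces(4)])

end

section \<open>The wavelet spaces of a filter\<close>

context filter_system
begin

abbreviation "wfam \<equiv> wavelet_fam \<mu> \<alpha> c m"

lemma wfam_zero [simp]: "fst (wfam 0) = {1..} \<times> {[]}" "snd (wfam 0) (k, zs) = restrict_space \<mu> (level m' k)"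
  by simp_all

lemma dual_fam_wfam: "dual_fam (wfam n)"
proof (induction n)
  case 0
  show ?case
    using dual_famD[OF dual_fam_level[OF co_mult_measurable]] by (auto simp: dual_fam_def)
qed (simp add: dual_fam_dilate)

text \<open>The lowest rung has the indices \<open>(k, [])\<close> in place of \<open>k\<close>.\<close>

definition reindex :: "('g widx \<Rightarrow> ('g character \<Rightarrow> complex) set) \<Rightarrow> nat \<Rightarrow> ('g character \<Rightarrow> complex) set" where
  "reindex w = (\<lambda>k\<in>{1..}. w (k, []))"

lemma reindex_unitary: "unitary_op (L2_sum (wfam 0)) (L2_sum (level_fam \<mu> m')) reindex"
proof (rule unitary_op_fam_classI[where u="\<lambda>f k. f (k, [])"])
  show "reindex (fam_class (wfam 0) f) = fam_class (level_fam \<mu> m') (\<lambda>k. f (k, []))" for f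
    unfolding reindex_def fam_class_def fst_level_fam by (rule restrict_ext) simp
  show "fam_measurable (level_fam \<mu> m') (\<lambda>k. f (k, []))" if "fam_measurable (wfam 0) f" for f
    using that by (auto simp: fam_measurable_def)
  have bij: "bij_betw (\<lambda>k. (k, [])) {1..} (fst (wfam 0))" by (auto simp: bij_betw_def inj_on_def)
  show "fam_energy (level_fam \<mu> m') (\<lambda>k. f (k, [])) = fam_energy (wfam 0) f" for f
    using nn_integral_bij_count_space[OF bij, of "\<lambda>i. \<integral>\<^sup>+x. ennreal ((cmod (f i x))\<^sup>2) \<partial>snd (wfam 0) i"]
    by (simp add: fam_energy_def)
  show "\<exists>f. fam_measurable (wfam 0) f \<and> fam_class (level_fam \<mu> m') (\<lambda>k. f (k, [])) = fam_class (level_fam \<mu> m') g"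
    if "fam_measurable (level_fam \<mu> m') g" for g
    by (rule exI[of _ "\<lambda>i. g (fst i)"]) (use that in \<open>auto simp: fam_measurable_def\<close>)
qed simp_all

lemma reindex_rep: "reindex (mult_rep (wfam 0) \<gamma> w) = mult_rep (level_fam \<mu> m') \<gamma> (reindex w)"
  unfolding reindex_def mult_rep_def fst_level_fam by (rule restrict_ext) simp

definition fold_wavelet ::
  "(nat \<Rightarrow> ('g character \<Rightarrow> complex) set) \<times> ('g widx \<Rightarrow> ('g character \<Rightarrow> complex) set)
    \<Rightarrow> nat \<Rightarrow> ('g character \<Rightarrow> complex) set" where
  "fold_wavelet x = fold_op (fst x, reindex (snd x))"

lemma fold_wavelet_unitary:
  "unitary_op (hprod (L2_sum (level_fam \<mu> m)) (L2_sum (wfam 0))) (L2_sum (level_fam \<mu> m)) fold_wavelet"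
proof -
  have "unitary_op (L2_sum (level_fam \<mu> m)) (L2_sum (level_fam \<mu> m)) (\<lambda>x. x)"
    by (simp add: unitary_op_def linear_op_def bij_betw_def)
  then show ?thesis
    unfolding fold_wavelet_def[abs_def]
    by (intro unitary_op_compose[OF unitary_hprod[OF _ _ _ _ _ reindex_unitary] fold_unitary]
        complex_inner_space_L2_sum)
qed

lemma fold_wavelet_zero:
  assumes "v \<in> hcarrier (L2_sum (level_fam \<mu> m))"
  shows "fold_wavelet (v, hzero (L2_sum (wfam 0))) = ruelle \<mu> \<alpha> m m H v"
proof -
  interpret V: complex_inner_space "L2_sum (level_fam \<mu> m)" by (rule complex_inner_space_L2_sum)
  obtain f where f: "\<And>i. f i \<in> borel_measurable \<mu>" "v = fam_class (level_fam \<mu> m) f"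
    by (rule level_L2_cases[OF m_measurable assms], rule that) simp_all
  have z: "reindex (hzero (L2_sum (wfam 0))) = fam_class (level_fam \<mu> m') (\<lambda>_ _. 0)"
    using unitary_zero[OF reindex_unitary complex_inner_space_L2_sum complex_inner_space_L2_sum]
    by (simp add: L2_sum_zero[of "level_fam \<mu> m'"])
  have "fold_wavelet (v, hzero (L2_sum (wfam 0))) = fam_class (level_fam \<mu> m) (fold_fun f (\<lambda>_ _. 0))"
    using ruelle_fold[of f "\<lambda>_ _. 0", OF f(1)] 
    by (simp add: fold_wavelet_def fold_op_def z f(2) del: wavelet_fam.simps)
  also have "\<dots> = ruelle \<mu> \<alpha> m m H v"
    unfolding f(2) ruelle_class[OF m_measurable m_measurable f(1)] by (simp add: fold_fun_def[abs_def])
  finally show ?thesis .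
qed

lemma coordinate_vector_class:
  "coordinate_vector \<mu> m i = fam_class (level_fam \<mu> m) (\<lambda>j. if j = i then indicator (level m i) else (\<lambda>_. 0))"
  by (simp add: coordinate_vector_def fam_class_def)

lemma coordinate_measurable_fun:
  "(if j = i then indicator (level m i) else (\<lambda>_. 0 :: complex)) \<in> borel_measurable \<mu>"
  using level_sets[OF m_measurable, of i] by simp

lemma coordinate_vector_closed: "coordinate_vector \<mu> m i \<in> hcarrier (L2_sum (level_fam \<mu> m))"
proof -
  let ?e = "\<lambda>j. if j = i then indicator (level m i) else (\<lambda>_. 0 :: complex)"
  have "(\<Sum>j\<in>{1..m \<omega>}. ennreal ((cmod (?e j \<omega>))\<^sup>2)) \<le> 1" for \<omega>
  proof -
    have "(\<Sum>j\<in>{1..m \<omega>}. ennreal ((cmod (?e j \<omega>))\<^sup>2)) \<le> (\<Sum>j\<in>{1..m \<omega>}. if j = i then 1 else 0)"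
      by (rule sum_mono) (auto simp: indicator_def)
    also have "\<dots> \<le> 1" by simp
    finally show ?thesis .
  qed
  then have "fam_energy (level_fam \<mu> m) ?e \<le> (\<integral>\<^sup>+\<omega>. 1 \<partial>\<mu>)"
    unfolding level_energy[of m ?e, OF m_measurable coordinate_measurable_fun] by (intro nn_integral_mono)
  also have "\<dots> < \<infinity>" using haar_total[OF haar] by simp
  finally show ?thesis
    unfolding coordinate_vector_class
    using fam_class_closed_iff[OF fam_measurable_level[of ?e m, OF coordinate_measurable_fun]] by simp
qed

text \<open>The filter equation forces row \<open>i\<close> to vanish above the complement of the \<open>i\<close>-th level set, so
  the Ruelle operator returns the full row.\<close>

lemma ruelle_coordinate_vector:
  assumes i: "i \<ge> 1"
  shows "ruelle \<mu> \<alpha> m m H (coordinate_vector \<mu> m i) = fam_class (level_fam \<mu> m) (H i)"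
proof -
  let ?e = "\<lambda>j. if j = i then indicator (level m i) else (\<lambda>_. 0 :: complex)"
  have "ruelle \<mu> \<alpha> m m H (coordinate_vector \<mu> m i) = fam_class (level_fam \<mu> m)
      (\<lambda>j \<eta>. \<Sum>i'\<in>{1..m (dual_endo \<alpha> \<eta>)}. H i' j \<eta> * ?e i' (dual_endo \<alpha> \<eta>))"
    unfolding coordinate_vector_class
    by (rule ruelle_class[OF m_measurable m_measurable coordinate_measurable_fun])
  also have "\<dots> = fam_class (level_fam \<mu> m) (H i)"
  proof (rule fam_class_eqI)
    fix j assume "j \<in> fst (level_fam \<mu> m)"
    then have j: "j \<ge> 1" by simp
    show "AE \<eta> in snd (level_fam \<mu> m) j.
        (\<Sum>i'\<in>{1..m (dual_endo \<alpha> \<eta>)}. H i' j \<eta> * ?e i' (dual_endo \<alpha> \<eta>)) = H i j \<eta>"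
      unfolding snd_level_fam AE_level[OF m_measurable]
      using AE_dual_endo[OF AE_regular] AE_space
    proof eventually_elim
      case (elim \<eta>)
      have \<eta>: "\<eta> \<in> dual_group" using elim(2) by simp
      have fib: "\<eta> \<in> dual_fiber \<alpha> (dual_endo \<alpha> \<eta>)" using \<eta> by (simp add: dual_fiber_def)
      have "(\<Sum>i'\<in>{1..m (dual_endo \<alpha> \<eta>)}. H i' j \<eta> * ?e i' (dual_endo \<alpha> \<eta>))
          = (\<Sum>i'\<in>{1..m (dual_endo \<alpha> \<eta>)}. if i' = i then H i j \<eta> else 0)"
        using \<eta> by (intro sum.cong refl) (auto simp: level_def)
      also have "\<dots> = H i j \<eta>"
        using row_vanishes_off_level[OF elim(1) i _ fib j] i by (auto simp: level_def)
      finally show ?case by simp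
    qed
  qed
  finally show ?thesis .
qed

end

section \<open>The generalized multiresolution analysis\<close>

locale pure_filter_system = filter_system +
  assumes pure: "pure_isometry (L2_sum (level_fam \<mu> m)) (ruelle \<mu> \<alpha> m m H)"
begin

sublocale ladder: ladder "L2_sum (level_fam \<mu> m)" "\<lambda>n. L2_sum (wfam n)" fold_wavelet
  "\<lambda>n. dilate_op \<alpha> c (wfam n)" \<alpha> "mult_rep (level_fam \<mu> m)" "\<lambda>n. mult_rep (wfam n)"
proof (rule ladder.intro)
  let ?C = "hcarrier (L2_sum (level_fam \<mu> m))"
  note m_fam = dual_fam_level[OF m_measurable]
  show "hilbert_space (L2_sum (level_fam \<mu> m))" "hilbert_space (L2_sum (wfam n))" for n
    by (rule hilbert_space_L2_sum)+
  show "\<exists>S. countable_total (L2_sum (level_fam \<mu> m)) S" "\<exists>S. countable_total (L2_sum (wfam n)) S" for n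
    by (rule countable_total_L2_sum[OF m_fam] countable_total_L2_sum[OF dual_fam_wfam])+
  show "unitary_op (hprod (L2_sum (level_fam \<mu> m)) (L2_sum (wfam 0))) (L2_sum (level_fam \<mu> m)) fold_wavelet"
    by (rule fold_wavelet_unitary)
  show "unitary_op (L2_sum (wfam n)) (L2_sum (wfam (Suc n))) (dilate_op \<alpha> c (wfam n))" for n
    using dilate_unitary[OF dual_fam_wfam] by simp
  show "unitary_rep (L2_sum (level_fam \<mu> m)) (mult_rep (level_fam \<mu> m))"
    "unitary_rep (L2_sum (wfam n)) (mult_rep (wfam n))" for n
    by (rule mult_rep_unitary[OF m_fam] mult_rep_unitary[OF dual_fam_wfam])+
  let ?S = "\<lambda>v. fold_wavelet (v, hzero (L2_sum (wfam 0)))"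
  have "(?S ^^ n) v = (ruelle \<mu> \<alpha> m m H ^^ n) v \<and> (?S ^^ n) v \<in> ?C" if "v \<in> ?C" for n v
  proof (induction n)
    case (Suc n)
    have "ruelle \<mu> \<alpha> m m H ((ruelle \<mu> \<alpha> m m H ^^ n) v) \<in> ?C"
      using pure Suc unfolding pure_isometry_def isometry_op_def linear_op_def by metis
    moreover have "?S ((?S ^^ n) v) = ruelle \<mu> \<alpha> m m H ((?S ^^ n) v)"
      by (rule fold_wavelet_zero) (use Suc in blast)
    ultimately show ?case using conjunct1[OF Suc] by (simp only: funpow.simps comp_def)
  qed (use that in simp)
  then have "(?S ^^ n) ` ?C = (ruelle \<mu> \<alpha> m m H ^^ n) ` ?C" for n
    by (intro image_cong refl) blast
  then show "(\<Inter>n. (?S ^^ n) ` ?C) = {hzero (L2_sum (level_fam \<mu> m))}"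
    using pure by (simp add: pure_isometry_def)
  fix v w \<gamma>
  show "fold_wavelet (mult_rep (level_fam \<mu> m) \<gamma> v, mult_rep (wfam 0) \<gamma> w)
      = mult_rep (level_fam \<mu> m) (\<alpha> \<gamma>) (fold_wavelet (v, w))"
    if "v \<in> ?C" "w \<in> hcarrier (L2_sum (wfam 0))"
    using fold_rep[OF that(1) unitary_closed[OF reindex_unitary that(2)]]
    by (simp only: fold_wavelet_def reindex_rep fst_conv snd_conv)
  show "dilate_op \<alpha> c (wfam n) (mult_rep (wfam n) (\<alpha> \<gamma>) w) = mult_rep (wfam (Suc n)) \<gamma> (dilate_op \<alpha> c (wfam n) w)"
    if "w \<in> hcarrier (L2_sum (wfam n))" for n
    using dilate_rep[OF dual_fam_wfam that] by simp
qed

lemma ladder_space_eq: "ladder_space \<mu> \<alpha> c m = ladder.E"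
  by (simp add: ladder_space_def ladder.E_def)

lemma ladder_op_eq: "ladder_op \<mu> \<alpha> c m H G = ladder.T"
  by (rule ext) (simp add: ladder_op_def ladder.T_def fold_wavelet_def fold_op_def reindex_def)

lemma ladder_rep_eq: "ladder_rep \<mu> \<alpha> c m = ladder.rep"
  by (intro ext) (simp add: ladder_rep_def ladder.rep_def)

lemma ladder_core_eq: "ladder_core \<mu> \<alpha> c m = ladder.core"
  by (simp add: ladder_core_def ladder.core_def ladder_space_eq)

lemma core_multiplicity: "multiplicity_unitary \<mu> ladder.E ladder.rep ladder.core m fst"
  unfolding multiplicity_unitary_def using ladder.core_unitary by (simp add: ladder.rep_def)

lemma filter_constructed: "constructed_filter \<mu> ladder.E ladder.rep ladder.\<delta> ladder.subspace m H"
proof -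
  have core0: "ladder.subspace 0 = ladder.core" using ladder.subspace_neg[of 0] by simp
  have "fam_class (level_fam \<mu> m) (H i) = fst (op_inverse ladder.E ladder.\<delta>
      (op_inverse (ladder.E\<lparr>hcarrier := ladder.core\<rparr>) fst (coordinate_vector \<mu> m i)))" if "i \<ge> 1" for i
  proof -
    let ?x = "(coordinate_vector \<mu> m i, \<lambda>n. hzero (L2_sum (wfam n)))"
    have x: "?x \<in> ladder.core" using coordinate_vector_closed by (simp only: ladder.in_core_iff) blast
    then have "fst (op_inverse ladder.E ladder.\<delta> ?x) = fst (ladder.T ?x)"
      using ladder.op_inverse_\<delta> ladder.core_subset by auto
    also have "\<dots> = fam_class (level_fam \<mu> m) (H i)"
      using fold_wavelet_zero[OF coordinate_vector_closed] ruelle_coordinate_vector[OF that]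
      by (simp only: ladder.T_def fst_conv snd_conv)
    finally show ?thesis by (simp only: ladder.core_inverse[OF coordinate_vector_closed])
  qed
  then show ?thesis
    unfolding constructed_filter_def core0 using core_multiplicity
    by (intro exI[of _ fst] conjI allI impI) (simp_all only: fam_class_def fst_level_fam snd_level_fam)
qed

end

theorem theorem8:
  fixes \<alpha> :: "'g::{ab_group_add,countable} \<Rightarrow> 'g"
    and \<mu> :: "'g character measure"
    and c :: "'g character \<Rightarrow> 'g character"
    and m :: "'g character \<Rightarrow> nat"
    and H G :: "'g fmatrix"
  assumes "\<And>x y. \<alpha> (x + y) = \<alpha> x + \<alpha> y"
    and "inj \<alpha>"
    and "image_index \<alpha> > 1"
    and "(\<Inter>n. range (\<alpha> ^^ n)) = {0}"
    and "haar_measure \<mu>"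
    and "c \<in> measurable \<mu> \<mu>"
    and "\<And>\<omega>. \<omega> \<in> dual_group \<Longrightarrow> dual_endo \<alpha> (c \<omega>) = \<omega>"
    and "m \<in> measurable \<mu> (count_space UNIV)"
    and "consistency_inequality \<mu> \<alpha> m"
    and "filter_matrix \<mu> \<alpha> m H"
    and "pure_isometry (L2_sum (level_fam \<mu> m)) (ruelle \<mu> \<alpha> m m H)"
    and "complementary_filter \<mu> \<alpha> m H G"
  shows
    "let V = ladder_space \<mu> \<alpha> c m;
         \<pi> = ladder_rep \<mu> \<alpha> c m;
         T = ladder_op \<mu> \<alpha> c m H G;
         \<delta> = op_inverse V T;
         U = (\<lambda>j::int. op_powi V T (- j) ` ladder_core \<mu> \<alpha> c m)
     in unitary_op V V T \<and>
        (\<forall>\<gamma>. \<forall>f\<in>hcarrier V. T (\<pi> \<gamma> (op_inverse V T f)) = \<pi> (\<alpha> \<gamma>) f) \<and>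
        gmra V \<alpha> \<pi> \<delta> U \<and>
        multiplicity_function \<mu> V \<pi> (ladder_core \<mu> \<alpha> c m) m \<and>
        constructed_filter \<mu> V \<pi> \<delta> U m H"
proof -
  interpret pure_filter_system \<alpha> \<mu> c m H G
    by unfold_locales (use assms in auto)
  have U: "(\<lambda>j. op_powi ladder.E ladder.T (- j) ` ladder.core) = ladder.subspace"
    by (rule ext) (simp add: ladder.subspace_def)
  have "ladder.T (ladder.rep \<gamma> (ladder.\<delta> f)) = ladder.rep (\<alpha> \<gamma>) f" if "f \<in> hcarrier ladder.E" for \<gamma> f
    using ladder.T_rep[OF unitary_closed[OF ladder.\<delta>_unitary that]] ladder.T_\<delta>[OF that] by simp
  then show ?thesis
    unfolding Let_def ladder_space_eq ladder_op_eq ladder_rep_eq ladder_core_eq ladder.\<delta>_def[symmetric] U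
    using ladder.T_unitary ladder.gmra_ladder core_multiplicity filter_constructed m_measurable
    by (auto simp: multiplicity_function_def)
qed

end
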